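(* Let $d,e\in\mathbb{N}^*$. Let $\sigma\in\mathcal{C}^4_b(\mathbb{R}^e,\mathcal{L}(\mathbb{R}^d,\mathbb{R}^e))$ and assume that $b\in\mathcal{C}^1(\mathbb{R}^e,\mathbb{R}^e)$ and $\nabla b\in\mathcal{C}_b(\mathbb{R}^e,\mathbb{R}^{e\times e})$. Let $\beta\in(\tfrac13,\tfrac12)$ and let $\mathbf{X}\in\mathscr{C}^\beta_g([0,T];\mathbb{R}^d)$. Then for any initial condition $y_0\in\mathbb{R}^e$, there exists a unique $(Y,Y')\in\mathcal{C}^\beta_X(\mathbb{R}^e)$ such that $Y$ solves $$dY_t=b(Y_t)\,dt+\sigma(Y_t)\,d\mathbf{X}_t,\qquad Y_0=y_0,$$ on $[0,T]$ in the sense of controlled rough paths, and $Y'=\sigma(Y)$. Moreover, for $t\in[0,T]$, $$Y_t=U^{\mathbf{X};Z_t}_{t\leftarrow0},\qquad Z_t=y_0+\int_0^tW(s,Z_s)\,ds,$$ where $$W(t,z)=J^{\mathbf{X};z}_{0\leftarrow t}\;b\big(U^{\mathbf{X};z}_{t\leftarrow0}\big),\qquad(t,z)\in[0,T]\times\mathbb{R}^e.$$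
   Context: Notation: $T>0$ is fixed; $\mathbb{N}^*=\{1,2,\dots\}$; $\delta f_{s,t}=f_t-f_s$; $\mathcal{S}_{[0,T]}=\{(s,t)\in[0,T]^2:s\le t\}$. $\mathcal{C}^k_b$ is the space of bounded $k$ times continuously differentiable functions with bounded derivatives ($\mathcal{C}_b$: bounded continuous). $\mathcal{C}^\beta$ is the space of $\beta$-Hölder paths; a two-parameter function $g$ on $\mathcal{S}_{[0,T]}$ is $\gamma$-Hölder if $\sup_{s<t}|g_{s,t}|/(t-s)^\gamma<\infty$. $\mathscr{C}^\beta_g([0,T];\mathbb{R}^d)$ is the space of geometric $\beta$-Hölder rough paths $\mathbf{X}=(X,\mathbb{X})$: $X\in\mathcal{C}^\beta([0,T];\mathbb{R}^d)$, $\mathbb{X}:\mathcal{S}_{[0,T]}\to\mathbb{R}^d\otimes\mathbb{R}^d$ is $2\beta$-Hölder, Chen's relation holds and the symmetric part of $\mathbb{X}_{s,t}$ is $\tfrac12\delta X_{s,t}\otimes\delta X_{s,t}$. $(Y,Y')\in\mathcal{C}^\beta_X(E)$ (path controlled by $X$) means $Y\in\mathcal{C}^\beta([0,T];E)$, $Y'\in\mathcal{C}^\beta([0,T];\mathcal{L}(\mathbb{R}^d,E))$ and $R^Y_{s,t}=\delta Y_{s,t}-Y'_s\delta X_{s,t}$ is $2\beta$-Hölder. The rough integral of a controlled path with values in $\mathcal{L}(\mathbb{R}^d,\mathbb{R}^e)$ is $\int_s^tY_u\,d\mathbf{X}_u=\lim\sum_i\big(Y_{t_i}\delta X_{t_i,t_{i+1}}+Y'_{t_i}\mathbb{X}_{t_i,t_{i+1}}\big)$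 as the mesh of subdivisions of $[s,t]$ tends to $0$. "$Y$ solves the equation in the sense of controlled rough paths" means $Y_t=y_0+\int_0^tb(Y_s)\,ds+\int_0^t\sigma(Y_s)\,d\mathbf{X}_s$ for all $t\in[0,T]$, where $\sigma(Y)$ is controlled with Gubinelli derivative $\nabla\sigma(Y)\sigma(Y)$. Flow: $(U^{\mathbf{X};y}_{t\leftarrow0})_{t\in[0,T]}$ denotes the solution of the driftless rough differential equation $d\widetilde Y_t=\sigma(\widetilde Y_t)\,d\mathbf{X}_t$, $\widetilde Y_0=y$; $J^{\mathbf{X};z}_{t\leftarrow0}$ is the Jacobian matrix of $y\mapsto U^{\mathbf{X};y}_{t\leftarrow0}$ at $y=z$, and $J^{\mathbf{X};z}_{0\leftarrow t}=(J^{\mathbf{X};z}_{t\leftarrow0})^{-1}$. *)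

theory Defs
  imports "HOL-Analysis.Analysis"
begin

section \<open>Function spaces\<close>

text \<open>The iterated Frechet derivatives are tested on fixed directions, so that all of them have
  the codomain of \<open>f\<close>. As the domain is finite-dimensional, this is the same as asking that the
  derivatives, as maps into multilinear maps, exist, are continuous and are bounded.\<close>

primrec Cb :: "nat \<Rightarrow> ('a::euclidean_space \<Rightarrow> 'b::real_normed_vector) \<Rightarrow> bool" where
  "Cb 0 f \<longleftrightarrow> continuous_on UNIV f \<and> bounded (range f)"
| "Cb (Suc k) f \<longleftrightarrow> continuous_on UNIV f \<and> bounded (range f) \<and>
     (\<forall>x. f differentiable (at x)) \<and> (\<forall>v. Cb k (\<lambda>x. frechet_derivative f (at x) v))"

definition holder2 :: "real \<Rightarrow> real \<Rightarrow> (real \<Rightarrow> real \<Rightarrow> 'a::real_normed_vector) \<Rightarrow> bool" where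
  "holder2 T \<gamma> g \<longleftrightarrow>
     (\<exists>C. \<forall>s t. 0 \<le> s \<and> s < t \<and> t \<le> T \<longrightarrow> norm (g s t) / (t - s) powr \<gamma> \<le> C)"

definition increment :: "(real \<Rightarrow> 'a::real_normed_vector) \<Rightarrow> real \<Rightarrow> real \<Rightarrow> 'a" where
  "increment f s t = f t - f s"

definition holder :: "real \<Rightarrow> real \<Rightarrow> (real \<Rightarrow> 'a::real_normed_vector) \<Rightarrow> bool" where
  "holder T \<beta> f \<longleftrightarrow> holder2 T \<beta> (increment f)"


section \<open>Rough paths and controlled paths\<close>

text \<open>The tensor product of two copies of \<open>\<real>\<^sup>d\<close> is the space of \<open>d \<times> d\<close> matrices.\<close>

definition outer :: "real^'d \<Rightarrow> real^'d \<Rightarrow> real^'d^'d" where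
  "outer x y = (\<chi> i j. x $ i * y $ j)"

definition geometric_rough_path ::
  "real \<Rightarrow> real \<Rightarrow> (real \<Rightarrow> real^'d) \<Rightarrow> (real \<Rightarrow> real \<Rightarrow> real^'d^'d) \<Rightarrow> bool" where
  "geometric_rough_path T \<beta> X XX \<longleftrightarrow>
     holder T \<beta> X \<and> holder2 T (2 * \<beta>) XX \<and>
     (\<forall>s u t. 0 \<le> s \<and> s \<le> u \<and> u \<le> t \<and> t \<le> T \<longrightarrow>
        XX s t = XX s u + XX u t + outer (increment X s u) (increment X u t)) \<and>
     (\<forall>s t. 0 \<le> s \<and> s \<le> t \<and> t \<le> T \<longrightarrow>
        (1/2) *\<^sub>R (XX s t + transpose (XX s t)) =
        (1/2) *\<^sub>R outer (increment X s t) (increment X s t))"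

definition controlled ::
  "real \<Rightarrow> real \<Rightarrow> (real \<Rightarrow> real^'d) \<Rightarrow> (real \<Rightarrow> 'a::real_normed_vector) \<Rightarrow>
   (real \<Rightarrow> (real^'d) \<Rightarrow>\<^sub>L 'a) \<Rightarrow> bool" where
  "controlled T \<beta> X Y Y' \<longleftrightarrow>
     holder T \<beta> Y \<and> holder T \<beta> Y' \<and>
     holder2 T (2 * \<beta>) (\<lambda>s t. increment Y s t - blinfun_apply (Y' s) (increment X s t))"

text \<open>A bilinear map \<open>L\<close> acting on a tensor. With the orientation of Chen's relation above,
  the \<open>(i, j)\<close> entry of the second level stands for the integral of the increment of \<open>X\<^sup>i\<close>
  against \<open>dX\<^sup>j\<close>; hence the first argument of a Gubinelli derivative takes the first index.\<close>

definition tensor_apply ::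
  "((real^'d) \<Rightarrow>\<^sub>L ((real^'d) \<Rightarrow>\<^sub>L 'a::real_normed_vector)) \<Rightarrow> real^'d^'d \<Rightarrow> 'a" where
  "tensor_apply L A =
     (\<Sum>i\<in>UNIV. \<Sum>j\<in>UNIV. (A $ i $ j) *\<^sub>R blinfun_apply (blinfun_apply L (axis i 1)) (axis j 1))"


section \<open>Rough integrals and rough differential equations\<close>

definition subdivision :: "real \<Rightarrow> real \<Rightarrow> nat \<Rightarrow> (nat \<Rightarrow> real) \<Rightarrow> bool" where
  "subdivision s t n \<tau> \<longleftrightarrow> \<tau> 0 = s \<and> \<tau> n = t \<and> (\<forall>i<n. \<tau> i < \<tau> (Suc i))"

definition has_rough_integral ::
  "(real \<Rightarrow> real^'d) \<Rightarrow> (real \<Rightarrow> real \<Rightarrow> real^'d^'d) \<Rightarrow>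
   (real \<Rightarrow> (real^'d) \<Rightarrow>\<^sub>L 'a::real_normed_vector) \<Rightarrow>
   (real \<Rightarrow> (real^'d) \<Rightarrow>\<^sub>L ((real^'d) \<Rightarrow>\<^sub>L 'a)) \<Rightarrow> real \<Rightarrow> real \<Rightarrow> 'a \<Rightarrow> bool" where
  "has_rough_integral X XX Y Y' s t I \<longleftrightarrow>
     (\<forall>\<epsilon>>0. \<exists>\<delta>>0. \<forall>n \<tau>. subdivision s t n \<tau> \<and> (\<forall>i<n. \<tau> (Suc i) - \<tau> i < \<delta>) \<longrightarrow>
        norm ((\<Sum>i<n. blinfun_apply (Y (\<tau> i)) (increment X (\<tau> i) (\<tau> (Suc i))) +
                        tensor_apply (Y' (\<tau> i)) (XX (\<tau> i) (\<tau> (Suc i)))) - I) < \<epsilon>)"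

text \<open>The Gubinelli derivative of \<open>\<sigma>(Y)\<close> is \<open>\<nabla>\<sigma>(Y) \<sigma>(Y)\<close>, that is, it maps \<open>v\<close> to
  \<open>D\<sigma>(Y)[\<sigma>(Y) v]\<close>.\<close>

definition grad_mult ::
  "('a::real_normed_vector \<Rightarrow> (real^'d) \<Rightarrow>\<^sub>L 'a) \<Rightarrow> 'a \<Rightarrow>
   (real^'d) \<Rightarrow>\<^sub>L ((real^'d) \<Rightarrow>\<^sub>L 'a)" where
  "grad_mult \<sigma> y = Blinfun (frechet_derivative \<sigma> (at y)) o\<^sub>L \<sigma> y"

definition solves_rde ::
  "real \<Rightarrow> real \<Rightarrow> (real \<Rightarrow> real^'d) \<Rightarrow> (real \<Rightarrow> real \<Rightarrow> real^'d^'d) \<Rightarrow>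
   (real^'e \<Rightarrow> real^'e) \<Rightarrow> (real^'e \<Rightarrow> (real^'d) \<Rightarrow>\<^sub>L (real^'e)) \<Rightarrow> real^'e \<Rightarrow>
   (real \<Rightarrow> real^'e) \<Rightarrow> (real \<Rightarrow> (real^'d) \<Rightarrow>\<^sub>L (real^'e)) \<Rightarrow> bool" where
  "solves_rde T \<beta> X XX b \<sigma> y0 Y Y' \<longleftrightarrow>
     controlled T \<beta> X Y Y' \<and>
     (\<forall>t\<in>{0..T}. Y' t = \<sigma> (Y t)) \<and>
     controlled T \<beta> X (\<lambda>t. \<sigma> (Y t)) (\<lambda>t. grad_mult \<sigma> (Y t)) \<and>
     (\<forall>t\<in>{0..T}. \<exists>B I.
        ((\<lambda>s. b (Y s)) has_integral B) {0..t} \<and>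
        has_rough_integral X XX (\<lambda>s. \<sigma> (Y s)) (\<lambda>s. grad_mult \<sigma> (Y s)) 0 t I \<and>
        Y t = y0 + B + I)"


section \<open>The flow of the driftless equation\<close>

definition rde_flow ::
  "real \<Rightarrow> real \<Rightarrow> (real \<Rightarrow> real^'d) \<Rightarrow> (real \<Rightarrow> real \<Rightarrow> real^'d^'d) \<Rightarrow>
   (real^'e \<Rightarrow> (real^'d) \<Rightarrow>\<^sub>L (real^'e)) \<Rightarrow> real^'e \<Rightarrow> real \<Rightarrow> real^'e" where
  "rde_flow T \<beta> X XX \<sigma> y t =
     (THE u. \<exists>Y Y'. solves_rde T \<beta> X XX (\<lambda>_. 0) \<sigma> y Y Y' \<and> u = Y t)"

definition flow_jacobian ::
  "real \<Rightarrow> real \<Rightarrow> (real \<Rightarrow> real^'d) \<Rightarrow> (real \<Rightarrow> real \<Rightarrow> real^'d^'d) \<Rightarrow>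
   (real^'e \<Rightarrow> (real^'d) \<Rightarrow>\<^sub>L (real^'e)) \<Rightarrow> real^'e \<Rightarrow> real \<Rightarrow> real^'e^'e" where
  "flow_jacobian T \<beta> X XX \<sigma> z t = jacobian (\<lambda>y. rde_flow T \<beta> X XX \<sigma> y t) (at z)"

definition flow_drift ::
  "real \<Rightarrow> real \<Rightarrow> (real \<Rightarrow> real^'d) \<Rightarrow> (real \<Rightarrow> real \<Rightarrow> real^'d^'d) \<Rightarrow>
   (real^'e \<Rightarrow> real^'e) \<Rightarrow> (real^'e \<Rightarrow> (real^'d) \<Rightarrow>\<^sub>L (real^'e)) \<Rightarrow>
   real \<Rightarrow> real^'e \<Rightarrow> real^'e" where
  "flow_drift T \<beta> X XX b \<sigma> t z =
     matrix_inv (flow_jacobian T \<beta> X XX \<sigma> z t) *v b (rde_flow T \<beta> X XX \<sigma> z t)"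

definition solves_flow_ode ::
  "real \<Rightarrow> real \<Rightarrow> (real \<Rightarrow> real^'d) \<Rightarrow> (real \<Rightarrow> real \<Rightarrow> real^'d^'d) \<Rightarrow>
   (real^'e \<Rightarrow> real^'e) \<Rightarrow> (real^'e \<Rightarrow> (real^'d) \<Rightarrow>\<^sub>L (real^'e)) \<Rightarrow> real^'e \<Rightarrow>
   (real \<Rightarrow> real^'e) \<Rightarrow> bool" where
  "solves_flow_ode T \<beta> X XX b \<sigma> y0 Z \<longleftrightarrow>
     (\<forall>t\<in>{0..T}. ((\<lambda>s. flow_drift T \<beta> X XX b \<sigma> s (Z s)) has_integral (Z t - y0)) {0..t})"

end

theory Submission
  imports Defs
begin

text \<open>
  A path solves the equation in the sense of controlled rough paths iff it satisfies Davie's local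
  expansion \<open>V\<^sub>t - V\<^sub>s = \<sigma>(V\<^sub>s) X\<^sub>s\<^sub>t + (\<nabla>\<sigma> \<sigma>)(V\<^sub>s) \<bbbX>\<^sub>s\<^sub>t + b(V\<^sub>s) (t - s) + O((t - s)\<^sup>3\<^sup>\<beta>)\<close> with \<open>3 \<beta> > 1\<close>.
  The driftless flow is the limit of the Euler schemes with this expansion as one-step map. The Euler
  scheme of the tangent vector field \<open>(x, a) \<mapsto> (v x, Dv x a)\<close> is the tangent map of the Euler scheme
  of \<open>v\<close>; a local a priori bound for the scheme, applied to the twice iterated tangent field, therefore bounds
  its first and second derivatives uniformly in the mesh, so that the flow is of class
  \<open>C\<^sup>1\<^sup>,\<^sup>1\<close> with invertible derivative close to the identity for short times.
  Hence \<open>W\<close> is locally Lipschitz with linear growth, \<open>Z\<close> exists by Picard iteration, the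
  path \<open>U\<^sub>t(Z\<^sub>t)\<close> satisfies Davie's expansion with drift, and transporting two solutions
  by the driftless flow to a common time gives uniqueness.
\<close>

text \<open>The driving path may have infinite variation, so neither Gronwall's lemma nor
  differentiation under the integral applies to the rough equation directly. Derivatives are
  therefore taken of the discrete scheme, a finite composition of smooth maps, and only bounds
  uniform in the mesh are passed to the limit. The obstacle is that tangent fields grow linearly in
  the tangent components, so they admit no global bound. The a priori estimate is local: for short
  times it keeps the scheme in a unit ball around its start, and linearity in the tangent components
  rescales the result to all directions. Four derivatives of \<open>\<sigma>\<close> are the price:
  the second tangent field contains two derivatives of \<open>v\<close>, its derivative contains
  three, and the estimate asks the latter to be Lipschitz. Second-order control of the flow is
  required because both the drift \<open>W\<close> and the comparison of two solutions involve
  differences of its derivative at two points. The ratio 2/3 in the constants comes from halving a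
  block of steps: of three steps, the larger half has two.\<close>

section \<open>The one-step map and its defect\<close>

text \<open>One step of the second-order (Davie or Milstein) scheme in coordinates. The first index
  of \<open>P\<close> selects the field along which one differentiates, the second the field being
  differentiated, in accordance with the orientation of Chen's relation.\<close>

definition rough_increment ::
  "('d::finite \<Rightarrow> 'a::real_normed_vector \<Rightarrow> 'a) \<Rightarrow> ('d \<Rightarrow> 'a \<Rightarrow> 'a \<Rightarrow> 'a) \<Rightarrow>
   real^'d \<Rightarrow> real^'d^'d \<Rightarrow> 'a \<Rightarrow> 'a" where
  "rough_increment v D p P y =
     (\<Sum>i\<in>UNIV. p $ i *\<^sub>R v i y) + (\<Sum>i\<in>UNIV. \<Sum>j\<in>UNIV. P $ i $ j *\<^sub>R D j y (v i y))"

text \<open>One constant covers the field, its derivative and the variation of the derivative, so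
  that later estimates depend on the fields through \<open>M\<close> alone. The Lipschitz condition
  takes the place of a second derivative.\<close>

definition regular_on ::
  "'a::real_normed_vector set \<Rightarrow> real \<Rightarrow> ('d::finite \<Rightarrow> 'a \<Rightarrow> 'a) \<Rightarrow> ('d \<Rightarrow> 'a \<Rightarrow> 'a \<Rightarrow> 'a) \<Rightarrow> bool" where
  "regular_on S M v D \<longleftrightarrow>
     (\<forall>i. \<forall>y\<in>S. (v i has_derivative D i y) (at y) \<and> norm (v i y) \<le> M \<and>
        (\<forall>a. norm (D i y a) \<le> M * norm a)) \<and>
     (\<forall>i. \<forall>y\<in>S. \<forall>z\<in>S. \<forall>a. norm (D i y a - D i z a) \<le> M * norm (y - z) * norm a)"

lemma regular_onD:
  assumes "regular_on S M v D" "y \<in> S"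
  shows "(v i has_derivative D i y) (at y)" "linear (D i y)" "norm (v i y) \<le> M"
    "norm (D i y a) \<le> M * norm a" "0 \<le> M"
    "z \<in> S \<Longrightarrow> norm (D i y a - D i z a) \<le> M * norm (y - z) * norm a"
proof -
  show 1: "(v i has_derivative D i y) (at y)" "norm (v i y) \<le> M" "norm (D i y a) \<le> M * norm a"
    "z \<in> S \<Longrightarrow> norm (D i y a - D i z a) \<le> M * norm (y - z) * norm a"
    using assms unfolding regular_on_def by blast+
  show "linear (D i y)"
    using 1(1) by (rule has_derivative_linear)
  show "0 \<le> M"
    using norm_ge_zero 1(2) by (rule order_trans)
qed

lemma norm_sum_scaleR_le:
  fixes c :: "'i::finite \<Rightarrow> real"
  assumes "\<And>i. \<bar>c i\<bar> \<le> k" "\<And>i. norm (w i) \<le> m"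
  shows "norm (\<Sum>i\<in>UNIV. c i *\<^sub>R w i) \<le> real CARD('i) * (k * m)"
proof (rule sum_norm_bound)
  fix i :: 'i
  have "0 \<le> k"
    using assms(1)[of i] by linarith
  then show "norm (c i *\<^sub>R w i) \<le> k * m"
    using mult_mono[OF assms(1)[of i] assms(2)[of i]] by simp
qed

lemma norm_double_sum_scaleR_le:
  fixes c :: "'i::finite \<Rightarrow> 'i \<Rightarrow> real"
  assumes "\<And>i j. \<bar>c i j\<bar> \<le> k" "\<And>i j. norm (w i j) \<le> m"
  shows "norm (\<Sum>i\<in>UNIV. \<Sum>j\<in>UNIV. c i j *\<^sub>R w i j) \<le> real CARD('i)^2 * (k * m)"
proof -
  have "norm (\<Sum>i\<in>UNIV. \<Sum>j\<in>UNIV. c i j *\<^sub>R w i j) \<le> real CARD('i) * (real CARD('i) * (k * m))"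
    by (intro sum_norm_bound norm_sum_scaleR_le assms)
  then show ?thesis
    by (simp add: power2_eq_square algebra_simps)
qed

lemma quadratic_remainder:
  fixes f :: "'a::real_normed_vector \<Rightarrow> 'b::real_normed_vector"
  assumes S: "convex S" "y \<in> S" "z \<in> S" and M: "0 \<le> M"
    and f': "\<And>x. x \<in> S \<Longrightarrow> (f has_derivative f' x) (at x)"
    and lip: "\<And>x a. x \<in> S \<Longrightarrow> norm (f' x a - f' y a) \<le> M * norm (x - y) * norm a"
  shows "norm (f z - f y - f' y (z - y)) \<le> M * norm (z - y)^2"
proof -
  have sub: "closed_segment y z \<subseteq> S"
    using S by (simp add: closed_segment_subset)
  have "norm (f z - f y - f' y (z - y)) \<le> norm (z - y) * (M * norm (z - y))"
  proof (rule differentiable_bound_linearization[where S = "closed_segment y z" and f' = f' and ?x0.0 = y])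
    show "y + t *\<^sub>R (z - y) \<in> closed_segment y z" if "t \<in> {0..1}" for t
      using that by (auto simp: closed_segment_def algebra_simps intro!: exI[of _ t])
    show "(f has_derivative f' x) (at x within closed_segment y z)" if "x \<in> closed_segment y z" for x
      using f' sub that by (blast intro: has_derivative_at_withinI)
    show "onorm (f' x - f' y) \<le> M * norm (z - y)" if x: "x \<in> closed_segment y z" for x
    proof (rule onorm_bound)
      show "0 \<le> M * norm (z - y)"
        using M by simp
      fix a
      have "norm (f' x a - f' y a) \<le> M * norm (x - y) * norm a"
        using lip sub x by blast
      also have "norm (x - y) \<le> norm (z - y)"
        using x by (metis norm_minus_commute segment_bound(1))
      finally show "norm ((f' x - f' y) a) \<le> M * norm (z - y) * norm a"
        using M by (simp add: mult_left_mono mult_right_mono)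
    qed
  qed auto
  then show ?thesis
    by (simp add: power2_eq_square algebra_simps)
qed

context
  fixes S :: "'a::real_normed_vector set" and M :: real
    and v :: "'d::finite \<Rightarrow> 'a \<Rightarrow> 'a" and D :: "'d \<Rightarrow> 'a \<Rightarrow> 'a \<Rightarrow> 'a"
  assumes S: "convex S" and reg: "regular_on S M v D"
begin

lemma regular_on_lipschitz:
  assumes "y \<in> S" "z \<in> S"
  shows "norm (v i y - v i z) \<le> M * norm (y - z)"
proof (rule differentiable_bound[OF S])
  show "(v i has_derivative D i x) (at x within S)" if "x \<in> S" for x
    using regular_onD(1)[OF reg that] by (rule has_derivative_at_withinI)
  show "onorm (D i x) \<le> M" if "x \<in> S" for x
    using regular_onD(4,5)[OF reg that] by (intro onorm_bound) auto
qed (use assms in auto)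

lemma regular_on_taylor:
  assumes "y \<in> S" "z \<in> S"
  shows "norm (v i z - v i y - D i y (z - y)) \<le> M * norm (z - y)^2"
  using S assms regular_onD(5)[OF reg assms(1)] regular_onD(1,6)[OF reg] by (rule quadratic_remainder) (use assms in auto)

lemma regular_on_second_lipschitz:
  assumes "y \<in> S" "z \<in> S"
  shows "norm (D j y (v i y) - D j z (v i z)) \<le> 2 * M^2 * norm (y - z)"
proof -
  have M: "0 \<le> M"
    using regular_onD(5)[OF reg assms(1)] .
  have "D j y (v i y) - D j z (v i z) = D j y (v i y - v i z) + (D j y (v i z) - D j z (v i z))"
    using linear_diff[OF regular_onD(2)[OF reg assms(1)]] by simp
  also have "norm \<dots> \<le> M * (M * norm (y - z)) + M * norm (y - z) * M"
    by (intro norm_triangle_mono order_trans[OF regular_onD(4)[OF reg assms(1)]]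
        order_trans[OF regular_onD(6)[OF reg assms(1)]] mult_left_mono regular_on_lipschitz
        regular_onD(3)[OF reg] assms mult_nonneg_nonneg M norm_ge_zero)
  finally show ?thesis
    by (simp add: power2_eq_square algebra_simps)
qed

context
  fixes K r :: real
  assumes r: "0 \<le> r" "r \<le> 1" and K: "0 \<le> K"
begin

lemma scaled_square_le: "K * r^2 \<le> K * r"
  using r K by (simp add: power2_eq_square mult_left_le mult_left_mono)


text \<open>Here \<open>r\<close> stands for the power \<beta> of the step length: the first level
  has order \<open>r\<close>, the second order \<open>r^2\<close>, and \<open>r <= 1\<close> lets a
  linear bound cover both. The factor 2 lets the Lipschitz estimate, where a product rule occurs,
  share this constant.\<close>

lemma rough_increment_bound:
  assumes y: "y \<in> S" and p: "\<And>i. \<bar>p $ i\<bar> \<le> K * r" and P: "\<And>i j. \<bar>P $ i $ j\<bar> \<le> K * r^2"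
  shows "norm (rough_increment v D p P y)
    \<le> (real CARD('d) * K * M + 2 * real CARD('d)^2 * K * M^2) * r"
proof -
  have M: "0 \<le> M"
    using regular_onD(5)[OF reg y] .
  have "norm (D j y (v i y)) \<le> M^2" for i j
    using order_trans[OF regular_onD(4)[OF reg y] mult_left_mono[OF regular_onD(3)[OF reg y] M]]
    by (simp add: power2_eq_square)
  then have "norm (rough_increment v D p P y)
    \<le> real CARD('d) * (K * r * M) + real CARD('d)^2 * (K * r^2 * M^2)"
    unfolding rough_increment_def
    by (intro norm_triangle_mono norm_sum_scaleR_le norm_double_sum_scaleR_le p P regular_onD(3)[OF reg y])
  moreover have "real CARD('d)^2 * (K * r^2 * M^2) \<le> real CARD('d)^2 * (K * r * M^2)"
    by (intro mult_left_mono mult_right_mono scaled_square_le) auto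
  moreover have "0 \<le> real CARD('d)^2 * (K * r * M^2)"
    using K r by simp
  ultimately show ?thesis
    by (simp add: algebra_simps)
qed

lemma rough_increment_lipschitz:
  assumes yz: "y \<in> S" "z \<in> S" and p: "\<And>i. \<bar>p $ i\<bar> \<le> K * r" and P: "\<And>i j. \<bar>P $ i $ j\<bar> \<le> K * r^2"
  shows "norm (rough_increment v D p P y - rough_increment v D p P z)
    \<le> (real CARD('d) * K * M + 2 * real CARD('d)^2 * K * M^2) * r * norm (y - z)"
proof -
  have M: "0 \<le> M"
    using regular_onD(5)[OF reg yz(1)] .
  have "rough_increment v D p P y - rough_increment v D p P z
    = (\<Sum>i\<in>UNIV. p $ i *\<^sub>R (v i y - v i z)) +
      (\<Sum>i\<in>UNIV. \<Sum>j\<in>UNIV. P $ i $ j *\<^sub>R (D j y (v i y) - D j z (v i z)))"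
    by (simp add: rough_increment_def scaleR_diff_right sum_subtractf)
  also have "norm \<dots> \<le> real CARD('d) * (K * r * (M * norm (y - z)))
      + real CARD('d)^2 * (K * r^2 * (2 * M^2 * norm (y - z)))"
    by (intro norm_triangle_mono norm_sum_scaleR_le norm_double_sum_scaleR_le p P
        regular_on_lipschitz regular_on_second_lipschitz yz)
  also have "K * r^2 * (2 * M^2 * norm (y - z)) \<le> K * r * (2 * M^2 * norm (y - z))"
    using M by (intro mult_right_mono scaled_square_le) auto
  finally show ?thesis
    by (simp add: algebra_simps)
qed

end

text \<open>The failure of the one-step map to be a flow: by Chen's relation the terms up to order two cancel.\<close>

lemma rough_increment_defect:
  fixes p q :: "real^'d" and P Q :: "real^'d^'d" and K r :: real
  assumes r: "0 \<le> r" "r \<le> 1" and K: "0 \<le> K"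
    and y: "y \<in> S" "y + rough_increment v D p P y \<in> S"
    and p: "\<And>i. \<bar>p $ i\<bar> \<le> K * r" and P: "\<And>i j. \<bar>P $ i $ j\<bar> \<le> K * r^2"
    and q: "\<And>i. \<bar>q $ i\<bar> \<le> K * r" and Q: "\<And>i j. \<bar>Q $ i $ j\<bar> \<le> K * r^2"
    and A: "A = real CARD('d) * K * M + 2 * real CARD('d)^2 * K * M^2"
  shows "norm (rough_increment v D p P y + rough_increment v D q Q (y + rough_increment v D p P y)
      - rough_increment v D (p + q) (P + Q + outer p q) y)
    \<le> (real CARD('d) * K * M * A^2 + real CARD('d)^3 * K^2 * M^3 + 2 * real CARD('d)^2 * K * M^2 * A) * r^3"
proof -
  define \<eta> where "\<eta> = rough_increment v D p P y"
  define n where "n = real CARD('d)"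
  have M: "0 \<le> M"
    using regular_onD(5)[OF reg y(1)] .
  have \<eta>: "norm \<eta> \<le> A * r"
    unfolding \<eta>_def A by (rule rough_increment_bound[OF r K y(1) p P])
  have lin: "D j y (\<Sum>i\<in>UNIV. c i *\<^sub>R w i) = (\<Sum>i\<in>UNIV. c i *\<^sub>R D j y (w i))" for c w j
    using linear_sum[OF regular_onD(2)[OF reg y(1)], of j "\<lambda>i. c i *\<^sub>R w i" UNIV]
      linear_scale[OF regular_onD(2)[OF reg y(1)]] by simp
  define Z where "Z = (\<Sum>i\<in>UNIV. \<Sum>j\<in>UNIV. P $ i $ j *\<^sub>R D j y (v i y))"
  have D\<eta>: "D j y \<eta> = (\<Sum>i\<in>UNIV. p $ i *\<^sub>R D j y (v i y)) + D j y Z" for j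
    unfolding \<eta>_def rough_increment_def Z_def[symmetric]
    using linear_add[OF regular_onD(2)[OF reg y(1)]] lin by simp
  have "rough_increment v D p P y + rough_increment v D q Q (y + \<eta>)
      - rough_increment v D (p + q) (P + Q + outer p q) y
    = (\<Sum>j\<in>UNIV. q $ j *\<^sub>R (v j (y + \<eta>) - v j y - D j y (y + \<eta> - y)))
      + (\<Sum>j\<in>UNIV. q $ j *\<^sub>R D j y Z)
      + (\<Sum>i\<in>UNIV. \<Sum>j\<in>UNIV. Q $ i $ j *\<^sub>R (D j (y + \<eta>) (v i (y + \<eta>)) - D j y (v i y)))"
  proof -
    \<comment> \<open>The first-order effect of \<open>p\<close> on the fields weighted by
      \<open>q\<close> is exactly the outer product in Chen's relation, so it cancels; only the
      second-level part \<open>Z\<close> of the displacement survives.\<close>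
    have "(\<Sum>j\<in>UNIV. q $ j *\<^sub>R D j y \<eta>)
      = (\<Sum>i\<in>UNIV. \<Sum>j\<in>UNIV. outer p q $ i $ j *\<^sub>R D j y (v i y)) + (\<Sum>j\<in>UNIV. q $ j *\<^sub>R D j y Z)"
      unfolding D\<eta> outer_def
      by (subst sum.swap) (simp add: scaleR_add_right sum.distrib scaleR_sum_right mult.commute)
    then show ?thesis
      unfolding rough_increment_def
      by (simp add: scaleR_diff_right sum_subtractf sum.distrib scaleR_add_left)
  qed
  also have "norm \<dots> \<le> n * (K * r * (M * (A * r)^2)) + n * (K * r * (M * (n^2 * (K * r^2 * M^2))))
      + n^2 * (K * r^2 * (2 * M^2 * (A * r)))"
  proof (unfold n_def, intro norm_triangle_mono norm_sum_scaleR_le norm_double_sum_scaleR_le q Q)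
    show "norm (v j (y + \<eta>) - v j y - D j y (y + \<eta> - y)) \<le> M * (A * r)^2" for j
      using regular_on_taylor[OF y(1) y(2), of j] \<eta> M
      by (intro order_trans[OF regular_on_taylor[OF y(1) y(2)[folded \<eta>_def]]] mult_left_mono power_mono) auto
    have "norm (D j y (v i y)) \<le> M^2" for i j
      using order_trans[OF regular_onD(4)[OF reg y(1)] mult_left_mono[OF regular_onD(3)[OF reg y(1)] M]]
      by (simp add: power2_eq_square)
    then have "norm Z \<le> real CARD('d)^2 * (K * r^2 * M^2)"
      unfolding Z_def by (intro norm_double_sum_scaleR_le P)
    then show "norm (D j y Z) \<le> M * (real CARD('d)^2 * (K * r^2 * M^2))" for j
      using M by (intro order_trans[OF regular_onD(4)[OF reg y(1)]] mult_left_mono)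
    show "norm (D j (y + \<eta>) (v i (y + \<eta>)) - D j y (v i y)) \<le> 2 * M^2 * (A * r)" for i j
      using order_trans[OF regular_on_second_lipschitz[OF y(2)[folded \<eta>_def] y(1), of j i] mult_left_mono[OF _ _]] \<eta>
      by simp
  qed
  also have "\<dots> = (n * K * M * A^2 + n^3 * K^2 * M^3 + 2 * n^2 * K * M^2 * A) * r^3"
    by (simp add: algebra_simps power2_eq_square power3_eq_cube)
  finally show ?thesis
    unfolding n_def \<eta>_def .
qed

end

section \<open>The Euler scheme\<close>

lemma powr_cube: "((x::real) powr b)^3 = x powr (3 * b)"
  by (cases "x = 0") (auto simp: powr_power mult.commute)

text \<open>Write \<open>x powr \<theta>\<close> as \<open>x * x powr (\<theta> - 1)\<close> and
  bound the second factor through the larger piece. The gain is a factor below 1, the contraction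
  behind both the Euler estimate and the sewing bound.\<close>

lemma powr_split_le:
  fixes a b \<theta> :: real
  assumes "0 \<le> a" "0 \<le> b" "a \<le> 2/3 * (a + b)" "b \<le> 2/3 * (a + b)" "1 < \<theta>"
  shows "a powr \<theta> + b powr \<theta> \<le> (2/3) powr (\<theta> - 1) * (a + b) powr \<theta>"
proof -
  have eq: "x powr \<theta> = x * x powr (\<theta> - 1)" if "0 \<le> x" for x :: real
    using that by (cases "x = 0") (auto simp: powr_diff)
  have "x powr \<theta> \<le> x * ((2/3) powr (\<theta> - 1) * (a + b) powr (\<theta> - 1))"
    if "0 \<le> x" "x \<le> 2/3 * (a + b)" for x
  proof -
    have "x powr (\<theta> - 1) \<le> (2/3 * (a + b)) powr (\<theta> - 1)"
      using that assms by (intro powr_mono2) auto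
    also have "\<dots> = (2/3) powr (\<theta> - 1) * (a + b) powr (\<theta> - 1)"
      by (rule powr_mult)
    finally show ?thesis
      unfolding eq[OF that(1)] using that by (intro mult_left_mono)
  qed
  from this[OF assms(1,3)] this[OF assms(2,4)] show ?thesis
    using eq[of "a + b"] assms by (simp add: algebra_simps)
qed

text \<open>The second level is bounded by a square so that both levels scale with one small
  quantity. The bounds include \<open>s = t\<close>, where \<open>0 powr \<beta> = 0\<close> makes
  the second level vanish.\<close>

locale rough_path =
  fixes T \<beta> K :: real and X :: "real \<Rightarrow> real^'d::finite" and XX :: "real \<Rightarrow> real \<Rightarrow> real^'d^'d"
  assumes T: "0 < T" and \<beta>: "1/3 < \<beta>" "\<beta> < 1/2" and K: "0 \<le> K"
    and X_bound: "0 \<le> s \<Longrightarrow> s \<le> t \<Longrightarrow> t \<le> T \<Longrightarrow> \<bar>increment X s t $ i\<bar> \<le> K * (t - s) powr \<beta>"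
    and XX_bound: "0 \<le> s \<Longrightarrow> s \<le> t \<Longrightarrow> t \<le> T \<Longrightarrow> \<bar>XX s t $ i $ j\<bar> \<le> K * ((t - s) powr \<beta>)^2"
    and chen: "0 \<le> s \<Longrightarrow> s \<le> u \<Longrightarrow> u \<le> t \<Longrightarrow> t \<le> T \<Longrightarrow>
      XX s t = XX s u + XX u t + outer (increment X s u) (increment X u t)"
begin

definition Inc :: "('d \<Rightarrow> 'a::real_normed_vector \<Rightarrow> 'a) \<Rightarrow> ('d \<Rightarrow> 'a \<Rightarrow> 'a \<Rightarrow> 'a) \<Rightarrow> real \<Rightarrow> real \<Rightarrow> 'a \<Rightarrow> 'a" where
  "Inc v D s t = rough_increment v D (increment X s t) (XX s t)"

text \<open>The index \<open>j\<close> is the position of the starting point on the grid of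
  multiples of \<open>\<Delta>\<close> and \<open>m\<close> the number of steps; schemes with the
  same mesh then compose exactly.\<close>

primrec euler :: "('d \<Rightarrow> 'a::real_normed_vector \<Rightarrow> 'a) \<Rightarrow> ('d \<Rightarrow> 'a \<Rightarrow> 'a \<Rightarrow> 'a) \<Rightarrow> real \<Rightarrow> nat \<Rightarrow> nat \<Rightarrow> 'a \<Rightarrow> 'a" where
  "euler v D \<Delta> j 0 y = y"
| "euler v D \<Delta> j (Suc m) y = euler v D \<Delta> j m y +
     Inc v D (real (j + m) * \<Delta>) (real (Suc (j + m)) * \<Delta>) (euler v D \<Delta> j m y)"

lemma euler_add: "euler v D \<Delta> j (m + n) y = euler v D \<Delta> (j + m) n (euler v D \<Delta> j m y)"
  by (induction n) (auto simp: add.assoc)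

definition inc_const :: "real \<Rightarrow> real" where
  "inc_const M = real CARD('d) * K * M + 2 * real CARD('d)^2 * K * M^2"

definition defect_const :: "real \<Rightarrow> real" where
  "defect_const M = real CARD('d) * K * M * inc_const M ^ 2 + real CARD('d)^3 * K^2 * M^3
     + 2 * real CARD('d)^2 * K * M^2 * inc_const M"

lemma inc_const_nonneg: "0 \<le> M \<Longrightarrow> 0 \<le> inc_const M"
  unfolding inc_const_def using K by simp

lemma defect_const_nonneg: "0 \<le> M \<Longrightarrow> 0 \<le> defect_const M"
  unfolding defect_const_def using K inc_const_nonneg[of M] by simp

lemma increment_add: "increment X s u + increment X u t = increment X s t"
  by (simp add: increment_def)

lemma Inc_self: "0 \<le> t \<Longrightarrow> t \<le> T \<Longrightarrow> Inc v D t t y = 0"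
  using XX_bound[of t t] by (simp add: Inc_def rough_increment_def increment_def)

context
  fixes S :: "'a::real_normed_vector set" and M and v :: "'d \<Rightarrow> 'a \<Rightarrow> 'a" and D
  assumes S: "convex S" and reg: "regular_on S M v D"
begin

lemma powr_unit: "0 \<le> (t - s) powr \<beta>" "s \<le> t \<Longrightarrow> t - s \<le> 1 \<Longrightarrow> (t - s) powr \<beta> \<le> 1"
  using \<beta> powr_mono2[of \<beta> "t - s" 1] by auto

lemma Inc_bound:
  assumes "y \<in> S" "0 \<le> s" "s \<le> t" "t \<le> T" "t - s \<le> 1"
  shows "norm (Inc v D s t y) \<le> inc_const M * (t - s) powr \<beta>"
  unfolding Inc_def inc_const_def using assms
  by (intro rough_increment_bound[OF S reg] X_bound XX_bound powr_unit K) auto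

lemma Inc_lipschitz:
  assumes "y \<in> S" "z \<in> S" "0 \<le> s" "s \<le> t" "t \<le> T" "t - s \<le> 1"
  shows "norm (Inc v D s t y - Inc v D s t z) \<le> inc_const M * (t - s) powr \<beta> * norm (y - z)"
  unfolding Inc_def inc_const_def using assms
  by (intro rough_increment_lipschitz[OF S reg] X_bound XX_bound powr_unit K) auto

lemma Inc_defect:
  assumes "y \<in> S" "y + Inc v D s u y \<in> S" "0 \<le> s" "s \<le> u" "u \<le> t" "t \<le> T" "t - s \<le> 1"
  shows "norm (Inc v D s u y + Inc v D u t (y + Inc v D s u y) - Inc v D s t y)
    \<le> defect_const M * (t - s) powr (3 * \<beta>)"
proof -
  have X: "\<bar>increment X a b $ i\<bar> \<le> K * (t - s) powr \<beta>"
    and XX: "\<bar>XX a b $ i $ j\<bar> \<le> K * ((t - s) powr \<beta>)^2" if "s \<le> a" "a \<le> b" "b \<le> t" for a b i j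
  proof -
    have le: "(b - a) powr \<beta> \<le> (t - s) powr \<beta>"
      using that \<beta> by (intro powr_mono2) auto
    show "\<bar>increment X a b $ i\<bar> \<le> K * (t - s) powr \<beta>"
      using X_bound[of a b i] mult_left_mono[OF le K] that assms by linarith
    show "\<bar>XX a b $ i $ j\<bar> \<le> K * ((t - s) powr \<beta>)^2"
      using XX_bound[of a b i j] mult_left_mono[OF power_mono[OF le] K, of 2] that assms by fastforce
  qed
  show ?thesis
    using rough_increment_defect[OF S reg powr_unit(1) powr_unit(2) K assms(1) assms(2)[unfolded Inc_def] X XX X XX,
        where A = "inc_const M"] assms
    unfolding Inc_def chen[OF assms(3-6)] increment_add[of s u t, symmetric] defect_const_def powr_cube
    by (simp add: inc_const_def)
qed

end

text \<open>The remainder over a block of steps is bounded by splitting the block in the middle; the defect is absorbed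
  because \<open>(2/3) powr (3 * \<beta> - 1) < 1\<close>. Only bounds on a ball around the initial value are used, since
  the estimate is applied to tangent vector fields, which are unbounded.\<close>

theorem euler_estimate:
  fixes M :: real
  assumes M: "0 \<le> M"
  obtains h c where "0 < h" "h \<le> 1" "0 \<le> c"
    "\<And>(S::'a::real_normed_vector set) v D y0 \<Delta> j m k l.
      convex S \<Longrightarrow> regular_on S M v D \<Longrightarrow> cball y0 2 \<subseteq> S \<Longrightarrow> 0 \<le> \<Delta> \<Longrightarrow>
      real (j + m) * \<Delta> \<le> T \<Longrightarrow> real m * \<Delta> \<le> h \<Longrightarrow> k \<le> l \<Longrightarrow> l \<le> m \<Longrightarrow>
      norm (euler v D \<Delta> j l y0 - euler v D \<Delta> j k y0 -
        Inc v D (real (j + k) * \<Delta>) (real (j + l) * \<Delta>) (euler v D \<Delta> j k y0))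
        \<le> c * (real (l - k) * \<Delta>) powr (3 * \<beta>) \<and> euler v D \<Delta> j l y0 \<in> cball y0 1"
proof -
  define A where "A = inc_const M"
  define N where "N = defect_const M"
  have A0: "0 \<le> A" and N0: "0 \<le> N"
    unfolding A_def N_def using M by (auto intro: inc_const_nonneg defect_const_nonneg)
  define \<theta> where "\<theta> = 3 * \<beta>"
  define \<kappa> :: real where "\<kappa> = (2/3) powr (\<theta> - 1)"
  have \<theta>: "1 < \<theta>"
    using \<beta> by (simp add: \<theta>_def)
  have "(2/3::real) powr (\<theta> - 1) < 1 powr (\<theta> - 1)"
    using \<theta> by (intro powr_less_mono2) auto
  then have \<kappa>: "0 < \<kappa>" "\<kappa> < 1"
    by (auto simp: \<kappa>_def)
  \<comment> \<open>Once \<open>A * r\<close> is at most \<open>(1 - \<kappa>) / 2\<close>, the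
    recursion multiplies the constant by at most \<open>(1 + \<kappa>) / 2\<close> and adds
    \<open>N\<close>; this \<open>c\<close> is the fixed point.\<close>
  define c where "c = 2 * N / (1 - \<kappa>)"
  have c0: "0 \<le> c"
    using N0 \<kappa> by (simp add: c_def)
  \<comment> \<open>The first entry keeps the perturbation \<open>A * r\<close> below half the gap
    \<open>1 - \<kappa>\<close>. The second gives \<open>c * r^3 <= 1/2\<close>; with the one-step
    map also at most 1/2, the scheme stays in the unit ball.\<close>
  define r where "r = min ((1 - \<kappa>) / (2 * (A + 1))) (1 / (2 * (c + 1)))"
  have r: "0 < r" "r \<le> 1"
    using \<kappa> A0 c0 by (auto simp: r_def min_le_iff_disj field_simps)
  have Ar: "A * r \<le> (1 - \<kappa>) / 2"
  proof -
    have "A * r \<le> A * ((1 - \<kappa>) / (2 * (A + 1)))"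
      using A0 by (intro mult_left_mono) (auto simp: r_def)
    also have "\<dots> = (A / (A + 1)) * ((1 - \<kappa>) / 2)"
      by simp
    also have "\<dots> \<le> (1 - \<kappa>) / 2"
      using A0 \<kappa> by (intro mult_left_le_one_le) auto
    finally show ?thesis .
  qed
  have cr: "c * r^3 \<le> 1/2"
  proof -
    have "c * r^3 \<le> c * r"
      using r c0 power_decreasing[of 1 3 r] by (intro mult_left_mono) auto
    also have "\<dots> \<le> c * (1 / (2 * (c + 1)))"
      using c0 by (intro mult_left_mono) (auto simp: r_def)
    also have "\<dots> \<le> 1/2"
      using c0 by (simp add: field_simps)
    finally show ?thesis .
  qed
  define h where "h = r powr (1 / \<beta>)"
  have hr: "h powr \<beta> = r"
    using r \<beta> by (simp add: h_def powr_powr)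
  have h: "0 < h" "h \<le> 1"
    using r \<beta> powr_mono2[of "1/\<beta>" r 1] by (auto simp: h_def)
  have absorb: "(1 + A * r) * (c * \<kappa>) + N \<le> c"
  proof -
    have "A * r * \<kappa> \<le> (1 - \<kappa>) / 2 * 1"
      using \<kappa> Ar by (intro mult_mono) auto
    then have "(1 + A * r) * \<kappa> \<le> (1 + \<kappa>) / 2"
      by (simp add: field_simps)
    then have "c * ((1 + A * r) * \<kappa>) \<le> c * ((1 + \<kappa>) / 2)"
      using c0 by (rule mult_left_mono)
    moreover have "N = c * ((1 - \<kappa>) / 2)"
      using \<kappa> by (simp add: c_def)
    ultimately show ?thesis
      by (simp add: algebra_simps)
  qed
  have "norm (euler v D \<Delta> j l y0 - euler v D \<Delta> j k y0 -
        Inc v D (real (j + k) * \<Delta>) (real (j + l) * \<Delta>) (euler v D \<Delta> j k y0))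
        \<le> c * (real (l - k) * \<Delta>) powr \<theta> \<and> euler v D \<Delta> j l y0 \<in> cball y0 1"
    if S: "convex S" and reg: "regular_on S M v D" and y0: "cball y0 2 \<subseteq> S" and \<Delta>: "0 \<le> \<Delta>"
      and jm: "real (j + m) * \<Delta> \<le> T" and mh: "real m * \<Delta> \<le> h" and kl: "k \<le> l" "l \<le> m"
    for S :: "'a set" and v D y0 \<Delta> j m k l
  proof -
    define t where "t k = real (j + k) * \<Delta>" for k
    define y where "y k = euler v D \<Delta> j k y0" for k
    define \<rho> where "\<rho> k l = y l - y k - Inc v D (t k) (t l) (y k)" for k l
    have t0: "0 \<le> t k" for k
      using \<Delta> by (simp add: t_def)
    have t_mono: "t k \<le> t l" if "k \<le> l" for k l
      using \<Delta> that by (simp add: t_def mult_right_mono)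
    have tT: "t k \<le> T" if "k \<le> m" for k
      using t_mono[OF that] jm by (simp add: t_def)
    have t_diff: "t l - t k = real (l - k) * \<Delta>" if "k \<le> l" for k l
      using that by (simp add: t_def algebra_simps of_nat_diff)
    have small: "t l - t k \<le> h" if "k \<le> l" "l \<le> m" for k l
      unfolding t_diff[OF that(1)] using \<Delta> that mult_right_mono[of "real (l - k)" "real m" \<Delta>] mh by force
    have small_r: "(t l - t k) powr \<beta> \<le> r" if "k \<le> l" "l \<le> m" for k l
      unfolding hr[symmetric] using small[OF that] t_mono[OF that(1)] \<beta> by (intro powr_mono2) auto
    have Ar_le: "A * (t l - t k) powr \<beta> \<le> A * r" if "k \<le> l" "l \<le> m" for k l
      using small_r[OF that] A0 by (rule mult_left_mono)
    have sub: "cball y0 1 \<subseteq> S"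
      using y0 by (rule order_trans[rotated]) auto
    have "\<forall>k\<le>n. \<forall>l\<le>n. k \<le> l \<longrightarrow> norm (\<rho> k l) \<le> c * (t l - t k) powr \<theta> \<and> y l \<in> cball y0 1"
      if "n \<le> m" for n
      using that
    proof (induction n)
      case 0
      then show ?case
        using Inc_self[OF t0 tT] by (auto simp: \<rho>_def y_def)
    next
      case (Suc n)
      let ?L = "Suc n"
      have IH: "norm (\<rho> k l) \<le> c * (t l - t k) powr \<theta>" "y l \<in> cball y0 1"
        if "k \<le> l" "l \<le> n" for k l
        using Suc that by auto
      \<comment> \<open>Blocks ending at the new point are treated by induction on their length.
        Only earlier points, already known to lie in the unit ball, enter; that the new point lies
        there is afterwards read off the block starting at 0.\<close>
      have rho: "norm (\<rho> (?L - n') ?L) \<le> c * (t ?L - t (?L - n')) powr \<theta>" if "n' \<le> ?L" for n'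
        using that
      proof (induction n' rule: less_induct)
        case (less q)
        consider "q = 0" | "q = 1" | "2 \<le> q"
          by linarith
        then show ?case
        proof cases
          case 1
          then show ?thesis
            using Inc_self[OF t0 tT[OF Suc.prems]] by (auto simp: \<rho>_def)
        next
          case 2
          then have "\<rho> (?L - q) ?L = 0"
            by (simp add: \<rho>_def y_def t_def)
          then show ?thesis
            using c0 by simp
        next
          case 3
          define k where "k = ?L - q"
          \<comment> \<open>The right half has \<open>b\<close> steps and the left half
            \<open>q - b\<close>; for \<open>q >= 2\<close> neither exceeds two thirds of
            \<open>q\<close>.\<close>
          define b where "b = q div 2"
          define i where "i = ?L - b"
          have b: "1 \<le> b" "b < q" "b \<le> ?L"
            using 3 less.prems by (auto simp: b_def)
          have ki: "k \<le> i" "i \<le> n" "k \<le> n" "k \<le> ?L" "i \<le> ?L"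
            using b less.prems by (auto simp: k_def i_def)
          \<comment> \<open>The one-step prediction of \<open>y i\<close>. It misses
            \<open>y i\<close> by exactly the remainder of the left block, and it may leave the unit
            ball, which is why regularity is required on the ball of radius 2.\<close>
          define z where "z = y k + Inc v D (t k) (t i) (y k)"
          have yk: "y k \<in> cball y0 1" and yi: "y i \<in> cball y0 1"
            using IH(2)[of k k] IH(2)[of i i] ki by auto
          have km: "k \<le> m" "i \<le> m" "?L \<le> m"
            using ki Suc.prems by auto
          have "norm (Inc v D (t k) (t i) (y k)) \<le> A * (t i - t k) powr \<beta>"
            unfolding A_def using yk sub small[OF ki(1) km(2)] h
            by (intro Inc_bound[OF S reg] t0 t_mono ki tT km) auto
          also have "\<dots> \<le> 1"
            using Ar_le[OF ki(1) km(2)] Ar \<kappa> by simp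
          finally have "z \<in> cball y0 2"
            using yk norm_triangle_ineq4[of "y0 - y k" "Inc v D (t k) (t i) (y k)"]
            by (simp add: z_def dist_norm algebra_simps)
          then have zS: "z \<in> S"
            using y0 by auto
          have "\<rho> k ?L = \<rho> i ?L + \<rho> k i + (Inc v D (t i) (t ?L) (y i) - Inc v D (t i) (t ?L) z)
            + (Inc v D (t k) (t i) (y k) + Inc v D (t i) (t ?L) z - Inc v D (t k) (t ?L) (y k))"
            by (simp add: \<rho>_def)
          also have "norm \<dots> \<le> c * (t ?L - t i) powr \<theta> + c * (t i - t k) powr \<theta>
            + A * r * (c * (t i - t k) powr \<theta>) + N * (t ?L - t k) powr \<theta>"
          proof (intro norm_triangle_mono)
            show "norm (\<rho> i ?L) \<le> c * (t ?L - t i) powr \<theta>"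
              using less.IH[of b] b unfolding i_def by auto
            show ki_le: "norm (\<rho> k i) \<le> c * (t i - t k) powr \<theta>"
              using IH ki by auto
            have "norm (Inc v D (t i) (t ?L) (y i) - Inc v D (t i) (t ?L) z)
              \<le> A * (t ?L - t i) powr \<beta> * norm (y i - z)"
              unfolding A_def using yi sub small[OF ki(5) km(3)] h
              by (intro Inc_lipschitz[OF S reg] t0 t_mono ki tT km zS) auto
            also have "y i - z = \<rho> k i"
              by (simp add: \<rho>_def z_def)
            also have "A * (t ?L - t i) powr \<beta> * norm (\<rho> k i) \<le> A * r * (c * (t i - t k) powr \<theta>)"
              using A0 r by (intro mult_mono[OF Ar_le[OF ki(5) km(3)] ki_le]) auto
            finally show "norm (Inc v D (t i) (t ?L) (y i) - Inc v D (t i) (t ?L) z)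
              \<le> A * r * (c * (t i - t k) powr \<theta>)" .
            show "norm (Inc v D (t k) (t i) (y k) + Inc v D (t i) (t ?L) z - Inc v D (t k) (t ?L) (y k))
              \<le> N * (t ?L - t k) powr \<theta>"
              unfolding N_def \<theta>_def z_def using yk sub small[OF ki(4) km(3)] h zS[unfolded z_def]
              by (intro Inc_defect[OF S reg] t0 t_mono ki tT km) auto
          qed
          also have "\<dots> \<le> (1 + A * r) * (c * ((t i - t k) powr \<theta> + (t ?L - t i) powr \<theta>))
            + N * (t ?L - t k) powr \<theta>"
            using A0 r c0 by (simp add: algebra_simps)
          also have "(t i - t k) powr \<theta> + (t ?L - t i) powr \<theta> \<le> \<kappa> * (t ?L - t k) powr \<theta>"
          proof -
            have "(i - k) * 3 \<le> 2 * q" "b * 3 \<le> 2 * q"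
            proof -
              have "i - k = q - b"
                using b less.prems unfolding i_def k_def by linarith
              moreover have "(q - q div 2) * 3 \<le> 2 * q" "q div 2 * 3 \<le> 2 * q"
                using 3 by presburger+
              ultimately show "(i - k) * 3 \<le> 2 * q" "b * 3 \<le> 2 * q"
                by (auto simp: b_def)
            qed
            then have le: "real (i - k) * 3 \<le> 2 * real q" "real b * 3 \<le> 2 * real q"
              by linarith+
            have eq: "t i - t k = real (i - k) * \<Delta>" "t ?L - t i = real b * \<Delta>" "t ?L - t k = real q * \<Delta>"
              using ki b less.prems by (auto simp: t_diff i_def k_def)
            have "t i - t k \<le> 2/3 * (t ?L - t k)" "t ?L - t i \<le> 2/3 * (t ?L - t k)"
              unfolding eq using mult_right_mono[OF le(1) \<Delta>] mult_right_mono[OF le(2) \<Delta>] by simp_all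
            then show ?thesis
              using powr_split_le[of "t i - t k" "t ?L - t i" \<theta>] \<theta> t_mono[OF ki(1)] t_mono[OF ki(5)]
              by (simp add: \<kappa>_def)
          qed
          also have "(1 + A * r) * (c * (\<kappa> * (t ?L - t k) powr \<theta>)) + N * (t ?L - t k) powr \<theta>
            = ((1 + A * r) * (c * \<kappa>) + N) * (t ?L - t k) powr \<theta>"
            by (simp add: algebra_simps)
          also have "\<dots> \<le> c * (t ?L - t k) powr \<theta>"
            using absorb by (intro mult_right_mono) auto
          finally show ?thesis
            using A0 c0 r unfolding k_def by (simp add: mult_left_mono)
        qed
      qed
      have "norm (\<rho> 0 ?L) \<le> c * (t ?L - t 0) powr \<theta>"
        using rho[of ?L] by simp
      also have "\<dots> \<le> c * r^3"
        unfolding \<theta>_def powr_cube[symmetric] using small_r[of 0 ?L] Suc.prems c0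
        by (intro mult_left_mono power_mono) auto
      finally have "norm (\<rho> 0 ?L) \<le> 1/2"
        using cr by linarith
      moreover have "norm (Inc v D (t 0) (t ?L) (y 0)) \<le> 1/2"
      proof -
        have "norm (Inc v D (t 0) (t ?L) (y 0)) \<le> A * (t ?L - t 0) powr \<beta>"
          unfolding A_def using sub small[of 0 ?L] h Suc.prems
          by (intro Inc_bound[OF S reg] t0 t_mono tT) (auto simp: y_def)
        then show ?thesis
          using Ar_le[of 0 ?L] Suc.prems Ar \<kappa> by simp
      qed
      ultimately have "norm (\<rho> 0 ?L + Inc v D (t 0) (t ?L) (y 0)) \<le> 1"
        using norm_triangle_ineq[of "\<rho> 0 ?L" "Inc v D (t 0) (t ?L) (y 0)"] by linarith
      then have new: "y ?L \<in> cball y0 1"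
        by (simp add: \<rho>_def y_def dist_norm norm_minus_commute del: euler.simps(2))
      have rho': "norm (\<rho> k ?L) \<le> c * (t ?L - t k) powr \<theta>" if "k \<le> ?L" for k
        using rho[of "?L - k"] that by simp
      show ?case
        using IH new rho' by (auto simp: le_Suc_eq)
    qed
    from this[of m] kl show ?thesis
      unfolding \<rho>_def y_def t_def[symmetric] t_diff[OF kl(1), symmetric] by auto
  qed
  then show ?thesis
    using that[of h c] h c0 Ar \<kappa> unfolding hr A_def \<theta>_def by auto
qed

end

section \<open>Tangent vector fields\<close>

text \<open>The second difference \<open>\<Delta> a b t\<close> is symmetric in \<open>a\<close> and
  \<open>b\<close> and agrees with \<open>t^2 *\<^sub>R D2 x a b\<close> up to order
  \<open>t^3\<close>; dividing by \<open>t^2\<close> and letting \<open>t\<close> tend to 0 gives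
  the symmetry.\<close>

lemma mixed_derivatives_commute:
  fixes w :: "'a::real_normed_vector \<Rightarrow> 'b::real_normed_vector"
  assumes D: "\<And>x. (w has_derivative D x) (at x)"
    and D2: "\<And>x a. ((\<lambda>x. D x a) has_derivative D2 x a) (at x)"
    and lip: "\<And>x y a b. norm (D2 x a b - D2 y a b) \<le> C * norm (x - y) * norm a * norm b"
  shows "D2 x a b = D2 x b a"
proof -
  define \<Delta> where "\<Delta> a b t = w (x + t *\<^sub>R a + t *\<^sub>R b) - w (x + t *\<^sub>R a) - w (x + t *\<^sub>R b) + w x" for a b and t :: real
  define C' where "C' = max C 0"
  have C': "0 \<le> C'" and lip': "norm (D2 x a b - D2 y a b) \<le> C' * norm (x - y) * norm a * norm b" for x y a b
    by (auto simp: C'_def intro!: order_trans[OF lip] mult_right_mono)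
  have est: "norm (\<Delta> a b t - t^2 *\<^sub>R D2 x a b) \<le> t^3 * (C' * (norm a + norm b) * norm a * norm b)" if t: "0 < t" for a b t
  proof -
    define R where "R = t * (norm a + norm b)"
    have ball: "x + s *\<^sub>R a + r *\<^sub>R b \<in> cball x R" if "0 \<le> s" "s \<le> t" "0 \<le> r" "r \<le> t" for s r
    proof -
      have "norm (s *\<^sub>R a + r *\<^sub>R b) \<le> s * norm a + r * norm b"
        using norm_triangle_ineq[of "s *\<^sub>R a" "r *\<^sub>R b"] that by simp
      also have "\<dots> \<le> R"
        unfolding R_def using that by (simp add: distrib_left add_mono mult_right_mono)
      finally show ?thesis
        using norm_minus_cancel[of "s *\<^sub>R a + r *\<^sub>R b"]
        by (simp add: dist_norm add.assoc del: norm_minus_cancel)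
    qed
    have inner: "norm (D (x + s *\<^sub>R a + t *\<^sub>R b) a - D (x + s *\<^sub>R a) a - D2 x a (t *\<^sub>R b)) \<le> norm (t *\<^sub>R b) * (C' * R * norm a)"
      if s: "0 \<le> s" "s \<le> t" for s
    proof -
      have "norm (D (x + s *\<^sub>R a + t *\<^sub>R b) a - D (x + s *\<^sub>R a) a - D2 x a (x + s *\<^sub>R a + t *\<^sub>R b - (x + s *\<^sub>R a)))
        \<le> norm (x + s *\<^sub>R a + t *\<^sub>R b - (x + s *\<^sub>R a)) * (C' * R * norm a)"
      proof (rule differentiable_bound_linearization[where f = "\<lambda>y. D y a" and f' = "\<lambda>y. D2 y a" and ?x0.0 = x and S = "cball x R"])
        show "x + s *\<^sub>R a + u *\<^sub>R (x + s *\<^sub>R a + t *\<^sub>R b - (x + s *\<^sub>R a)) \<in> cball x R" if "u \<in> {0..1}" for u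
          using ball[of s "u * t"] s t that by (simp add: mult_left_le_one_le)
        show "onorm (D2 y a - D2 x a) \<le> C' * R * norm a" if "y \<in> cball x R" for y
        proof (rule onorm_bound)
          show R: "0 \<le> C' * R * norm a"
            using C' t by (simp add: R_def)
          show "norm ((D2 y a - D2 x a) b) \<le> C' * R * norm a * norm b" for b
            using that C' by (auto intro!: order_trans[OF lip'] mult_right_mono mult_left_mono simp: dist_norm norm_minus_commute)
        qed
        show "x \<in> cball x R"
          using t by (simp add: R_def)
      qed (auto intro: has_derivative_at_withinI D2)
      then show ?thesis
        by simp
    qed
    \<comment> \<open>With the expected bilinear term subtracted, the derivative in \<open>s\<close>
      is the quantity bounded by \<open>inner\<close>, which has order \<open>t^2\<close>; the mean
      value theorem on \<open>{0..t}\<close> supplies the third power.\<close>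
    define g where "g s = w (x + s *\<^sub>R a + t *\<^sub>R b) - w (x + s *\<^sub>R a) - s *\<^sub>R D2 x a (t *\<^sub>R b)" for s
    have lin: "linear (D y)" for y
      using D by (rule has_derivative_linear)
    have lin2: "linear (D2 y a)" for y a
      using D2 by (rule has_derivative_linear)
    have "norm (g t - g 0) \<le> norm (t *\<^sub>R b) * (C' * R * norm a) * norm (t - 0)"
    proof (rule differentiable_bound[where S = "{0..t}"])
      show "(g has_derivative (\<lambda>d. d *\<^sub>R (D (x + s *\<^sub>R a + t *\<^sub>R b) a - D (x + s *\<^sub>R a) a - D2 x a (t *\<^sub>R b)))) (at s within {0..t})" for s
      proof -
        have "((\<lambda>s. w (x + s *\<^sub>R a + t *\<^sub>R b)) has_derivative (\<lambda>d. D (x + s *\<^sub>R a + t *\<^sub>R b) (d *\<^sub>R a))) (at s within {0..t})"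
          by (rule has_derivative_compose[OF _ D]) (auto intro!: derivative_eq_intros)
        moreover have "((\<lambda>s. w (x + s *\<^sub>R a)) has_derivative (\<lambda>d. D (x + s *\<^sub>R a) (d *\<^sub>R a))) (at s within {0..t})"
          by (rule has_derivative_compose[OF _ D]) (auto intro!: derivative_eq_intros)
        ultimately have "(g has_derivative (\<lambda>d. D (x + s *\<^sub>R a + t *\<^sub>R b) (d *\<^sub>R a) - D (x + s *\<^sub>R a) (d *\<^sub>R a)
          - d *\<^sub>R D2 x a (t *\<^sub>R b))) (at s within {0..t})"
          unfolding g_def by (intro has_derivative_diff) (auto intro!: derivative_eq_intros)
        then show ?thesis
          by (simp add: linear_scale[OF lin] scaleR_diff_right)
      qed
      show "onorm (\<lambda>d::real. d *\<^sub>R (D (x + s *\<^sub>R a + t *\<^sub>R b) a - D (x + s *\<^sub>R a) a - D2 x a (t *\<^sub>R b)))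
        \<le> norm (t *\<^sub>R b) * (C' * R * norm a)" if "s \<in> {0..t}" for s
        using inner[of s] that C' t
        by (intro onorm_bound) (auto simp: R_def mult.commute intro!: mult_left_mono)
    qed (use t in auto)
    then show ?thesis
      using t by (simp add: g_def \<Delta>_def R_def linear_scale[OF lin2] algebra_simps power2_eq_square power3_eq_cube)
  qed
  define E where "E = C' * (norm a + norm b) * norm a * norm b"
  have E: "0 \<le> E"
    using C' by (simp add: E_def)
  have le: "norm (D2 x a b - D2 x b a) \<le> 0 + t" if t: "0 < t" for t
  proof -
    \<comment> \<open>The difference of the two derivatives is at most \<open>2 * s * E\<close>, and
      this choice makes that at most \<open>t\<close>.\<close>
    define s where "s = t / (2 * (E + 1))"
    have s: "0 < s"
      using t E by (simp add: s_def)
    have "\<Delta> a b s = \<Delta> b a s"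
      by (simp add: \<Delta>_def algebra_simps)
    then have "s^2 *\<^sub>R (D2 x a b - D2 x b a) = (\<Delta> b a s - s^2 *\<^sub>R D2 x b a) - (\<Delta> a b s - s^2 *\<^sub>R D2 x a b)"
      by (simp add: scaleR_diff_right)
    also have "norm \<dots> \<le> s^3 * E + s^3 * E"
      using est[OF s, of a b] est[OF s, of b a]
      by (intro order_trans[OF norm_triangle_ineq4 add_mono]) (auto simp: E_def ac_simps)
    finally have "s^2 * norm (D2 x a b - D2 x b a) \<le> s^2 * (2 * s * E)"
      unfolding norm_scaleR by (simp add: power3_eq_cube power2_eq_square ac_simps)
    then have "norm (D2 x a b - D2 x b a) \<le> 2 * s * E"
      using s by simp
    also have "\<dots> = t * (E / (E + 1))"
      using E by (simp add: s_def field_simps)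
    also have "\<dots> \<le> t"
      using t E by (intro mult_left_le) auto
    finally show ?thesis
      by simp
  qed
  have "norm (D2 x a b - D2 x b a) \<le> 0"
    by (rule field_le_epsilon) (use le in auto)
  then show ?thesis
    by simp
qed

definition twice_diff ::
  "('d \<Rightarrow> 'a::real_normed_vector \<Rightarrow> 'b::real_normed_vector) \<Rightarrow> ('d \<Rightarrow> 'a \<Rightarrow> 'a \<Rightarrow> 'b) \<Rightarrow> ('d \<Rightarrow> 'a \<Rightarrow> 'a \<Rightarrow> 'a \<Rightarrow> 'b) \<Rightarrow> bool" where
  "twice_diff v D D2 \<longleftrightarrow> (\<forall>i y. (v i has_derivative D i y) (at y) \<and>
     (\<forall>a. ((\<lambda>y. D i y a) has_derivative D2 i y a) (at y)) \<and> (\<forall>a b. D2 i y a b = D2 i y b a))"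

lemma twice_diffD:
  assumes "twice_diff v D D2"
  shows "(v i has_derivative D i y) (at y)" "((\<lambda>y. D i y a) has_derivative D2 i y a) (at y)"
    "D2 i y a b = D2 i y b a" "linear (D i y)" "linear (D2 i y a)" "linear (\<lambda>a. D2 i y a b)"
proof -
  show 1: "(v i has_derivative D i y) (at y)" "((\<lambda>y. D i y a) has_derivative D2 i y a) (at y)"
    and 2: "\<And>a b. D2 i y a b = D2 i y b a" for a
    using assms unfolding twice_diff_def by blast+
  show "linear (D i y)" "linear (D2 i y a)"
    using 1 by (auto intro: has_derivative_linear)
  have "linear (D2 i y b)"
    using 1(2) by (rule has_derivative_linear)
  then show "linear (\<lambda>a. D2 i y a b)"
    unfolding 2[of _ b] .
qed

lemma linear_basis_expansion:
  fixes f :: "'a::euclidean_space \<Rightarrow> 'b::real_vector"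
  assumes "linear f"
  shows "f x = (\<Sum>b\<in>Basis. (x \<bullet> b) *\<^sub>R f b)"
proof -
  have "f x = f (\<Sum>b\<in>Basis. (x \<bullet> b) *\<^sub>R b)"
    by (simp add: euclidean_representation)
  then show ?thesis
    by (simp add: linear_sum[OF assms] linear_scale[OF assms])
qed

text \<open>The second derivative is given only for fixed directions. Expanding the moving direction
  in the basis reduces the claim to the product rule for a finite sum.\<close>

lemma has_derivative_moving_direction:
  fixes g w :: "'p::real_normed_vector \<Rightarrow> 'a::euclidean_space"
  assumes td: "twice_diff v D D2"
    and g: "(g has_derivative g') (at p)" and w: "(w has_derivative w') (at p)"
  shows "((\<lambda>p. D j (g p) (w p)) has_derivative (\<lambda>h. D j (g p) (w' h) + D2 j (g p) (w p) (g' h))) (at p)"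
proof -
  have "((\<lambda>p. \<Sum>b\<in>Basis. (w p \<bullet> b) *\<^sub>R D j (g p) b) has_derivative
    (\<lambda>h. \<Sum>b\<in>Basis. (w p \<bullet> b) *\<^sub>R D2 j (g p) b (g' h) + (w' h \<bullet> b) *\<^sub>R D j (g p) b)) (at p)"
  proof (intro has_derivative_sum has_derivative_scaleR)
    show "((\<lambda>p. w p \<bullet> b) has_derivative (\<lambda>h. w' h \<bullet> b)) (at p)" for b
      using w by (rule has_derivative_inner_left)
    show "((\<lambda>p. D j (g p) b) has_derivative (\<lambda>h. D2 j (g p) b (g' h))) (at p)" for b
      by (rule has_derivative_compose[OF g twice_diffD(2)[OF td]])
  qed
  then show ?thesis
    unfolding sum.distrib linear_basis_expansion[OF twice_diffD(4)[OF td], symmetric]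
      linear_basis_expansion[OF twice_diffD(6)[OF td], symmetric]
    by (simp add: add.commute)
qed

definition tangent :: "('d \<Rightarrow> 'a \<Rightarrow> 'a) \<Rightarrow> ('d \<Rightarrow> 'a \<Rightarrow> 'a \<Rightarrow> 'a) \<Rightarrow> 'd \<Rightarrow> 'a \<times> 'a \<Rightarrow> 'a \<times> 'a" where
  "tangent v D i p = (v i (fst p), D i (fst p) (snd p))"

definition tangent_deriv ::
  "('d \<Rightarrow> 'a \<Rightarrow> 'a \<Rightarrow> 'a) \<Rightarrow> ('d \<Rightarrow> 'a \<Rightarrow> 'a \<Rightarrow> 'a \<Rightarrow> 'a::plus) \<Rightarrow> 'd \<Rightarrow> 'a \<times> 'a \<Rightarrow> 'a \<times> 'a \<Rightarrow> 'a \<times> 'a" where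
  "tangent_deriv D D2 i p q =
     (D i (fst p) (fst q), D i (fst p) (snd q) + D2 i (fst p) (snd p) (fst q))"

definition tangent_deriv2 ::
  "('d \<Rightarrow> 'a \<Rightarrow> 'a \<Rightarrow> 'a \<Rightarrow> 'a) \<Rightarrow> ('d \<Rightarrow> 'a \<Rightarrow> 'a \<Rightarrow> 'a \<Rightarrow> 'a \<Rightarrow> 'a::plus) \<Rightarrow>
   'd \<Rightarrow> 'a \<times> 'a \<Rightarrow> 'a \<times> 'a \<Rightarrow> 'a \<times> 'a \<Rightarrow> 'a \<times> 'a" where
  "tangent_deriv2 D2 D3 i p q r =
     (D2 i (fst p) (fst q) (fst r),
      D2 i (fst p) (snd q) (fst r) + (D2 i (fst p) (snd r) (fst q) + D3 i (fst p) (snd p) (fst q) (fst r)))"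

lemma has_derivative_tangent:
  fixes v :: "'d \<Rightarrow> 'a::euclidean_space \<Rightarrow> 'a"
  assumes "twice_diff v D D2"
  shows "(tangent v D i has_derivative tangent_deriv D D2 i p) (at p)"
  unfolding tangent_def[abs_def] tangent_deriv_def
  by (intro has_derivative_Pair has_derivative_moving_direction[OF assms]
      has_derivative_compose[OF _ twice_diffD(1)[OF assms]] bounded_linear_imp_has_derivative
      bounded_linear_fst bounded_linear_snd)

text \<open>The tangent construction is iterated, so its hypotheses have to be reproduced for the
  tangent field; this is what asks each partial field \<open>D i x a\<close> to be twice
  differentiable itself.\<close>

lemma twice_diff_tangent:
  fixes v :: "'d \<Rightarrow> 'a::euclidean_space \<Rightarrow> 'a"
  assumes td: "twice_diff v D D2" and td3: "\<And>a. twice_diff (\<lambda>i x. D i x a) (\<lambda>i x. D2 i x a) (\<lambda>i x. D3 i x a)"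
  shows "twice_diff (tangent v D) (tangent_deriv D D2) (tangent_deriv2 D2 D3)"
proof -
  have "((\<lambda>p. tangent_deriv D D2 i p a) has_derivative tangent_deriv2 D2 D3 i p a) (at p)" for i p a
  proof -
    have D3: "((\<lambda>p. D2 i (fst p) (snd p) (fst a)) has_derivative
      (\<lambda>r. D2 i (fst p) (snd r) (fst a) + D3 i (fst p) (snd p) (fst a) (fst r))) (at p)"
    proof -
      \<comment> \<open>The moving component sits in the first slot of \<open>D2\<close>, while the
        rule for moving directions acts on the last slot. Symmetry of \<open>D2\<close>, inherited
        by \<open>D3\<close> through uniqueness of derivatives, exchanges them.\<close>
      have sym: "D2 i x b c = D2 i x c b" for x b c
        using twice_diffD(3)[OF td] .
      have "D3 i x b c d = D3 i x c b d" for x b c d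
      proof -
        have "((\<lambda>x. D2 i x b c) has_derivative D3 i x b c) (at x)" "((\<lambda>x. D2 i x c b) has_derivative D3 i x c b) (at x)"
          by (rule twice_diffD(2)[OF td3])+
        then have "D3 i x b c = D3 i x c b"
          unfolding sym[of _ b c] by (rule has_derivative_unique)
        then show ?thesis
          by (rule fun_cong)
      qed
      then show ?thesis
        using has_derivative_moving_direction[OF td3[of "fst a"], where g = fst and w = snd, where p = p and j = i
          and g' = fst and w' = snd]
        unfolding sym[of _ _ "fst a"] by (simp add: bounded_linear_imp_has_derivative bounded_linear_fst bounded_linear_snd)
    qed
    show ?thesis
      unfolding tangent_deriv_def[abs_def] tangent_deriv2_def[abs_def]
      by (intro has_derivative_Pair has_derivative_add D3
          has_derivative_compose[OF _ twice_diffD(2)[OF td]] bounded_linear_imp_has_derivative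
          bounded_linear_fst bounded_linear_snd)
  qed
  moreover have "tangent_deriv2 D2 D3 i p a b = tangent_deriv2 D2 D3 i p b a" for i p a b
    unfolding tangent_deriv2_def twice_diffD(3)[OF td, of i "fst p" "fst a" "fst b"]
      twice_diffD(3)[OF td3, of i "fst p" "snd p" "fst a" "fst b"]
    by (simp only: add.left_commute)
  ultimately show ?thesis
    using has_derivative_tangent[OF td] unfolding twice_diff_def by blast
qed

context rough_path
begin

text \<open>Symmetry of the second derivative is essential: differentiating
  \<open>D j y (v i y)\<close> produces \<open>D2 j y (v i y) a\<close>, whereas the tangent field
  produces \<open>D2 j y a (v i y)\<close>.\<close>

lemma Inc_tangent:
  fixes v :: "'d \<Rightarrow> 'a::euclidean_space \<Rightarrow> 'a"
  assumes td: "twice_diff v D D2"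
  shows "fst (Inc (tangent v D) (tangent_deriv D D2) s t p) = Inc v D s t (fst p)"
    and "(Inc v D s t has_derivative (\<lambda>a. snd (Inc (tangent v D) (tangent_deriv D D2) s t (x, a)))) (at x)"
proof -
  show "fst (Inc (tangent v D) (tangent_deriv D D2) s t p) = Inc v D s t (fst p)"
    by (simp add: Inc_def rough_increment_def fst_sum tangent_def tangent_deriv_def)
  have "(Inc v D s t has_derivative (\<lambda>a. (\<Sum>i\<in>UNIV. increment X s t $ i *\<^sub>R D i x a) +
     (\<Sum>i\<in>UNIV. \<Sum>j\<in>UNIV. XX s t $ i $ j *\<^sub>R (D j x (D i x a) + D2 j x (v i x) a)))) (at x)"
    unfolding Inc_def rough_increment_def[abs_def]
    by (intro has_derivative_add has_derivative_sum has_derivative_scaleR_right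
        has_derivative_moving_direction[OF td] twice_diffD(1)[OF td] has_derivative_ident)
  then show "(Inc v D s t has_derivative (\<lambda>a. snd (Inc (tangent v D) (tangent_deriv D D2) s t (x, a)))) (at x)"
    by (simp add: Inc_def rough_increment_def snd_sum tangent_def tangent_deriv_def twice_diffD(3)[OF td, of _ x "v _ x"])
qed

lemma euler_tangent:
  fixes v :: "'d \<Rightarrow> 'a::euclidean_space \<Rightarrow> 'a"
  assumes td: "twice_diff v D D2"
  shows "fst (euler (tangent v D) (tangent_deriv D D2) \<Delta> j m p) = euler v D \<Delta> j m (fst p)"
    and "(euler v D \<Delta> j m has_derivative (\<lambda>a. snd (euler (tangent v D) (tangent_deriv D D2) \<Delta> j m (x, a)))) (at x)"
proof (induction m arbitrary: p x)
  case (Suc m)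
  {
    case 1
    show ?case
      using Suc(1) by (simp add: Inc_tangent(1)[OF td])
  next
    case 2
    let ?e = "\<lambda>a. euler (tangent v D) (tangent_deriv D D2) \<Delta> j m (x, a)"
    have "?e a = (euler v D \<Delta> j m x, snd (?e a))" for a
      using Suc(1)[of "(x, a)"] by (metis fst_conv prod.collapse)
    then have eq: "Inc (tangent v D) (tangent_deriv D D2) s t (?e a)
      = Inc (tangent v D) (tangent_deriv D D2) s t (euler v D \<Delta> j m x, snd (?e a))" for a s t
      by metis
    show ?case
      unfolding euler.simps snd_add eq
      by (intro has_derivative_add Suc(2) has_derivative_compose[OF Suc(2) Inc_tangent(2)[OF td]])
  }
qed (auto simp: euler.simps(1)[abs_def])

end

section \<open>Arithmetic of bounded Lipschitz functions\<close>

definition bounded_lipschitz_on :: "'p::real_normed_vector set \<Rightarrow> real \<Rightarrow> ('p \<Rightarrow> 'b::real_normed_vector) \<Rightarrow> bool" where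
  "bounded_lipschitz_on R M g \<longleftrightarrow> 0 \<le> M \<and> (\<forall>p\<in>R. norm (g p) \<le> M) \<and>
     (\<forall>p\<in>R. \<forall>q\<in>R. norm (g p - g q) \<le> M * norm (p - q))"

lemma bounded_lipschitz_onI:
  assumes "0 \<le> M" "\<And>p. p \<in> R \<Longrightarrow> norm (g p) \<le> M"
    "\<And>p q. p \<in> R \<Longrightarrow> q \<in> R \<Longrightarrow> norm (g p - g q) \<le> M * norm (p - q)"
  shows "bounded_lipschitz_on R M g"
  using assms unfolding bounded_lipschitz_on_def by blast

lemma bounded_lipschitz_on_mono:
  assumes "bounded_lipschitz_on R M g" "M \<le> M'"
  shows "bounded_lipschitz_on R M' g"
proof (rule bounded_lipschitz_onI)
  fix p q
  assume "p \<in> R" "q \<in> R"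
  then have "norm (g p - g q) \<le> M * norm (p - q)"
    using assms(1) unfolding bounded_lipschitz_on_def by blast
  also have "\<dots> \<le> M' * norm (p - q)"
    using assms(2) by (rule mult_right_mono) simp
  finally show "norm (g p - g q) \<le> M' * norm (p - q)" .
qed (use assms in \<open>force simp: bounded_lipschitz_on_def\<close>)+

lemma bounded_lipschitz_on_add:
  assumes "bounded_lipschitz_on R M f" "bounded_lipschitz_on R N g"
  shows "bounded_lipschitz_on R (M + N) (\<lambda>p. f p + g p)"
proof (rule bounded_lipschitz_onI)
  fix p q
  assume pq: "p \<in> R" "q \<in> R"
  have "norm (f p + g p - (f q + g q)) \<le> norm (f p - f q) + norm (g p - g q)"
    by (metis add_diff_add norm_triangle_ineq)
  also have "\<dots> \<le> M * norm (p - q) + N * norm (p - q)"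
    using assms pq unfolding bounded_lipschitz_on_def by (intro add_mono) blast+
  finally show "norm (f p + g p - (f q + g q)) \<le> (M + N) * norm (p - q)"
    by (simp add: algebra_simps)
  show "norm (f p + g p) \<le> M + N"
    using assms pq unfolding bounded_lipschitz_on_def by (intro norm_triangle_mono) blast+
qed (use assms in \<open>auto simp: bounded_lipschitz_on_def\<close>)

lemma bounded_lipschitz_on_Pair:
  assumes "bounded_lipschitz_on R M f" "bounded_lipschitz_on R N g"
  shows "bounded_lipschitz_on R (M + N) (\<lambda>p. (f p, g p))"
proof (rule bounded_lipschitz_onI)
  have le: "norm (x, y) \<le> norm x + norm y" for x :: 'b and y :: 'c
    by (simp add: norm_Pair sqrt_sum_squares_le_sum)
  fix p q
  assume pq: "p \<in> R" "q \<in> R"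
  have "norm ((f p, g p) - (f q, g q)) \<le> norm (f p - f q) + norm (g p - g q)"
    using le by simp
  also have "\<dots> \<le> M * norm (p - q) + N * norm (p - q)"
    using assms pq unfolding bounded_lipschitz_on_def by (intro add_mono) blast+
  finally show "norm ((f p, g p) - (f q, g q)) \<le> (M + N) * norm (p - q)"
    by (simp add: algebra_simps)
  show "norm (f p, g p) \<le> M + N"
    using assms pq unfolding bounded_lipschitz_on_def by (intro order_trans[OF le] add_mono) blast+
qed (use assms in \<open>auto simp: bounded_lipschitz_on_def\<close>)

text \<open>Product rule for a linear map and a vector that both depend on the point; the factor 2
  counts the two differences.\<close>

lemma bounded_lipschitz_on_apply:
  assumes A: "\<And>u. bounded_lipschitz_on R (M * norm u) (\<lambda>p. A p u)" and M: "0 \<le> M"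
    and lin: "\<And>p. linear (A p)" and a: "bounded_lipschitz_on R N a"
  shows "bounded_lipschitz_on R (2 * M * N) (\<lambda>p. A p (a p))"
proof (rule bounded_lipschitz_onI)
  have N: "0 \<le> N"
    using a by (simp add: bounded_lipschitz_on_def)
  then show "0 \<le> 2 * M * N"
    using M by simp
  have A_le: "norm (A p u) \<le> M * norm u" if "p \<in> R" for p u
    using A that unfolding bounded_lipschitz_on_def by blast
  fix p q
  assume pq: "p \<in> R" "q \<in> R"
  have "norm (A p (a p)) \<le> M * N"
    using A_le[OF pq(1)] a pq M unfolding bounded_lipschitz_on_def
    by (meson mult_left_mono order_trans)
  then show "norm (A p (a p)) \<le> 2 * M * N"
    by (rule order_trans) (use M N in simp)
  have "A p (a p) - A q (a q) = A p (a p - a q) + (A p (a q) - A q (a q))"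
    by (simp add: linear_diff[OF lin])
  also have "norm \<dots> \<le> M * (N * norm (p - q)) + M * N * norm (p - q)"
  proof (rule norm_triangle_mono)
    have "norm (A p (a p - a q)) \<le> M * norm (a p - a q)"
      by (rule A_le[OF pq(1)])
    also have "norm (a p - a q) \<le> N * norm (p - q)"
      using a pq unfolding bounded_lipschitz_on_def by blast
    finally show "norm (A p (a p - a q)) \<le> M * (N * norm (p - q))"
      using M by (simp add: mult_left_mono)
    have "norm (A p (a q) - A q (a q)) \<le> M * norm (a q) * norm (p - q)"
      using A pq unfolding bounded_lipschitz_on_def by blast
    also have "M * norm (a q) \<le> M * N"
      using a pq M unfolding bounded_lipschitz_on_def by (intro mult_left_mono) blast+
    finally show "norm (A p (a q) - A q (a q)) \<le> M * N * norm (p - q)"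
      by (simp add: mult_right_mono)
  qed
  finally show "norm (A p (a p) - A q (a q)) \<le> 2 * M * N * norm (p - q)"
    by (simp add: algebra_simps)
qed

section \<open>Regularity of the second tangent field\<close>

locale smooth_fields =
  fixes v :: "'d::finite \<Rightarrow> 'a::euclidean_space \<Rightarrow> 'a" and D D2 D3 and B :: real
  assumes B: "0 \<le> B"
    and D: "\<And>i x. (v i has_derivative D i x) (at x)"
    and D2: "\<And>i x a. ((\<lambda>x. D i x a) has_derivative D2 i x a) (at x)"
    and D3: "\<And>i x a b. ((\<lambda>x. D2 i x a b) has_derivative D3 i x a b) (at x)"
    and bound0: "\<And>i x. norm (v i x) \<le> B"
    and bound1: "\<And>i x a. norm (D i x a) \<le> B * norm a"
    and bound2: "\<And>i x a b. norm (D2 i x a b) \<le> B * norm a * norm b"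
    and bound3: "\<And>i x a b c. norm (D3 i x a b c) \<le> B * norm a * norm b * norm c"
    and lip1: "\<And>i x y a. norm (D i x a - D i y a) \<le> B * norm (x - y) * norm a"
    and lip2: "\<And>i x y a b. norm (D2 i x a b - D2 i y a b) \<le> B * norm (x - y) * norm a * norm b"
    and lip3: "\<And>i x y a b c. norm (D3 i x a b c - D3 i y a b c) \<le> B * norm (x - y) * norm a * norm b * norm c"
begin

lemma twice_diff: "twice_diff v D D2"
  unfolding twice_diff_def by (intro conjI allI D D2 mixed_derivatives_commute[OF D D2 lip2])

lemma twice_diff_D: "twice_diff (\<lambda>i x. D i x a) (\<lambda>i x. D2 i x a) (\<lambda>i x. D3 i x a)"
proof -
  have "norm (D3 i x a b c - D3 i y a b c) \<le> (B * norm a) * norm (x - y) * norm b * norm c" for i x y b c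
    using lip3[of i x a b c y] by (simp add: algebra_simps)
  then show ?thesis
    unfolding twice_diff_def by (intro conjI allI D2 D3 mixed_derivatives_commute[OF D2 D3])
qed

lemmas twice_diff_tangent' = twice_diff_tangent[OF twice_diff twice_diff_D]

abbreviation "T1 \<equiv> tangent v D"
abbreviation "T1' \<equiv> tangent_deriv D D2"
abbreviation "T2 \<equiv> tangent T1 T1'"
abbreviation "T2' \<equiv> tangent_deriv T1' (tangent_deriv2 D2 D3)"

text \<open>Contains the balls of radius two around the points whose tangent components are at most one,
  as required by \<open>euler_estimate\<close>.\<close>

definition bounded_tangents :: "(('a \<times> 'a) \<times> 'a \<times> 'a) set" where
  "bounded_tangents = {p. norm (snd (fst p)) \<le> 3 \<and> norm (fst (snd p)) \<le> 3 \<and> norm (snd (snd p)) \<le> 3}"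

lemma convex_bounded_tangents: "convex bounded_tangents"
proof -
  have *: "norm (u *\<^sub>R x + w *\<^sub>R y) \<le> 3" if "norm x \<le> 3" "norm y \<le> 3" "0 \<le> u" "0 \<le> w" "u + w = 1"
    for x y :: 'a and u w :: real
    using convex_bound_le[of "norm x" 3 "norm y" u w] that
      norm_triangle_ineq[of "u *\<^sub>R x" "w *\<^sub>R y"] by simp
  show ?thesis
    unfolding convex_def bounded_tangents_def by (auto intro!: *)
qed

lemma norm_coordinates:
  fixes p :: "('a \<times> 'a) \<times> 'a \<times> 'a"
  shows "norm (fst (fst p)) \<le> norm p" "norm (snd (fst p)) \<le> norm p"
    "norm (fst (snd p)) \<le> norm p" "norm (snd (snd p)) \<le> norm p"
proof -
  have *: "norm (fst z) \<le> norm z" "norm (snd z) \<le> norm z" for z :: "'b::real_normed_vector \<times> 'c::real_normed_vector"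
    using norm_fst_le[of "fst z" "snd z"] norm_snd_le[of "snd z" "fst z"] by simp_all
  show "norm (fst (fst p)) \<le> norm p" "norm (snd (fst p)) \<le> norm p"
    "norm (fst (snd p)) \<le> norm p" "norm (snd (snd p)) \<le> norm p"
    by (rule order_trans[OF *(1) *(1)] order_trans[OF *(2) *(1)] order_trans[OF *(1) *(2)] order_trans[OF *(2) *(2)])+
qed

lemma bl_coordinates:
  "bounded_lipschitz_on bounded_tangents 3 (\<lambda>p. snd (fst p))"
  "bounded_lipschitz_on bounded_tangents 3 (\<lambda>p. fst (snd p))"
  "bounded_lipschitz_on bounded_tangents 3 (\<lambda>p. snd (snd p))"
proof -
  have *: "norm (x::'a) \<le> norm (z::('a \<times> 'a) \<times> 'a \<times> 'a) \<Longrightarrow> norm x \<le> 3 * norm z" for x z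
    using norm_ge_zero[of z] by linarith
  show "bounded_lipschitz_on bounded_tangents 3 (\<lambda>p. snd (fst p))"
    "bounded_lipschitz_on bounded_tangents 3 (\<lambda>p. fst (snd p))"
    "bounded_lipschitz_on bounded_tangents 3 (\<lambda>p. snd (snd p))"
    unfolding bounded_lipschitz_on_def bounded_tangents_def
    using *[OF norm_coordinates(2)] *[OF norm_coordinates(3)] *[OF norm_coordinates(4)]
    by (auto simp flip: fst_diff snd_diff)
qed

lemma bl_base:
  "bounded_lipschitz_on R (B * norm a) (\<lambda>p::('a \<times> 'a) \<times> 'a \<times> 'a. D i (fst (fst p)) a)"
  "bounded_lipschitz_on R (B * norm a * norm b) (\<lambda>p::('a \<times> 'a) \<times> 'a \<times> 'a. D2 i (fst (fst p)) a b)"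
  "bounded_lipschitz_on R (B * norm a * norm b * norm c) (\<lambda>p::('a \<times> 'a) \<times> 'a \<times> 'a. D3 i (fst (fst p)) a b c)"
proof -
  have le: "B * norm (fst (fst p) - fst (fst q)) * y \<le> B * y * norm (p - q)" if "0 \<le> y"
    for p q :: "('a \<times> 'a) \<times> 'a \<times> 'a" and y
    using mult_left_mono[OF norm_coordinates(1)[of "p - q"], of "B * y"] B that
    by (simp add: mult.commute mult.left_commute)
  show "bounded_lipschitz_on R (B * norm a) (\<lambda>p. D i (fst (fst p)) a)"
    using B order_trans[OF lip1 le[of "norm a"]] by (intro bounded_lipschitz_onI bound1) auto
  show "bounded_lipschitz_on R (B * norm a * norm b) (\<lambda>p. D2 i (fst (fst p)) a b)"
    using B order_trans[OF lip2 le[of "norm a * norm b", unfolded mult.assoc[symmetric]]]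
    by (intro bounded_lipschitz_onI bound2) auto
  show "bounded_lipschitz_on R (B * norm a * norm b * norm c) (\<lambda>p. D3 i (fst (fst p)) a b c)"
    using B order_trans[OF lip3 le[of "norm a * norm b * norm c", unfolded mult.assoc[symmetric]]]
    by (intro bounded_lipschitz_onI bound3) auto
qed

lemma linears:
  "linear (D i x)" "linear (D2 i x a)" "linear (\<lambda>a. D2 i x a b)" "linear (D3 i x a b)"
  "linear (\<lambda>b. D3 i x a b c)" "linear (\<lambda>a. D3 i x a b c)"
proof -
  show 1: "linear (D i x)" "linear (D2 i x a)" "linear (\<lambda>a. D2 i x a b)" "linear (D3 i x a b)"
    "linear (\<lambda>b. D3 i x a b c)" for a b c
    by (rule twice_diffD[OF twice_diff] twice_diffD[OF twice_diff_D])+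
  have sym: "D2 i y b a = D2 i y a b" for y a
    by (rule twice_diffD[OF twice_diff])
  have "D3 i x a b c = D3 i x b a c" for a
    using fun_cong[OF has_derivative_unique[OF D3[of i a b x] D3[of i b a x, unfolded sym]]] .
  then show "linear (\<lambda>a. D3 i x a b c)"
    using 1(5)[of b c] by simp
qed

text \<open>These are the kinds of summand that occur in \<open>T2'\<close>. Inserting a tangent
  component, bounded by 3, into a derivative costs \<open>2 * 3\<close> by the product rule: 6 for
  one insertion and 36 for two.\<close>

lemma bl_terms:
  fixes i :: 'd
  defines "R \<equiv> bounded_tangents"
  assumes u: "norm u \<le> n"
  shows "bounded_lipschitz_on R (B * n) (\<lambda>p. D i (fst (fst p)) u)"
    "bounded_lipschitz_on R (6 * B * n) (\<lambda>p. D2 i (fst (fst p)) (snd (fst p)) u)"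
    "bounded_lipschitz_on R (6 * B * n) (\<lambda>p. D2 i (fst (fst p)) (fst (snd p)) u)"
    "bounded_lipschitz_on R (6 * B * n) (\<lambda>p. D2 i (fst (fst p)) (snd (snd p)) u)"
    "bounded_lipschitz_on R (36 * B * n) (\<lambda>p. D3 i (fst (fst p)) (snd (fst p)) (fst (snd p)) u)"
proof -
  have n: "0 \<le> n"
    using u norm_ge_zero order_trans by blast
  have Bn: "B * norm u \<le> B * n"
    using u B by (rule mult_left_mono)
  have d2: "bounded_lipschitz_on R (6 * B * n) (\<lambda>p. D2 i (fst (fst p)) (f p) u)"
    if "bounded_lipschitz_on R 3 f" for f
  proof (rule bounded_lipschitz_on_mono)
    show "bounded_lipschitz_on R (2 * (B * norm u) * 3) (\<lambda>p. D2 i (fst (fst p)) (f p) u)"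
      using bl_base(2)[of R _ u i] B
      by (intro bounded_lipschitz_on_apply[OF _ _ linears(3) that]) (auto simp: ac_simps)
    show "2 * (B * norm u) * 3 \<le> 6 * B * n"
      using Bn by simp
  qed
  show "bounded_lipschitz_on R (B * n) (\<lambda>p. D i (fst (fst p)) u)"
    by (rule bounded_lipschitz_on_mono[OF bl_base(1) Bn])
  show "bounded_lipschitz_on R (6 * B * n) (\<lambda>p. D2 i (fst (fst p)) (snd (fst p)) u)"
    "bounded_lipschitz_on R (6 * B * n) (\<lambda>p. D2 i (fst (fst p)) (fst (snd p)) u)"
    "bounded_lipschitz_on R (6 * B * n) (\<lambda>p. D2 i (fst (fst p)) (snd (snd p)) u)"
    unfolding R_def by (intro d2[unfolded R_def] bl_coordinates)+
  have d3: "bounded_lipschitz_on R (6 * B * norm u * norm b) (\<lambda>p. D3 i (fst (fst p)) (snd (fst p)) b u)" for b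
  proof (rule bounded_lipschitz_on_mono)
    show "bounded_lipschitz_on R (2 * (B * norm b * norm u) * 3) (\<lambda>p. D3 i (fst (fst p)) (snd (fst p)) b u)"
      using bl_base(3)[of R _ b u i] B unfolding R_def
      by (intro bounded_lipschitz_on_apply[OF _ _ linears(6) bl_coordinates(1)]) (auto simp: ac_simps)
  qed (simp add: ac_simps)
  show "bounded_lipschitz_on R (36 * B * n) (\<lambda>p. D3 i (fst (fst p)) (snd (fst p)) (fst (snd p)) u)"
  proof (rule bounded_lipschitz_on_mono)
    show "bounded_lipschitz_on R (2 * (6 * B * norm u) * 3) (\<lambda>p. D3 i (fst (fst p)) (snd (fst p)) (fst (snd p)) u)"
      using d3 B unfolding R_def
      by (intro bounded_lipschitz_on_apply[OF _ _ linears(5) bl_coordinates(2)]) auto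
    show "2 * (6 * B * norm u) * 3 \<le> 36 * B * n"
      using Bn by simp
  qed
qed

text \<open>The summands of \<open>T2'\<close> add up to \<open>70 * B\<close> and those of
  \<open>T2\<close> to \<open>19 * B\<close>; the constant 100 is a round number above both.\<close>

theorem regular_on_second_tangent: "regular_on bounded_tangents (100 * B) T2 T2'"
  unfolding regular_on_def
proof (intro conjI allI ballI)
  fix i and p :: "('a \<times> 'a) \<times> 'a \<times> 'a" and q :: "('a \<times> 'a) \<times> 'a \<times> 'a"
  define n where "n = norm q"
  have q: "norm (fst (fst q)) \<le> n" "norm (snd (fst q)) \<le> n" "norm (fst (snd q)) \<le> n" "norm (snd (snd q)) \<le> n"
    unfolding n_def by (rule norm_coordinates)+
  have "bounded_lipschitz_on bounded_tangents
    (B * n + (B * n + 6 * B * n) + ((B * n + (B * n + 6 * B * n)) + (6 * B * n + (6 * B * n + (6 * B * n + 36 * B * n)))))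
    (\<lambda>p. T2' i p q)"
  proof -
    \<comment> \<open>Written out, with symmetry of \<open>D2\<close> used to put the moving
      component before the fixed direction, the order in which \<open>bl_terms\<close> is
      stated.\<close>
    have "T2' i p q =
      ((D i (fst (fst p)) (fst (fst q)), D i (fst (fst p)) (snd (fst q)) + D2 i (fst (fst p)) (snd (fst p)) (fst (fst q))),
       (D i (fst (fst p)) (fst (snd q)), D i (fst (fst p)) (snd (snd q)) + D2 i (fst (fst p)) (snd (fst p)) (fst (snd q)))
       + (D2 i (fst (fst p)) (fst (snd p)) (fst (fst q)),
          D2 i (fst (fst p)) (snd (snd p)) (fst (fst q)) + (D2 i (fst (fst p)) (fst (snd p)) (snd (fst q))
            + D3 i (fst (fst p)) (snd (fst p)) (fst (snd p)) (fst (fst q)))))" for p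
      using twice_diffD(3)[OF twice_diff, of i "fst (fst p)" "snd (fst q)" "fst (snd p)"]
      unfolding tangent_deriv_def tangent_deriv2_def by (simp only: fst_conv snd_conv)
    then show ?thesis
      using bounded_lipschitz_on_Pair[OF
          bounded_lipschitz_on_Pair[OF bl_terms(1)[OF q(1), of i] bounded_lipschitz_on_add[OF bl_terms(1)[OF q(2), of i] bl_terms(2)[OF q(1), of i]]]
          bounded_lipschitz_on_add[OF
            bounded_lipschitz_on_Pair[OF bl_terms(1)[OF q(3), of i] bounded_lipschitz_on_add[OF bl_terms(1)[OF q(4), of i] bl_terms(2)[OF q(3), of i]]]
            bounded_lipschitz_on_Pair[OF bl_terms(3)[OF q(1), of i]
              bounded_lipschitz_on_add[OF bl_terms(4)[OF q(1), of i]
                bounded_lipschitz_on_add[OF bl_terms(3)[OF q(2), of i] bl_terms(5)[OF q(1), of i]]]]]]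
      by (simp only:)
  qed
  then have bl: "bounded_lipschitz_on bounded_tangents (100 * B * n) (\<lambda>p. T2' i p q)"
    by (rule bounded_lipschitz_on_mono) (use B q in \<open>auto simp: n_def\<close>)
  assume p: "p \<in> bounded_tangents"
  show "norm (T2' i p q) \<le> 100 * B * norm q"
    using bl p unfolding bounded_lipschitz_on_def n_def by blast
  show "norm (T2' i p q - T2' i z q) \<le> 100 * B * norm (p - z) * norm q" if "z \<in> bounded_tangents" for z
    using bl p that unfolding bounded_lipschitz_on_def n_def by (auto simp: ac_simps)
  show "(T2 i has_derivative T2' i p) (at p)"
    by (rule has_derivative_tangent[OF twice_diff_tangent'])
  have le: "norm (x, y) \<le> norm x + norm y" for x y :: "'b::real_normed_vector"
    by (simp add: norm_Pair sqrt_sum_squares_le_sum)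
  have d: "norm (D i x u) \<le> B * 3" if "norm u \<le> 3" for x u
    using that B by (intro order_trans[OF bound1] mult_left_mono)
  have d2: "norm (D2 i x a u) \<le> B * 3 * 3" if "norm a \<le> 3" "norm u \<le> 3" for x a u
    using that B by (intro order_trans[OF bound2] mult_mono) auto
  have "norm (T2 i p) \<le> (B + B * 3) + (B * 3 + (B * 3 + B * 3 * 3))"
    using p unfolding tangent_def tangent_deriv_def bounded_tangents_def fst_conv snd_conv
    by (intro order_trans[OF le] add_mono norm_triangle_mono bound0 d d2) auto
  then show "norm (T2 i p) \<le> 100 * B"
    using B by simp
qed

end

section \<open>Uniform bounds on the derivatives of the Euler scheme\<close>

lemma frechet_derivative_bounded_linear:
  assumes "bounded_linear L" "f differentiable (at x)"
  shows "frechet_derivative (\<lambda>x. L (f x)) (at x) v = L (frechet_derivative f (at x) v)"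
    and "(\<lambda>x. L (f x)) differentiable (at x)"
proof -
  have f': "((\<lambda>x. L (f x)) has_derivative (\<lambda>v. L (frechet_derivative f (at x) v))) (at x)"
    using bounded_linear.has_derivative[OF assms(1)] assms(2) frechet_derivative_works by blast
  show "frechet_derivative (\<lambda>x. L (f x)) (at x) v = L (frechet_derivative f (at x) v)"
    by (rule fun_cong[OF frechet_derivative_at[OF f'], symmetric])
  show "(\<lambda>x. L (f x)) differentiable (at x)"
    using f' by (rule differentiableI)
qed

text \<open>Applied to evaluation at a unit vector, this passes from the operator-valued
  \<open>\<sigma>\<close> to its columns, the driving vector fields.\<close>

lemma Cb_bounded_linear:
  assumes "bounded_linear L"
  shows "Cb k f \<Longrightarrow> Cb k (\<lambda>x. L (f x))"
proof (induction k arbitrary: f)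
  case (0 f)
  then show ?case
    using assms bounded_linear_image[of "range f" L]
    by (auto simp: image_image intro: bounded_linear.continuous_on)
next
  case (Suc k f)
  have diff: "f differentiable (at x)" for x
    using Suc.prems by simp
  show ?case
    using Suc assms bounded_linear_image[of "range f" L]
    by (simp add: frechet_derivative_bounded_linear[OF assms diff] bounded_linear.continuous_on image_image)
qed

lemma Cb_bounded:
  assumes "Cb k f"
  obtains M where "\<And>x. norm (f x) \<le> M"
proof -
  have "bounded (range f)"
    using assms by (cases k) auto
  then show ?thesis
    using that by (auto simp: bounded_iff)
qed

lemma Cb_SucD:
  assumes "Cb (Suc k) f"
  shows "(f has_derivative frechet_derivative f (at x)) (at x)" "Cb k (\<lambda>x. frechet_derivative f (at x) a)"
  using assms frechet_derivative_works by auto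

text \<open>\<open>Cb\<close> bounds derivatives one fixed direction at a time; a basis expansion
  makes the bound uniform in the direction. The weight \<open>w\<close> allows iteration: for
  multilinear maps the other arguments are stored in \<open>p\<close> and their norms in
  \<open>w p\<close>.\<close>

lemma linear_bound:
  fixes g :: "'p \<Rightarrow> 'a::euclidean_space \<Rightarrow> 'b::real_normed_vector"
  assumes lin: "\<And>p. linear (g p)" and w: "\<And>p. 0 \<le> w p"
    and bd: "\<And>b. \<exists>M. \<forall>p. norm (g p b) \<le> M * w p"
  shows "\<exists>M\<ge>0. \<forall>p b. norm (g p b) \<le> M * norm b * w p"
proof -
  obtain M where M: "\<And>b p. norm (g p b) \<le> M b * w p"
    using bd by metis
  have "norm (g p u) \<le> (\<Sum>b\<in>Basis. \<bar>M b\<bar>) * norm u * w p" for p u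
  proof -
    have "norm (g p u) \<le> (\<Sum>b\<in>Basis. norm ((u \<bullet> b) *\<^sub>R g p b))"
      unfolding linear_basis_expansion[OF lin, of _ u] by (rule norm_sum)
    also have "\<dots> \<le> (\<Sum>b\<in>Basis. norm u * (\<bar>M b\<bar> * w p))"
    proof (rule sum_mono)
      fix b :: 'a
      assume "b \<in> Basis"
      then have "\<bar>u \<bullet> b\<bar> \<le> norm u"
        by (rule Basis_le_norm)
      moreover have "norm (g p b) \<le> \<bar>M b\<bar> * w p"
        by (rule order_trans[OF M]) (auto intro: mult_right_mono w)
      ultimately show "norm ((u \<bullet> b) *\<^sub>R g p b) \<le> norm u * (\<bar>M b\<bar> * w p)"
        by (simp add: mult_mono)
    qed
    finally show ?thesis
      by (simp add: sum_distrib_left sum_distrib_right ac_simps)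
  qed
  then show ?thesis
    by (intro exI[of _ "\<Sum>b\<in>Basis. \<bar>M b\<bar>"]) (auto intro: sum_nonneg)
qed

lemma linear_bound1:
  fixes g :: "'p \<Rightarrow> 'a::euclidean_space \<Rightarrow> 'b::real_normed_vector"
  assumes "\<And>p. linear (g p)" "\<And>a. \<exists>M. \<forall>p. norm (g p a) \<le> M"
  shows "\<exists>M\<ge>0. \<forall>p a. norm (g p a) \<le> M * norm a"
  using linear_bound[of g "\<lambda>_. 1"] assms by simp

lemma linear_bound2:
  fixes g :: "'p \<Rightarrow> 'a::euclidean_space \<Rightarrow> 'a \<Rightarrow> 'b::real_normed_vector"
  assumes lin: "\<And>p b. linear (\<lambda>a. g p a b)" "\<And>p a. linear (g p a)"
    and bd: "\<And>a b. \<exists>M. \<forall>p. norm (g p a b) \<le> M"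
  shows "\<exists>M\<ge>0. \<forall>p a b. norm (g p a b) \<le> M * norm a * norm b"
proof -
  have "\<exists>M. \<forall>q. norm (g (fst q) a (snd q)) \<le> M * norm (snd q)" for a
    using linear_bound1[of "\<lambda>p. g p a", OF lin(2) bd] by auto
  from linear_bound[of "\<lambda>q a. g (fst q) a (snd q)", OF lin(1) norm_ge_zero this]
  obtain M where "0 \<le> M" and M: "\<forall>q a. norm (g (fst q) a (snd q)) \<le> M * norm a * norm (snd q)"
    by blast
  moreover have "norm (g p a b) \<le> M * norm a * norm b" for p a b
    using M[rule_format, of "(p, b)" a] by simp
  ultimately show ?thesis
    by blast
qed

lemma linear_bound3:
  fixes g :: "'p \<Rightarrow> 'a::euclidean_space \<Rightarrow> 'a \<Rightarrow> 'a \<Rightarrow> 'b::real_normed_vector"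
  assumes lin: "\<And>p b c. linear (\<lambda>a. g p a b c)" "\<And>p a c. linear (\<lambda>b. g p a b c)"
      "\<And>p a b. linear (g p a b)"
    and bd: "\<And>a b c. \<exists>M. \<forall>p. norm (g p a b c) \<le> M"
  shows "\<exists>M\<ge>0. \<forall>p a b c. norm (g p a b c) \<le> M * norm a * norm b * norm c"
proof -
  have "\<exists>M. \<forall>q. norm (g (fst q) a (fst (snd q)) (snd (snd q)))
    \<le> M * (norm (fst (snd q)) * norm (snd (snd q)))" for a
    using linear_bound2[of "\<lambda>p. g p a", OF lin(2,3) bd] unfolding mult.assoc by auto
  from linear_bound[of "\<lambda>q a. g (fst q) a (fst (snd q)) (snd (snd q))", OF lin(1) _ this]
  obtain M where "0 \<le> M" and M: "\<forall>q a. norm (g (fst q) a (fst (snd q)) (snd (snd q)))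
    \<le> M * norm a * (norm (fst (snd q)) * norm (snd (snd q)))"
    by auto
  moreover have "norm (g p a b c) \<le> M * norm a * norm b * norm c" for p a b c
    using M[rule_format, of "(p, b, c)" a] by (simp add: mult.assoc)
  ultimately show ?thesis
    by blast
qed

lemma linear_bound4:
  fixes g :: "'p \<Rightarrow> 'a::euclidean_space \<Rightarrow> 'a \<Rightarrow> 'a \<Rightarrow> 'a \<Rightarrow> 'b::real_normed_vector"
  assumes lin: "\<And>p b c d. linear (\<lambda>a. g p a b c d)" "\<And>p a c d. linear (\<lambda>b. g p a b c d)"
      "\<And>p a b d. linear (\<lambda>c. g p a b c d)" "\<And>p a b c. linear (g p a b c)"
    and bd: "\<And>a b c d. \<exists>M. \<forall>p. norm (g p a b c d) \<le> M"
  shows "\<exists>M\<ge>0. \<forall>p a b c d. norm (g p a b c d) \<le> M * norm a * norm b * norm c * norm d"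
proof -
  have "\<exists>M. \<forall>q. norm (g (fst q) a (fst (snd q)) (fst (snd (snd q))) (snd (snd (snd q))))
    \<le> M * (norm (fst (snd q)) * norm (fst (snd (snd q))) * norm (snd (snd (snd q))))" for a
    using linear_bound3[of "\<lambda>p. g p a", OF lin(2-4) bd] unfolding mult.assoc by auto
  from linear_bound[of "\<lambda>q a. g (fst q) a (fst (snd q)) (fst (snd (snd q))) (snd (snd (snd q)))", OF lin(1) _ this]
  obtain M where "0 \<le> M" and M: "\<forall>q a. norm (g (fst q) a (fst (snd q)) (fst (snd (snd q))) (snd (snd (snd q))))
    \<le> M * norm a * (norm (fst (snd q)) * norm (fst (snd (snd q))) * norm (snd (snd (snd q))))"
    by auto
  moreover have "norm (g p a b c d) \<le> M * norm a * norm b * norm c * norm d" for p a b c d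
    using M[rule_format, of "(p, b, c, d)" a] by (simp add: mult.assoc)
  ultimately show ?thesis
    by blast
qed

text \<open>Since iterated derivatives are taken for fixed directions, their linearity in those
  directions has to be recovered; it follows from uniqueness of the derivative.\<close>

lemma linear_derivative_in_parameter:
  fixes F :: "'a::real_normed_vector \<Rightarrow> 'c::real_normed_vector \<Rightarrow> 'b::real_normed_vector"
  assumes lin: "\<And>x. linear (F x)" and F': "\<And>x u. ((\<lambda>x. F x u) has_derivative F' x u) (at x)"
  shows "linear (\<lambda>u. F' x u h)"
proof (rule linearI)
  fix u w :: 'c and r :: real
  have "((\<lambda>x. F x (u + w)) has_derivative (\<lambda>h. F' x u h + F' x w h)) (at x)"
    unfolding linear_add[OF lin] by (intro has_derivative_add F')
  from fun_cong[OF has_derivative_unique[OF F' this]] show "F' x (u + w) h = F' x u h + F' x w h" .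
  have "((\<lambda>x. F x (r *\<^sub>R u)) has_derivative (\<lambda>h. r *\<^sub>R F' x u h)) (at x)"
    unfolding linear_scale[OF lin] by (intro has_derivative_scaleR_right F')
  from fun_cong[OF has_derivative_unique[OF F' this]] show "F' x (r *\<^sub>R u) h = r *\<^sub>R F' x u h" .
qed

lemma lipschitz_of_bounded_derivative:
  fixes f :: "'a::real_normed_vector \<Rightarrow> 'b::real_normed_vector"
  assumes "\<And>x. (f has_derivative f' x) (at x)" "\<And>x h. norm (f' x h) \<le> M * norm h" "0 \<le> M"
  shows "norm (f x - f y) \<le> M * norm (x - y)"
  by (rule differentiable_bound[of UNIV f f']) (use assms in \<open>auto intro: onorm_bound\<close>)

lemma Cb_smooth_fields:
  fixes v :: "'d::finite \<Rightarrow> 'a::euclidean_space \<Rightarrow> 'a"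
  assumes Cb: "\<And>i. Cb 4 (v i)"
  shows "\<exists>D D2 D3 B. smooth_fields v D D2 D3 B"
proof -
  define D where "D i x = frechet_derivative (v i) (at x)" for i x
  define D2 where "D2 i x a = frechet_derivative (\<lambda>x. D i x a) (at x)" for i x a
  define D3 where "D3 i x a b = frechet_derivative (\<lambda>x. D2 i x a b) (at x)" for i x a b
  define D4 where "D4 i x a b c = frechet_derivative (\<lambda>x. D3 i x a b c) (at x)" for i x a b c
  have Cb4: "Cb (Suc (Suc (Suc (Suc 0)))) (v i)" for i
    using Cb[of i] by (simp add: eval_nat_numeral)
  note c1 = Cb_SucD(2)[OF Cb4, folded D_def]
  note c2 = Cb_SucD(2)[OF c1, folded D2_def]
  note c3 = Cb_SucD(2)[OF c2, folded D3_def]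
  note c4 = Cb_SucD(2)[OF c3, folded D4_def]
  note d1 = Cb_SucD(1)[OF Cb4, folded D_def]
  note d2 = Cb_SucD(1)[OF c1, folded D2_def]
  note d3 = Cb_SucD(1)[OF c2, folded D3_def]
  note d4 = Cb_SucD(1)[OF c3, folded D4_def]
  have l1: "linear (D i x)" for i x
    by (rule has_derivative_linear[OF d1])
  have l2: "linear (D2 i x a)" "linear (\<lambda>a. D2 i x a b)" for i x a b
    by (rule has_derivative_linear[OF d2] linear_derivative_in_parameter[OF l1 d2])+
  have l3: "linear (D3 i x a b)" "linear (\<lambda>b. D3 i x a b c)" "linear (\<lambda>a. D3 i x a b c)" for i x a b c
    by (rule has_derivative_linear[OF d3] linear_derivative_in_parameter[OF l2(1) d3]
        linear_derivative_in_parameter[OF l2(2) d3])+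
  have l4: "linear (D4 i x a b c)" "linear (\<lambda>c. D4 i x a b c d)" "linear (\<lambda>b. D4 i x a b c d)"
    "linear (\<lambda>a. D4 i x a b c d)" for i x a b c d
    by (rule has_derivative_linear[OF d4] linear_derivative_in_parameter[OF l3(1) d4]
        linear_derivative_in_parameter[OF l3(2) d4] linear_derivative_in_parameter[OF l3(3) d4])+
  have unif: "\<exists>M. \<forall>p. norm (F (fst p) (snd p)) \<le> M" if "\<And>i. Cb k (F i)" for F :: "'d \<Rightarrow> 'a \<Rightarrow> 'a" and k
  proof -
    have "\<exists>M. \<forall>x. norm (F i x) \<le> M" for i
      using Cb_bounded[OF that[of i]] by metis
    then obtain M where M: "\<And>i x. norm (F i x) \<le> M i"
      by metis
    have "norm (F (fst p) (snd p)) \<le> Max (range M)" for p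
      using M by (rule order_trans) auto
    then show ?thesis
      by blast
  qed
  obtain M0 where M0: "\<forall>p. norm (v (fst p) (snd p)) \<le> M0"
    using unif[of _ v, OF Cb] by blast
  obtain M1 where M1: "0 \<le> M1" "\<forall>p a. norm (D (fst p) (snd p) a) \<le> M1 * norm a"
    using linear_bound1[of "\<lambda>p. D (fst p) (snd p)", OF l1 unif[of _ "\<lambda>i x. D i x _", OF c1]] by blast
  obtain M2 where M2: "0 \<le> M2" "\<forall>p a b. norm (D2 (fst p) (snd p) a b) \<le> M2 * norm a * norm b"
    using linear_bound2[of "\<lambda>p. D2 (fst p) (snd p)", OF l2(2,1) unif[of _ "\<lambda>i x. D2 i x _ _", OF c2]] by blast
  obtain M3 where M3: "0 \<le> M3" "\<forall>p a b c. norm (D3 (fst p) (snd p) a b c) \<le> M3 * norm a * norm b * norm c"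
    using linear_bound3[of "\<lambda>p. D3 (fst p) (snd p)", OF l3(3,2,1) unif[of _ "\<lambda>i x. D3 i x _ _ _", OF c3]] by blast
  obtain M4 where M4: "0 \<le> M4" "\<forall>p a b c d. norm (D4 (fst p) (snd p) a b c d) \<le> M4 * norm a * norm b * norm c * norm d"
    using linear_bound4[of "\<lambda>p. D4 (fst p) (snd p)", OF l4(4,3,2,1) unif[of _ "\<lambda>i x. D4 i x _ _ _ _", OF c4]] by blast
  define B where "B = \<bar>M0\<bar> + M1 + M2 + M3 + M4"
  have B: "0 \<le> B" "M0 \<le> B" "M1 \<le> B" "M2 \<le> B" "M3 \<le> B" "M4 \<le> B"
    using M1 M2 M3 M4 by (auto simp: B_def)
  have b1: "norm (D i x a) \<le> B * norm a" for i x a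
    by (rule order_trans[OF M1(2)[rule_format, of "(i, x)", unfolded fst_conv snd_conv]])
      (intro mult_right_mono B norm_ge_zero)
  have b2: "norm (D2 i x a b) \<le> B * norm a * norm b" for i x a b
    by (rule order_trans[OF M2(2)[rule_format, of "(i, x)", unfolded fst_conv snd_conv]])
      (intro mult_right_mono B norm_ge_zero)
  have b3: "norm (D3 i x a b c) \<le> B * norm a * norm b * norm c" for i x a b c
    by (rule order_trans[OF M3(2)[rule_format, of "(i, x)", unfolded fst_conv snd_conv]])
      (intro mult_right_mono B norm_ge_zero)
  have b4: "norm (D4 i x a b c d) \<le> B * norm a * norm b * norm c * norm d" for i x a b c d
    by (rule order_trans[OF M4(2)[rule_format, of "(i, x)", unfolded fst_conv snd_conv]])
      (intro mult_right_mono B norm_ge_zero)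
  have "smooth_fields v D D2 D3 B"
  proof
    show "norm (v i x) \<le> B" for i x
      using M0[rule_format, of "(i, x)"] B by auto
    show "norm (D i x a - D i y a) \<le> B * norm (x - y) * norm a" for i x y a
    proof -
      have "norm (D i x a - D i y a) \<le> B * norm a * norm (x - y)"
        by (rule lipschitz_of_bounded_derivative[OF d2 b2]) (use B in simp)
      then show ?thesis
        by (simp add: ac_simps)
    qed
    show "norm (D2 i x a b - D2 i y a b) \<le> B * norm (x - y) * norm a * norm b" for i x y a b
    proof -
      have "norm (D2 i x a b - D2 i y a b) \<le> B * norm a * norm b * norm (x - y)"
        by (rule lipschitz_of_bounded_derivative[OF d3 b3]) (use B in simp)
      then show ?thesis
        by (simp add: ac_simps)
    qed
    show "norm (D3 i x a b c - D3 i y a b c) \<le> B * norm (x - y) * norm a * norm b * norm c" for i x y a b c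
    proof -
      have "norm (D3 i x a b c - D3 i y a b c) \<le> B * norm a * norm b * norm c * norm (x - y)"
        by (rule lipschitz_of_bounded_derivative[OF d4 b4]) (use B in simp)
      then show ?thesis
        by (simp add: ac_simps)
    qed
  qed (rule B d1 d2 d3 b1 b2 b3)+
  then show ?thesis
    by blast
qed

section \<open>Mesh-independent estimates for the scheme and its derivatives\<close>

locale rough_flow = rough_path T \<beta> K X XX + smooth_fields v D D2 D3 B
  for T \<beta> K :: real and X :: "real \<Rightarrow> real^'d::finite" and XX :: "real \<Rightarrow> real \<Rightarrow> real^'d^'d"
    and v :: "'d \<Rightarrow> 'a::euclidean_space \<Rightarrow> 'a" and D D2 D3 and B :: real
begin

lemma regular_on_UNIV: "regular_on UNIV B v D"
  unfolding regular_on_def using D bound0 bound1 lip1 by blast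

text \<open>The a priori estimate concerns tangent components of norm at most 1; linearity extends
  it to all of them.\<close>

lemma linear_bound_scale:
  fixes f :: "'b::real_normed_vector \<Rightarrow> 'c::real_normed_vector"
  assumes "linear f" "\<And>a. norm a \<le> 1 \<Longrightarrow> norm (f a) \<le> m"
  shows "norm (f a) \<le> m * norm a"
proof (cases "a = 0")
  case False
  then have "norm (f (a /\<^sub>R norm a)) \<le> m"
    by (intro assms) simp
  then show ?thesis
    using False by (simp add: linear_scale[OF assms(1)] field_simps)
qed (use linear_0[OF assms(1)] in simp)

text \<open>All three estimates are components of one estimate for the twice iterated tangent scheme
  started at \<open>((x, a), (b, 0))\<close>. Its components are the scheme, its derivative along
  \<open>a\<close>, its derivative along \<open>b\<close>, and, thanks to the initial 0, the pure
  second derivative along \<open>a\<close> and \<open>b\<close>.\<close>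

theorem discrete_flow:
  obtains h C where "0 < h" "h \<le> 1" "1 \<le> C" "C * h powr \<beta> \<le> 1/2"
    "\<And>\<Delta> j l x. 0 \<le> \<Delta> \<Longrightarrow> real (j + l) * \<Delta> \<le> T \<Longrightarrow> real l * \<Delta> \<le> h \<Longrightarrow>
       norm (euler v D \<Delta> j l x - x - Inc v D (real j * \<Delta>) (real (j + l) * \<Delta>) x) \<le> C * (real l * \<Delta>) powr (3 * \<beta>)"
    "\<And>\<Delta> j l x. 0 \<le> \<Delta> \<Longrightarrow> real (j + l) * \<Delta> \<le> T \<Longrightarrow> real l * \<Delta> \<le> h \<Longrightarrow>
       norm (euler v D \<Delta> j l x - x) \<le> C * (real l * \<Delta>) powr \<beta>"
    "\<And>\<Delta> j l. 0 \<le> \<Delta> \<Longrightarrow> real (j + l) * \<Delta> \<le> T \<Longrightarrow> real l * \<Delta> \<le> h \<Longrightarrow>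
       \<exists>E'. (\<forall>x. (euler v D \<Delta> j l has_derivative E' x) (at x)) \<and>
         (\<forall>x a. norm (E' x a - a) \<le> C * (real l * \<Delta>) powr \<beta> * norm a) \<and>
         (\<forall>x u. norm (euler v D \<Delta> j l (x + u) - euler v D \<Delta> j l x - E' x u) \<le> C * norm u ^ 2)"
proof -
  define M where "M = 100 * B"
  have M: "0 \<le> M"
    using B by (simp add: M_def)
  obtain h0 c where h0: "0 < h0" "h0 \<le> 1" and c: "0 \<le> c"
    and est: "\<And>(S::(('a \<times> 'a) \<times> 'a \<times> 'a) set) v D y0 \<Delta> j m k l.
      convex S \<Longrightarrow> regular_on S M v D \<Longrightarrow> cball y0 2 \<subseteq> S \<Longrightarrow> 0 \<le> \<Delta> \<Longrightarrow>
      real (j + m) * \<Delta> \<le> T \<Longrightarrow> real m * \<Delta> \<le> h0 \<Longrightarrow> k \<le> l \<Longrightarrow> l \<le> m \<Longrightarrow>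
      norm (euler v D \<Delta> j l y0 - euler v D \<Delta> j k y0 -
        Inc v D (real (j + k) * \<Delta>) (real (j + l) * \<Delta>) (euler v D \<Delta> j k y0))
        \<le> c * (real (l - k) * \<Delta>) powr (3 * \<beta>) \<and> euler v D \<Delta> j l y0 \<in> cball y0 1"
  proof (rule euler_estimate[OF M, where 'a = "('a \<times> 'a) \<times> 'a \<times> 'a"], goal_cases)
    case (1 h c)
    show ?case
      by (rule that[OF 1(2-5)])
  qed
  define C where "C = 1 + c + inc_const M"
  have C: "1 \<le> C" "c \<le> C"
    using c inc_const_nonneg[OF M] by (auto simp: C_def)
  define h where "h = min h0 ((1 / (2 * C)) powr (1 / \<beta>))"
  have h: "0 < h" "h \<le> 1" "h \<le> h0"
    using h0 C by (auto simp: h_def)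
  have "h powr \<beta> \<le> ((1 / (2 * C)) powr (1 / \<beta>)) powr \<beta>"
    using \<beta> h by (intro powr_mono2) (auto simp: h_def)
  also have "\<dots> = 1 / (2 * C)"
    using \<beta> C by (simp add: powr_powr)
  finally have Ch: "C * h powr \<beta> \<le> 1/2"
    using C by (simp add: field_simps)
  note td1 = twice_diff and td2 = twice_diff_tangent'
  let ?e = "\<lambda>\<Delta> j l x a b. euler T2 T2' \<Delta> j l ((x, a), (b, 0))"
  have main: "norm (?e \<Delta> j l x a b - ((x, a), (b, 0)) - Inc T2 T2' (real j * \<Delta>) (real (j + l) * \<Delta>) ((x, a), (b, 0)))
        \<le> c * (real l * \<Delta>) powr (3 * \<beta>)" (is ?A)
      "norm (?e \<Delta> j l x a b - ((x, a), (b, 0))) \<le> C * (real l * \<Delta>) powr \<beta>" (is ?B)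
      "norm (?e \<Delta> j l x a b - ((x, a), (b, 0))) \<le> 1" (is ?C)
    if \<Delta>: "0 \<le> \<Delta>" "real (j + l) * \<Delta> \<le> T" "real l * \<Delta> \<le> h" and ab: "norm a \<le> 1" "norm b \<le> 1"
    for \<Delta> j l x a b
  proof -
    let ?y = "((x, a), (b, 0::'a))"
    have sub: "cball ?y 2 \<subseteq> bounded_tangents"
    proof
      fix p
      assume "p \<in> cball ?y 2"
      then have "norm (p - ?y) \<le> 2"
        by (simp add: dist_norm norm_minus_commute)
      then have "norm (snd (fst p) - a) \<le> 2" "norm (fst (snd p) - b) \<le> 2" "norm (snd (snd p)) \<le> 2"
        using norm_coordinates[of "p - ?y"] by auto
      then show "p \<in> bounded_tangents"
        using ab norm_triangle_sub[of "snd (fst p)" a] norm_triangle_sub[of "fst (snd p)" b]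
        by (auto simp: bounded_tangents_def)
    qed
    have *: "?A \<and> ?e \<Delta> j l x a b \<in> cball ?y 1"
      using est[OF convex_bounded_tangents regular_on_second_tangent[folded M_def] sub \<Delta>(1,2), of 0 l] \<Delta> h by simp
    then show ?A ?C
      by (auto simp: dist_norm norm_minus_commute)
    have "norm (?e \<Delta> j l x a b - ?y) \<le> c * (real l * \<Delta>) powr (3 * \<beta>) + inc_const M * (real l * \<Delta>) powr \<beta>"
    proof -
      have "norm (Inc T2 T2' (real j * \<Delta>) (real (j + l) * \<Delta>) ?y) \<le> inc_const M * (real (j + l) * \<Delta> - real j * \<Delta>) powr \<beta>"
        using sub \<Delta> h by (intro Inc_bound[OF convex_bounded_tangents regular_on_second_tangent[folded M_def]])
          (auto simp: mult_right_mono algebra_simps)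
      moreover have "real (j + l) * \<Delta> - real j * \<Delta> = real l * \<Delta>"
        by (simp add: algebra_simps)
      ultimately show ?thesis
        using * norm_triangle_sub[of "?e \<Delta> j l x a b - ?y" "Inc T2 T2' (real j * \<Delta>) (real (j + l) * \<Delta>) ?y"] by auto
    qed
    also have "c * (real l * \<Delta>) powr (3 * \<beta>) \<le> c * (real l * \<Delta>) powr \<beta>"
      using \<Delta> h \<beta> c by (intro mult_left_mono powr_mono') auto
    also have "c * (real l * \<Delta>) powr \<beta> + inc_const M * (real l * \<Delta>) powr \<beta> \<le> C * (real l * \<Delta>) powr \<beta>"
      unfolding C_def by (simp add: algebra_simps)
    finally show ?B
      by simp
  qed
  define E' where "E' \<Delta> j l x a = snd (euler T1 T1' \<Delta> j l (x, a))" for \<Delta> j l x a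
  define E'' where "E'' \<Delta> j l x a b = snd (snd (?e \<Delta> j l x a b))" for \<Delta> j l x a b
  have fst_e: "fst (?e \<Delta> j l x a b) = (euler v D \<Delta> j l x, E' \<Delta> j l x a)" for \<Delta> j l x a b
    using euler_tangent(1)[OF td2, of \<Delta> j l "((x, a), (b, 0))"] euler_tangent(1)[OF td1, of \<Delta> j l "(x, a)"]
    by (simp add: E'_def prod_eq_iff)
  have E': "(euler v D \<Delta> j l has_derivative E' \<Delta> j l x) (at x)" for \<Delta> j l x
    using euler_tangent(2)[OF td1, of \<Delta> j l x] unfolding E'_def[abs_def] .
  then have lin: "linear (E' \<Delta> j l x)" for \<Delta> j l x
    by (rule has_derivative_linear)
  have E'': "((\<lambda>x. E' \<Delta> j l x a) has_derivative E'' \<Delta> j l x a) (at x)" for \<Delta> j l x a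
  proof -
    have "((\<lambda>x. euler T1 T1' \<Delta> j l (x, a)) has_derivative (\<lambda>b. snd (?e \<Delta> j l x a b))) (at x)"
      by (rule has_derivative_compose[OF _ euler_tangent(2)[OF td2]]) (auto intro!: derivative_eq_intros)
    then show ?thesis
      unfolding E'_def E''_def by (rule has_derivative_snd)
  qed
  show ?thesis
  proof (rule that[OF h(1,2) C(1) Ch])
    fix \<Delta> :: real and j l :: nat
    assume \<Delta>: "0 \<le> \<Delta>" "real (j + l) * \<Delta> \<le> T" "real l * \<Delta> \<le> h"
    note m = main[OF \<Delta>]
    show "norm (euler v D \<Delta> j l x - x - Inc v D (real j * \<Delta>) (real (j + l) * \<Delta>) x) \<le> C * (real l * \<Delta>) powr (3 * \<beta>)" for x
    proof -
      have "norm (euler v D \<Delta> j l x - x - Inc v D (real j * \<Delta>) (real (j + l) * \<Delta>) x) \<le> c * (real l * \<Delta>) powr (3 * \<beta>)"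
        using order_trans[OF norm_coordinates(1) m(1)[of 0 0 x]]
        by (simp add: fst_e Inc_tangent(1)[OF td1] Inc_tangent(1)[OF td2])
      also have "\<dots> \<le> C * (real l * \<Delta>) powr (3 * \<beta>)"
        using C by (intro mult_right_mono) auto
      finally show ?thesis .
    qed
    show "norm (euler v D \<Delta> j l x - x) \<le> C * (real l * \<Delta>) powr \<beta>" for x
      using order_trans[OF norm_coordinates(1) m(2)[of 0 0 x]] by (simp add: fst_e)
    have "norm (E' \<Delta> j l x a - a) \<le> C * (real l * \<Delta>) powr \<beta> * norm a" for x a
    proof (rule linear_bound_scale)
      show "linear (\<lambda>a. E' \<Delta> j l x a - a)"
        using linear_compose_sub[OF lin linear_ident] by simp
      show "norm (E' \<Delta> j l x a - a) \<le> C * (real l * \<Delta>) powr \<beta>" if "norm a \<le> 1" for a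
        using order_trans[OF norm_coordinates(2) m(2)[of a 0 x]] that by (simp add: fst_e)
    qed
    moreover have "norm (euler v D \<Delta> j l (x + u) - euler v D \<Delta> j l x - E' \<Delta> j l x u) \<le> C * norm u ^ 2" for x u
    proof -
      have "norm (E' \<Delta> j l y a - E' \<Delta> j l x a) \<le> 1 * norm (y - x) * norm a" for x y a
      proof (rule linear_bound_scale)
        show "linear (\<lambda>a. E' \<Delta> j l y a - E' \<Delta> j l x a)"
          by (rule linear_compose_sub[OF lin lin])
        fix a :: 'a
        assume a: "norm a \<le> 1"
        \<comment> \<open>The scheme stays within distance 1 of a starting point whose last
          component is 0, so the second derivative is at most 1 on unit vectors, uniformly in the
          mesh.\<close>
        have "norm (E'' \<Delta> j l x a b) \<le> 1 * norm b" for x b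
        proof (rule linear_bound_scale[OF has_derivative_linear[OF E'']])
          show "norm (E'' \<Delta> j l x a b) \<le> 1" if "norm b \<le> 1" for b
            using order_trans[OF norm_coordinates(4) m(3)[OF a that, of x]] by (simp add: E''_def)
        qed
        then show "norm (E' \<Delta> j l y a - E' \<Delta> j l x a) \<le> 1 * norm (y - x)"
          by (intro lipschitz_of_bounded_derivative[OF E'']) auto
      qed
      then have "norm (euler v D \<Delta> j l (x + u) - euler v D \<Delta> j l x - E' \<Delta> j l x (x + u - x)) \<le> 1 * norm (x + u - x)^2"
        by (intro quadratic_remainder[of UNIV] E') auto
      also have "\<dots> \<le> C * norm u ^ 2"
        using mult_right_mono[OF C(1), of "norm u ^ 2"] by simp
      finally show ?thesis
        by simp
    qed
    ultimately show "\<exists>E'. (\<forall>x. (euler v D \<Delta> j l has_derivative E' x) (at x)) \<and>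
         (\<forall>x a. norm (E' x a - a) \<le> C * (real l * \<Delta>) powr \<beta> * norm a) \<and>
         (\<forall>x u. norm (euler v D \<Delta> j l (x + u) - euler v D \<Delta> j l x - E' x u) \<le> C * norm u ^ 2)"
      using E' by blast
  qed
qed

end

section \<open>The flow of the driftless equation\<close>

lemma convergent_if_summable_differences:
  fixes f :: "nat \<Rightarrow> 'a::banach"
  assumes "summable g" "\<And>n. N \<le> n \<Longrightarrow> norm (f (Suc n) - f n) \<le> g n"
  shows "convergent f"
proof -
  have "summable (\<lambda>n. f (Suc n) - f n)"
    using assms by (rule summable_comparison_test')
  then have "convergent (\<lambda>n. (\<Sum>i<n. f (Suc i) - f i) + f 0)"
    by (intro convergent_add convergent_const) (simp add: summable_iff_convergent)
  then show ?thesis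
    by (simp add: sum_lessThan_telescope)
qed

text \<open>Fixes the constants \<open>h\<close> and \<open>C\<close> delivered by
  \<open>discrete_flow\<close>, so that the dyadic approximations and their limit share
  them.\<close>

locale euler_flow = rough_flow T \<beta> K X XX v D D2 D3 B
  for T \<beta> K :: real and X :: "real \<Rightarrow> real^'d::finite" and XX :: "real \<Rightarrow> real \<Rightarrow> real^'d^'d"
    and v :: "'d \<Rightarrow> 'a::euclidean_space \<Rightarrow> 'a" and D D2 D3 and B :: real +
  fixes h C :: real
  assumes h: "0 < h" "h \<le> 1" and C: "1 \<le> C" and Ch: "C * h powr \<beta> \<le> 1/2"
    and est1: "\<And>\<Delta> j l x. 0 \<le> \<Delta> \<Longrightarrow> real (j + l) * \<Delta> \<le> T \<Longrightarrow> real l * \<Delta> \<le> h \<Longrightarrow>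
       norm (euler v D \<Delta> j l x - x - Inc v D (real j * \<Delta>) (real (j + l) * \<Delta>) x) \<le> C * (real l * \<Delta>) powr (3 * \<beta>)"
    and est2: "\<And>\<Delta> j l x. 0 \<le> \<Delta> \<Longrightarrow> real (j + l) * \<Delta> \<le> T \<Longrightarrow> real l * \<Delta> \<le> h \<Longrightarrow>
       norm (euler v D \<Delta> j l x - x) \<le> C * (real l * \<Delta>) powr \<beta>"
    and est3: "\<And>\<Delta> j l. 0 \<le> \<Delta> \<Longrightarrow> real (j + l) * \<Delta> \<le> T \<Longrightarrow> real l * \<Delta> \<le> h \<Longrightarrow>
       \<exists>E'. (\<forall>x. (euler v D \<Delta> j l has_derivative E' x) (at x)) \<and>
         (\<forall>x a. norm (E' x a - a) \<le> C * (real l * \<Delta>) powr \<beta> * norm a) \<and>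
         (\<forall>x u. norm (euler v D \<Delta> j l (x + u) - euler v D \<Delta> j l x - E' x u) \<le> C * norm u ^ 2)"
begin

lemma euler_lipschitz_short:
  assumes \<Delta>: "0 \<le> \<Delta>" "real (j + l) * \<Delta> \<le> T" "real l * \<Delta> \<le> h"
  shows "norm (euler v D \<Delta> j l x - euler v D \<Delta> j l y) \<le> 2 * norm (x - y)"
proof -
  obtain E' where E': "\<And>x. (euler v D \<Delta> j l has_derivative E' x) (at x)"
    and b: "\<And>x a. norm (E' x a - a) \<le> C * (real l * \<Delta>) powr \<beta> * norm a"
    using est3[OF \<Delta>] by blast
  have "C * (real l * \<Delta>) powr \<beta> \<le> C * h powr \<beta>"
    using \<Delta> \<beta> C by (intro mult_left_mono powr_mono2) auto
  then have "C * (real l * \<Delta>) powr \<beta> \<le> 1"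
    using Ch by linarith
  then have "norm (E' x a) \<le> 2 * norm a" for x a
    using norm_triangle_sub[of "E' x a" a] b[of x a] mult_right_mono[of _ 1 "norm a"] by fastforce
  then show ?thesis
    by (intro lipschitz_of_bounded_derivative[OF E']) auto
qed

text \<open>Peel off the largest number of steps of total length at most \<open>h\<close>. As the
  mesh is at most \<open>h / 2\<close>, this removes a length of at least \<open>h / 2\<close> at
  the price of one factor 2.\<close>

lemma euler_lipschitz_pow:
  assumes \<Delta>: "0 < \<Delta>" "\<Delta> \<le> h / 2"
  shows "real (j + l) * \<Delta> \<le> T \<Longrightarrow> real l * \<Delta> \<le> real p * (h / 2) \<Longrightarrow>
    norm (euler v D \<Delta> j l x - euler v D \<Delta> j l y) \<le> 2 ^ p * norm (x - y)"
proof (induction p arbitrary: j l x y)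
  case 0
  then have "real l * \<Delta> \<le> 0"
    by simp
  then have "l = 0"
    using \<Delta> by (simp add: mult_le_0_iff)
  then show ?case
    by simp
next
  case (Suc p)
  show ?case
  proof (cases "real l * \<Delta> \<le> h")
    case True
    have "norm (euler v D \<Delta> j l x - euler v D \<Delta> j l y) \<le> 2 * norm (x - y)"
      using \<Delta> Suc.prems True by (intro euler_lipschitz_short) auto
    also have "\<dots> \<le> 2 ^ Suc p * norm (x - y)"
      by (intro mult_right_mono) auto
    finally show ?thesis .
  next
    case False
    define m where "m = nat \<lfloor>h / \<Delta>\<rfloor>"
    have m: "real m \<le> h / \<Delta>" "h / \<Delta> - 1 \<le> real m"
      using h \<Delta> unfolding m_def by auto
    have mh: "real m * \<Delta> \<le> h" "h / 2 \<le> real m * \<Delta>"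
    proof -
      show "real m * \<Delta> \<le> h"
        using m(1) \<Delta> by (simp add: field_simps)
      have "h - \<Delta> \<le> real m * \<Delta>"
        using mult_right_mono[OF m(2), of \<Delta>] \<Delta> by (simp add: left_diff_distrib)
      then show "h / 2 \<le> real m * \<Delta>"
        using \<Delta> by linarith
    qed
    have "real m * \<Delta> < real l * \<Delta>"
      using mh False by linarith
    then have ml: "m \<le> l"
      using \<Delta> by simp
    have split: "euler v D \<Delta> j l z = euler v D \<Delta> (j + m) (l - m) (euler v D \<Delta> j m z)" for z
      using euler_add[of v D \<Delta> j m "l - m" z] ml by simp
    have "norm (euler v D \<Delta> j l x - euler v D \<Delta> j l y) \<le> 2 ^ p * norm (euler v D \<Delta> j m x - euler v D \<Delta> j m y)"
      unfolding split
    proof (rule Suc.IH)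
      show "real (j + m + (l - m)) * \<Delta> \<le> T"
        using Suc.prems ml by simp
      show "real (l - m) * \<Delta> \<le> real p * (h / 2)"
        using Suc.prems mh ml by (simp add: of_nat_diff algebra_simps)
    qed
    also have "norm (euler v D \<Delta> j m x - euler v D \<Delta> j m y) \<le> 2 * norm (x - y)"
    proof (rule euler_lipschitz_short)
      have "real (j + m) * \<Delta> \<le> real (j + l) * \<Delta>"
        using ml \<Delta> by (intro mult_right_mono) auto
      then show "real (j + m) * \<Delta> \<le> T"
        using Suc.prems(1) by linarith
    qed (use \<Delta> mh in auto)
    finally show ?thesis
      by simp
  qed
qed

definition lip :: real where
  "lip = 2 ^ nat \<lceil>T / (h / 2)\<rceil>"

lemma lip: "1 \<le> lip"
  by (simp add: lip_def)

lemma euler_lipschitz: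
  assumes \<Delta>: "0 < \<Delta>" "\<Delta> \<le> h / 2" and T: "real (j + l) * \<Delta> \<le> T"
  shows "norm (euler v D \<Delta> j l x - euler v D \<Delta> j l y) \<le> lip * norm (x - y)"
  unfolding lip_def
proof (rule euler_lipschitz_pow[OF \<Delta> T])
  have "real l * \<Delta> \<le> real (j + l) * \<Delta>"
    using \<Delta> by (intro mult_right_mono) auto
  also have "\<dots> \<le> T / (h / 2) * (h / 2)"
    using T h by simp
  also have "\<dots> \<le> real (nat \<lceil>T / (h / 2)\<rceil>) * (h / 2)"
    using h by (intro mult_right_mono) (auto simp: of_nat_ceiling)
  finally show "real l * \<Delta> \<le> real (nat \<lceil>T / (h / 2)\<rceil>) * (h / 2)" .
qed

text \<open>Replace the steps one by one by two half steps. Each replacement costs order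
  \<open>3 * \<beta>\<close> by \<open>est1\<close>, and the Lipschitz bound carries this error to
  the end without loss in the mesh.\<close>

lemma euler_refine:
  assumes \<Delta>: "0 < \<Delta>" "\<Delta> \<le> h / 2"
  shows "real (j + l) * \<Delta> \<le> T \<Longrightarrow>
    norm (euler v D (\<Delta> / 2) (2 * j) (2 * l) x - euler v D \<Delta> j l x) \<le> real l * (lip * C * \<Delta> powr (3 * \<beta>))"
proof (induction l arbitrary: j x)
  case (Suc l)
  let ?y = "euler v D (\<Delta> / 2) (2 * j) 2 x" and ?z = "euler v D \<Delta> j 1 x"
  have "real (j + 1) * \<Delta> \<le> real (j + Suc l) * \<Delta>"
    using \<Delta> by (intro mult_right_mono) auto
  then have T: "real (j + 1) * \<Delta> \<le> T"
    using Suc.prems by linarith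
  have yz: "norm (?y - ?z) \<le> C * \<Delta> powr (3 * \<beta>)"
  proof -
    have eq: "real (2 * j) * (\<Delta> / 2) = real j * \<Delta>" "real (2 * j + 2) * (\<Delta> / 2) = real (Suc j) * \<Delta>"
      by (auto simp: algebra_simps add_divide_distrib)
    have z: "?z = x + Inc v D (real j * \<Delta>) (real (Suc j) * \<Delta>) x"
      by simp
    have "?y - ?z = ?y - x - Inc v D (real (2 * j) * (\<Delta> / 2)) (real (2 * j + 2) * (\<Delta> / 2)) x"
      unfolding eq z by (rule diff_diff_eq[symmetric])
    also have "norm \<dots> \<le> C * (real 2 * (\<Delta> / 2)) powr (3 * \<beta>)"
      using \<Delta> T h by (intro est1) (auto simp: field_simps)
    finally show ?thesis
      by simp
  qed
  have eq: "euler v D (\<Delta> / 2) (2 * j) (2 * Suc l) x - euler v D \<Delta> j (Suc l) x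
    = (euler v D (\<Delta> / 2) (2 * (j + 1)) (2 * l) ?y - euler v D (\<Delta> / 2) (2 * (j + 1)) (2 * l) ?z)
      + (euler v D (\<Delta> / 2) (2 * (j + 1)) (2 * l) ?z - euler v D \<Delta> (j + 1) l ?z)"
    using euler_add[of v D "\<Delta> / 2" "2 * j" 2 "2 * l" x] euler_add[of v D \<Delta> j 1 l x]
    by (simp del: euler.simps)
  have "norm (euler v D (\<Delta> / 2) (2 * j) (2 * Suc l) x - euler v D \<Delta> j (Suc l) x)
    \<le> lip * norm (?y - ?z) + real l * (lip * C * \<Delta> powr (3 * \<beta>))"
    unfolding eq
  proof (rule norm_triangle_mono)
    have eq: "real (j + 1 + l) * \<Delta> = real (j + Suc l) * \<Delta>" "real (2 * (j + 1) + 2 * l) * (\<Delta> / 2) = real (j + Suc l) * \<Delta>"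
      by (auto simp: algebra_simps add_divide_distrib)
    show "norm (euler v D (\<Delta> / 2) (2 * (j + 1)) (2 * l) ?y - euler v D (\<Delta> / 2) (2 * (j + 1)) (2 * l) ?z) \<le> lip * norm (?y - ?z)"
      using \<Delta> by (intro euler_lipschitz eq(2)[THEN ord_eq_le_trans] Suc.prems) auto
    show "norm (euler v D (\<Delta> / 2) (2 * (j + 1)) (2 * l) ?z - euler v D \<Delta> (j + 1) l ?z) \<le> real l * (lip * C * \<Delta> powr (3 * \<beta>))"
      by (intro Suc.IH eq(1)[THEN ord_eq_le_trans] Suc.prems)
  qed
  also have "\<dots> \<le> lip * (C * \<Delta> powr (3 * \<beta>)) + real l * (lip * C * \<Delta> powr (3 * \<beta>))"
    by (rule add_right_mono[OF mult_left_mono[OF yz]]) (use lip in simp)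
  also have "\<dots> = real (Suc l) * (lip * C * \<Delta> powr (3 * \<beta>))"
    by (simp add: algebra_simps)
  finally show ?case .
qed simp

text \<open>Rounding a time down to the next finer dyadic grid may move it by one fine step. This
  lemma and its left counterpart control such a shift at either end of a block.\<close>

lemma euler_extend_right:
  assumes \<Delta>: "0 < \<Delta>" "\<Delta> \<le> h / 2" and T: "real (j + Suc l) * \<Delta> \<le> T"
  shows "norm (euler v D \<Delta> j (Suc l) x - euler v D \<Delta> j l x) \<le> C * \<Delta> powr \<beta>"
  using est2[of \<Delta> "j + l" 1 "euler v D \<Delta> j l x"] \<Delta> T h by simp

lemma euler_extend_left:
  assumes \<Delta>: "0 < \<Delta>" "\<Delta> \<le> h / 2" and T: "real (j + Suc l) * \<Delta> \<le> T"
  shows "norm (euler v D \<Delta> j (Suc l) x - euler v D \<Delta> (Suc j) l x) \<le> lip * (C * \<Delta> powr \<beta>)"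
proof -
  have "real (j + 1) * \<Delta> \<le> real (j + Suc l) * \<Delta>"
    using \<Delta> by (intro mult_right_mono) auto
  then have T': "real (j + 1) * \<Delta> \<le> T"
    using T by linarith
  have eq: "euler v D \<Delta> j (Suc l) x = euler v D \<Delta> (Suc j) l (euler v D \<Delta> j 1 x)"
    using euler_add[of v D \<Delta> j 1 l x] by simp
  have "norm (euler v D \<Delta> j (Suc l) x - euler v D \<Delta> (Suc j) l x) \<le> lip * norm (euler v D \<Delta> j 1 x - x)"
    unfolding eq by (rule euler_lipschitz[OF \<Delta>]) (use T in simp)
  also have "\<dots> \<le> lip * (C * (real 1 * \<Delta>) powr \<beta>)"
    using \<Delta> T' h lip by (intro mult_left_mono est2) auto
  finally show ?thesis
    by simp
qed

section \<open>Dyadic approximations and their limit\<close>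

definition mesh :: "nat \<Rightarrow> real" where
  "mesh n = T / 2 ^ n"

definition idx :: "nat \<Rightarrow> real \<Rightarrow> nat" where
  "idx n t = nat \<lfloor>t / mesh n\<rfloor>"

definition approx :: "nat \<Rightarrow> real \<Rightarrow> real \<Rightarrow> 'a \<Rightarrow> 'a" where
  "approx n s t = euler v D (mesh n) (idx n s) (idx n t - idx n s)"

lemma mesh: "0 < mesh n" "mesh (Suc n) = mesh n / 2"
  using T by (auto simp: mesh_def)

lemma mesh_tendsto: "mesh \<longlonglongrightarrow> 0"
proof -
  have "(\<lambda>n. T * (1/2) ^ n) \<longlonglongrightarrow> T * 0"
    by (intro tendsto_mult tendsto_const LIMSEQ_power_zero) simp
  then show ?thesis
    by (simp add: mesh_def[abs_def] power_one_over)
qed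

lemma idx_mono: "s \<le> t \<Longrightarrow> idx n s \<le> idx n t"
  unfolding idx_def using mesh(1)[of n] by (intro nat_mono floor_mono divide_right_mono) auto

lemma idx_bounds:
  assumes "0 \<le> t"
  shows "real (idx n t) * mesh n \<le> t" "t - mesh n \<le> real (idx n t) * mesh n"
proof -
  have "real (idx n t) \<le> t / mesh n" "t / mesh n - 1 \<le> real (idx n t)"
    using assms mesh(1)[of n] unfolding idx_def by auto
  then show "real (idx n t) * mesh n \<le> t" "t - mesh n \<le> real (idx n t) * mesh n"
    using mesh(1)[of n] by (auto simp: field_simps)
qed

lemma idx_Suc:
  assumes "0 \<le> t"
  shows "idx (Suc n) t = 2 * idx n t \<or> idx (Suc n) t = Suc (2 * idx n t)"
proof -
  define y where "y = t / mesh n"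
  have y: "0 \<le> y"
    using assms mesh(1)[of n] by (simp add: y_def)
  have "t / mesh (Suc n) = 2 * y"
    by (simp add: y_def mesh(2))
  moreover have "\<lfloor>2 * y\<rfloor> = 2 * \<lfloor>y\<rfloor> \<or> \<lfloor>2 * y\<rfloor> = 2 * \<lfloor>y\<rfloor> + 1"
    by linarith
  ultimately show ?thesis
    using y unfolding idx_def y_def[symmetric] by (auto simp: nat_mult_distrib nat_add_distrib)
qed

definition fine_level :: nat where
  "fine_level = (SOME N. \<forall>n\<ge>N. mesh n \<le> h / 2)"

lemma fine_level:
  assumes "fine_level \<le> n"
  shows "mesh n \<le> h / 2"
proof -
  have "eventually (\<lambda>n. mesh n < h / 2) sequentially"
    using h by (intro order_tendstoD(2)[OF mesh_tendsto]) auto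
  then obtain N where N: "\<And>n. N \<le> n \<Longrightarrow> mesh n < h / 2"
    unfolding eventually_sequentially by blast
  have "\<forall>n\<ge>fine_level. mesh n \<le> h / 2"
    unfolding fine_level_def by (rule someI[of _ N]) (use N in force)
  then show ?thesis
    using assms by blast
qed

context
  fixes s t :: real
  assumes st: "0 \<le> s" "s \<le> t" "t \<le> T"
begin

lemma approx_domain: "real (idx n s + (idx n t - idx n s)) * mesh n \<le> T"
  using idx_bounds(1)[of t n] idx_mono[OF st(2), of n] st by simp

lemma approx_lipschitz: "fine_level \<le> n \<Longrightarrow> norm (approx n s t x - approx n s t y) \<le> lip * norm (x - y)"
  unfolding approx_def by (intro euler_lipschitz mesh fine_level approx_domain)

text \<open>The refined scheme is first run between the coarse grid points, where
  \<open>euler_refine\<close> applies, and then its end points are shifted. Both resulting exponents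
  are positive, as \<open>3 * \<beta> > 1\<close>, so the differences are summable over the
  levels.\<close>

lemma approx_step:
  assumes n: "fine_level \<le> n"
  shows "norm (approx (Suc n) s t x - approx n s t x)
    \<le> T * lip * C * mesh n powr (3 * \<beta> - 1) + (lip * C + C) * mesh n powr \<beta>"
proof -
  define \<delta> where "\<delta> = mesh (Suc n)"
  have \<delta>: "0 < \<delta>" "\<delta> \<le> h / 2" "mesh n / 2 = \<delta>"
    using mesh fine_level[of "Suc n"] n by (auto simp: \<delta>_def)
  \<comment> \<open>Coarse end points \<open>p\<close>, \<open>q\<close> and fine end points
    \<open>p'\<close>, \<open>q'\<close>, all as indices on the fine grid.\<close>
  define p q where "p = 2 * idx n s" and "q = 2 * idx n t"
  define p' q' where "p' = idx (Suc n) s" and "q' = idx (Suc n) t"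
  have pq: "p \<le> q" "p' \<le> q'" "p' = p \<or> p' = Suc p" "q' = q \<or> q' = Suc q" "q - p = 2 * (idx n t - idx n s)"
    using idx_mono[OF st(2)] idx_Suc[of s n] idx_Suc[of t n] st by (auto simp: p_def q_def p'_def q'_def)
  have qT: "real q' * \<delta> \<le> T"
    unfolding q'_def \<delta>_def using idx_bounds(1)[of t "Suc n"] st by linarith
  have T: "real m * \<delta> \<le> T" if "m \<le> q'" for m
    using mult_right_mono[of "real m" "real q'" \<delta>] that \<delta> qT by linarith
  have 1: "norm (euler v D \<delta> p (q - p) x - approx n s t x) \<le> T * lip * C * mesh n powr (3 * \<beta> - 1)"
  proof -
    have "norm (euler v D \<delta> p (q - p) x - approx n s t x)
      \<le> real (idx n t - idx n s) * (lip * C * mesh n powr (3 * \<beta>))"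
      unfolding approx_def pq(5) unfolding p_def \<delta>(3)[symmetric] using approx_domain n by (intro euler_refine mesh fine_level)
    also have "\<dots> = (real (idx n t - idx n s) * mesh n) * (lip * C * mesh n powr (3 * \<beta> - 1))"
      using mesh(1)[of n] by (simp add: powr_diff)
    also have "\<dots> \<le> T * (lip * C * mesh n powr (3 * \<beta> - 1))"
    proof (rule mult_right_mono)
      have "real (idx n t - idx n s) * mesh n \<le> real (idx n s + (idx n t - idx n s)) * mesh n"
        using mesh(1)[of n] by (intro mult_right_mono) auto
      then show "real (idx n t - idx n s) * mesh n \<le> T"
        using approx_domain[of n] by linarith
    qed (use lip C in auto)
    finally show ?thesis
      by (simp add: algebra_simps)
  qed
  have le: "C * \<delta> powr \<beta> \<le> C * mesh n powr \<beta>"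
    using C \<delta> \<beta> by (intro mult_left_mono powr_mono2) auto
  have 2: "norm (euler v D \<delta> p' (q' - p') x - euler v D \<delta> p (q - p) x) \<le> (lip * C + C) * \<delta> powr \<beta>"
  proof (cases "p' \<le> q")
    case True
    have right: "norm (euler v D \<delta> p' (q' - p') x - euler v D \<delta> p' (q - p') x) \<le> C * \<delta> powr \<beta>"
    proof (cases "q' = q")
      case False
      then have "q' - p' = Suc (q - p')" "q' = Suc q"
        using pq True by auto
      then show ?thesis
        using euler_extend_right[OF \<delta>(1,2), of p' "q - p'"] T[of q'] True pq(2) by simp
    qed (use C in simp)
    have left: "norm (euler v D \<delta> p' (q - p') x - euler v D \<delta> p (q - p) x) \<le> lip * (C * \<delta> powr \<beta>)"
    proof (cases "p' = p")
      case False
      then have "p' = Suc p" "q - p = Suc (q - p')" "q \<le> q'"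
        using pq True by auto
      then show ?thesis
        using euler_extend_left[OF \<delta>(1,2), of p "q - p'" x] T[of q] True by (simp add: norm_minus_commute)
    qed (use C lip in simp)
    show ?thesis
      using norm_triangle_mono[OF right left] by (simp add: algebra_simps)
  next
    case False
    \<comment> \<open>Here \<open>s\<close> and \<open>t\<close> lie in one coarse cell and round to
      the same fine point, so both blocks are empty.\<close>
    then have "p' = q'" "p = q"
      using pq by auto
    then show ?thesis
      using C lip by simp
  qed
  have "(lip * C + C) * \<delta> powr \<beta> \<le> (lip * C + C) * mesh n powr \<beta>"
    using C lip \<delta> \<beta> by (intro mult_left_mono powr_mono2) auto
  moreover have "approx (Suc n) s t x = euler v D \<delta> p' (q' - p') x"
    by (simp add: approx_def p'_def q'_def \<delta>_def)
  ultimately show ?thesis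
    using norm_triangle_mono[OF 2 1] by simp
qed

lemma summable_mesh_powr: "0 < a \<Longrightarrow> summable (\<lambda>n. mesh n powr a)"
proof -
  assume a: "0 < a"
  have "mesh n powr a = T powr a * ((1/2) powr a) ^ n" for n
  proof -
    have half: "((1/2::real) ^ n) powr a = ((1/2) powr a) ^ n"
      by (simp add: powr_powr mult.commute flip: powr_realpow)
    have "mesh n = T * (1/2) ^ n"
      by (simp add: mesh_def power_one_over)
    then show ?thesis
      by (simp add: powr_mult half del: power_one_over)
  qed
  moreover have "summable (\<lambda>n. T powr a * ((1/2) powr a) ^ n)"
    using a powr_less_mono2[of a "1/2" 1] by (intro summable_mult summable_geometric) simp
  ultimately show ?thesis
    by simp
qed

lemma approx_convergent: "convergent (\<lambda>n. approx n s t x)"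
proof (rule convergent_if_summable_differences)
  show "norm (approx (Suc n) s t x - approx n s t x)
    \<le> T * lip * C * mesh n powr (3 * \<beta> - 1) + (lip * C + C) * mesh n powr \<beta>" if "fine_level \<le> n" for n
    using that by (rule approx_step)
  show "summable (\<lambda>n. T * lip * C * mesh n powr (3 * \<beta> - 1) + (lip * C + C) * mesh n powr \<beta>)"
    using \<beta> by (intro summable_add summable_mult summable_mesh_powr) auto
qed

end

definition flow :: "real \<Rightarrow> real \<Rightarrow> 'a \<Rightarrow> 'a" where
  "flow s t x = lim (\<lambda>n. approx n s t x)"

lemma flow_tendsto: "0 \<le> s \<Longrightarrow> s \<le> t \<Longrightarrow> t \<le> T \<Longrightarrow> (\<lambda>n. approx n s t x) \<longlonglongrightarrow> flow s t x"
  using approx_convergent[of s t x] convergent_LIMSEQ_iff unfolding flow_def by blast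

lemma flow_self: "0 \<le> t \<Longrightarrow> t \<le> T \<Longrightarrow> flow t t x = x"
  by (simp add: flow_def approx_def)

text \<open>At each level the flow property is exact, because all blocks live on the same grid. The
  uniform Lipschitz bound allows the inner approximation to be replaced by its limit.\<close>

lemma flow_comp:
  assumes "0 \<le> s" "s \<le> u" "u \<le> t" "t \<le> T"
  shows "flow u t (flow s u x) = flow s t x"
proof -
  have eq: "approx n u t (approx n s u x) = approx n s t x" for n
    unfolding approx_def using idx_mono[OF assms(2), of n] idx_mono[OF assms(3), of n]
      euler_add[of v D "mesh n" "idx n s" "idx n u - idx n s" "idx n t - idx n u" x] by simp
  have "(\<lambda>n. approx n u t (approx n s u x) - approx n u t (flow s u x)) \<longlonglongrightarrow> 0"
  proof (rule Lim_null_comparison)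
    show "\<forall>\<^sub>F n in sequentially. norm (approx n u t (approx n s u x) - approx n u t (flow s u x))
      \<le> lip * norm (approx n s u x - flow s u x)"
      using assms by (intro eventually_sequentiallyI[of fine_level] approx_lipschitz) auto
    show "(\<lambda>n. lip * norm (approx n s u x - flow s u x)) \<longlonglongrightarrow> 0"
      using assms by (intro tendsto_mult_right_zero tendsto_norm_zero LIM_zero flow_tendsto) auto
  qed
  moreover have "(\<lambda>n. approx n u t (approx n s u x) - approx n u t (flow s u x)) \<longlonglongrightarrow> flow s t x - flow u t (flow s u x)"
    unfolding eq using assms by (intro tendsto_diff flow_tendsto) auto
  ultimately show ?thesis
    using LIMSEQ_unique by fastforce
qed

definition grid :: "nat \<Rightarrow> real \<Rightarrow> real" where
  "grid n t = real (idx n t) * mesh n"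

lemma grid_tendsto:
  assumes "0 \<le> t"
  shows "(\<lambda>n. grid n t) \<longlonglongrightarrow> t"
proof (rule tendsto_sandwich)
  show "\<forall>\<^sub>F n in sequentially. t - mesh n \<le> grid n t" "\<forall>\<^sub>F n in sequentially. grid n t \<le> t"
    unfolding grid_def using idx_bounds[OF assms] by auto
  show "(\<lambda>n. t - mesh n) \<longlonglongrightarrow> t"
    using tendsto_diff[OF tendsto_const mesh_tendsto, of t] by simp
qed auto

lemma grid_bounds: "0 \<le> t \<Longrightarrow> 0 \<le> grid n t" "0 \<le> t \<Longrightarrow> grid n t \<le> t" "s \<le> t \<Longrightarrow> grid n s \<le> grid n t"
  unfolding grid_def using idx_bounds[of t n] idx_mono[of s t n] mesh(1)[of n] by (auto intro: mult_right_mono)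

lemma powr_tendsto_0:
  assumes "f \<longlonglongrightarrow> (0::real)" "\<And>n. 0 \<le> f n" "0 < a"
  shows "(\<lambda>n. f n powr a) \<longlonglongrightarrow> 0"
  using tendsto_powr2[OF assms(1) tendsto_const, of a] assms by simp

lemma grid_gap:
  assumes "0 \<le> t" "t \<le> T"
  shows "(\<lambda>n. increment X (grid n t) t $ i) \<longlonglongrightarrow> 0" "(\<lambda>n. XX (grid n t) t $ i $ j) \<longlonglongrightarrow> 0"
proof -
  have gap: "(\<lambda>n. (t - grid n t) powr \<beta>) \<longlonglongrightarrow> 0"
    using tendsto_diff[OF tendsto_const grid_tendsto[OF assms(1)], of t] \<beta> grid_bounds(2)[OF assms(1)]
    by (intro powr_tendsto_0) auto
  show "(\<lambda>n. increment X (grid n t) t $ i) \<longlonglongrightarrow> 0"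
  proof (rule Lim_null_comparison)
    show "\<forall>\<^sub>F n in sequentially. norm (increment X (grid n t) t $ i) \<le> K * (t - grid n t) powr \<beta>"
      using X_bound grid_bounds assms by (intro always_eventually allI) (metis real_norm_def)
    show "(\<lambda>n. K * (t - grid n t) powr \<beta>) \<longlonglongrightarrow> 0"
      using gap by (rule tendsto_mult_right_zero)
  qed
  show "(\<lambda>n. XX (grid n t) t $ i $ j) \<longlonglongrightarrow> 0"
  proof (rule Lim_null_comparison)
    show "\<forall>\<^sub>F n in sequentially. norm (XX (grid n t) t $ i $ j) \<le> K * ((t - grid n t) powr \<beta>)^2"
      using XX_bound grid_bounds assms by (intro always_eventually allI) (metis real_norm_def)
    show "(\<lambda>n. K * ((t - grid n t) powr \<beta>)^2) \<longlonglongrightarrow> 0"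
      using tendsto_power[OF gap, of 2] by (intro tendsto_mult_right_zero) simp
  qed
qed

text \<open>Continuity of the second level in both times is extracted from Chen's relation, which
  expresses the rounded value through terms over the vanishing gaps between times and grid
  points.\<close>

lemma Inc_grid_tendsto:
  assumes "0 \<le> s" "s \<le> t" "t \<le> T"
  shows "(\<lambda>n. Inc v D (grid n s) (grid n t) x) \<longlonglongrightarrow> Inc v D s t x"
proof -
  have s: "s \<le> T" and t: "0 \<le> t"
    using assms by auto
  have X: "(\<lambda>n. increment X (grid n s) (grid n t) $ i) \<longlonglongrightarrow> increment X s t $ i" for i
  proof -
    have "(\<lambda>n. increment X s t $ i + increment X (grid n s) s $ i - increment X (grid n t) t $ i) \<longlonglongrightarrow> increment X s t $ i + 0 - 0"
      by (intro tendsto_intros grid_gap assms s t)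
    then show ?thesis
      by (simp add: increment_def)
  qed
  have XX: "(\<lambda>n. XX (grid n s) (grid n t) $ i $ j) \<longlonglongrightarrow> XX s t $ i $ j" for i j
  proof -
    have "XX (grid n s) (grid n t) = XX s t + XX (grid n s) s + outer (increment X (grid n s) s) (increment X s t)
      - XX (grid n t) t - outer (increment X (grid n s) (grid n t)) (increment X (grid n t) t)" for n
      using chen[of "grid n s" s t] chen[of "grid n s" "grid n t" t] grid_bounds(1,2)[of s n] grid_bounds(2)[of t n] grid_bounds(3)[of s t n] assms t
      by (simp add: algebra_simps)
    then have eq: "XX (grid n s) (grid n t) $ i $ j = XX s t $ i $ j + XX (grid n s) s $ i $ j
      + increment X (grid n s) s $ i * increment X s t $ j
      - XX (grid n t) t $ i $ j - increment X (grid n s) (grid n t) $ i * increment X (grid n t) t $ j" for n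
      by (simp add: outer_def)
    have "(\<lambda>n. XX (grid n s) (grid n t) $ i $ j) \<longlonglongrightarrow>
      XX s t $ i $ j + 0 + 0 * increment X s t $ j - 0 - increment X s t $ i * 0"
      unfolding eq by (intro tendsto_intros grid_gap X assms s t)
    then show ?thesis
      by simp
  qed
  show ?thesis
    unfolding Inc_def rough_increment_def by (intro tendsto_intros X XX)
qed

context
  fixes s t :: real
  assumes st: "0 \<le> s" "s \<le> t" "t \<le> T" "t - s \<le> h / 2"
begin

lemma grid_length: "real (idx n t - idx n s) * mesh n = grid n t - grid n s"
  using idx_mono[OF st(2), of n] by (simp add: grid_def algebra_simps of_nat_diff)

lemma grid_length_tendsto: "(\<lambda>n. (grid n t - grid n s) powr a) \<longlonglongrightarrow> (t - s) powr a" if "0 < a"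
  using st that grid_bounds(3)[OF st(2)] by (intro tendsto_powr2 tendsto_diff grid_tendsto tendsto_const) auto

text \<open>The rounded interval may exceed \<open>t - s\<close> by one mesh width; the reserve left
  by \<open>t - s <= h / 2\<close> absorbs it.\<close>

lemma approx_admissible:
  assumes "fine_level \<le> n"
  shows "0 \<le> mesh n" "real (idx n s + (idx n t - idx n s)) * mesh n \<le> T" "real (idx n t - idx n s) * mesh n \<le> h"
proof -
  show "0 \<le> mesh n"
    using mesh(1)[of n] by simp
  show "real (idx n s + (idx n t - idx n s)) * mesh n \<le> T"
    by (rule approx_domain[OF st(1-3)])
  show "real (idx n t - idx n s) * mesh n \<le> h"
    unfolding grid_length using fine_level[OF assms] idx_bounds[of s n] grid_bounds(2)[of t n] st unfolding grid_def by linarith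
qed

lemma flow_expansion: "norm (flow s t x - x - Inc v D s t x) \<le> C * (t - s) powr (3 * \<beta>)"
proof (rule tendsto_le[OF sequentially_bot])
  show "(\<lambda>n. norm (approx n s t x - x - Inc v D (grid n s) (grid n t) x)) \<longlonglongrightarrow> norm (flow s t x - x - Inc v D s t x)"
    by (intro tendsto_intros flow_tendsto Inc_grid_tendsto st)
  show "(\<lambda>n. C * (grid n t - grid n s) powr (3 * \<beta>)) \<longlonglongrightarrow> C * (t - s) powr (3 * \<beta>)"
    using \<beta> by (intro tendsto_mult_left grid_length_tendsto) auto
  have "norm (approx n s t x - x - Inc v D (grid n s) (grid n t) x) \<le> C * (grid n t - grid n s) powr (3 * \<beta>)"
    if "fine_level \<le> n" for n
    using est1[OF approx_admissible[OF that], of x] idx_mono[OF st(2), of n]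
    unfolding grid_length approx_def by (simp add: grid_def)
  then show "\<forall>\<^sub>F n in sequentially. norm (approx n s t x - x - Inc v D (grid n s) (grid n t) x)
      \<le> C * (grid n t - grid n s) powr (3 * \<beta>)"
    by (rule eventually_sequentiallyI)
qed

lemma flow_holder: "norm (flow s t x - x) \<le> C * (t - s) powr \<beta>"
proof (rule tendsto_le[OF sequentially_bot])
  show "(\<lambda>n. norm (approx n s t x - x)) \<longlonglongrightarrow> norm (flow s t x - x)"
    by (intro tendsto_intros flow_tendsto st)
  show "(\<lambda>n. C * (grid n t - grid n s) powr \<beta>) \<longlonglongrightarrow> C * (t - s) powr \<beta>"
    using \<beta> by (intro tendsto_mult_left grid_length_tendsto) auto
  show "\<forall>\<^sub>F n in sequentially. norm (approx n s t x - x) \<le> C * (grid n t - grid n s) powr \<beta>"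
    using est2[OF approx_admissible] unfolding grid_length approx_def by (intro eventually_sequentiallyI)
qed

text \<open>The derivative of the flow is a limit point of the derivatives of the Euler approximations,
  so their convergence is not needed.\<close>

lemma flow_derivative:
  "\<exists>J :: 'a \<Rightarrow>\<^sub>L 'a. (\<forall>a. norm (J a - a) \<le> C * (t - s) powr \<beta> * norm a) \<and>
     (\<forall>u. norm (flow s t (x + u) - flow s t x - J u) \<le> C * norm u ^ 2)"
proof -
  have "\<exists>J :: 'a \<Rightarrow>\<^sub>L 'a. (\<forall>a. norm (J a - a) \<le> C * (grid n t - grid n s) powr \<beta> * norm a) \<and>
     (\<forall>u. norm (approx n s t (x + u) - approx n s t x - J u) \<le> C * norm u ^ 2)" if n: "fine_level \<le> n" for n
  proof -
    obtain E' where E': "\<And>x. (approx n s t has_derivative E' x) (at x)"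
      and b: "\<And>x a. norm (E' x a - a) \<le> C * (grid n t - grid n s) powr \<beta> * norm a"
      and q: "\<And>x u. norm (approx n s t (x + u) - approx n s t x - E' x u) \<le> C * norm u ^ 2"
      using est3[OF approx_admissible[OF n]] unfolding grid_length approx_def[symmetric] by blast
    have "blinfun_apply (Blinfun (E' x)) = E' x"
      using has_derivative_bounded_linear[OF E'] by (rule bounded_linear_Blinfun_apply)
    then show ?thesis
      using b q by (intro exI[of _ "Blinfun (E' x)"]) simp
  qed
  then obtain J :: "nat \<Rightarrow> 'a \<Rightarrow>\<^sub>L 'a"
    where J1: "\<And>n a. fine_level \<le> n \<Longrightarrow> norm (J n a - a) \<le> C * (grid n t - grid n s) powr \<beta> * norm a"
      and J2: "\<And>n u. fine_level \<le> n \<Longrightarrow> norm (approx n s t (x + u) - approx n s t x - J n u) \<le> C * norm u ^ 2"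
    by metis
  have "norm (J (n + fine_level)) \<le> 2" for n
  proof (rule norm_blinfun_bound)
    fix a :: 'a
    let ?n = "n + fine_level"
    have "C * (grid ?n t - grid ?n s) powr \<beta> \<le> C * h powr \<beta>"
      using approx_admissible(3)[of ?n] C \<beta> grid_bounds(3)[OF st(2)] unfolding grid_length
      by (intro mult_left_mono powr_mono2) auto
    then have "C * (grid ?n t - grid ?n s) powr \<beta> * norm a \<le> 1 * norm a"
      using Ch by (intro mult_right_mono) auto
    then show "norm (J ?n a) \<le> 2 * norm a"
      using J1[of ?n a] norm_triangle_sub[of "J ?n a" a] by simp
  qed simp
  then have "bounded (range (\<lambda>n. J (n + fine_level)))"
    by (auto simp: bounded_iff)
  then obtain L r where r: "strict_mono r" and L: "((\<lambda>n. J (n + fine_level)) \<circ> r) \<longlonglongrightarrow> L"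
    using bounded_imp_convergent_subsequence by blast
  define m where "m n = r n + fine_level" for n
  have m: "fine_level \<le> m n" "filterlim m at_top sequentially" for n
    unfolding m_def using filterlim_subseq[OF r] by (auto intro: filterlim_tendsto_add_at_top filterlim_at_top_mono)
  have L: "(\<lambda>n. J (m n) a) \<longlonglongrightarrow> L a" for a
    using L by (intro tendsto_intros) (simp add: o_def m_def)
  have "norm (L a - a) \<le> C * (t - s) powr \<beta> * norm a" for a
  proof (rule tendsto_le[OF sequentially_bot])
    show "(\<lambda>n. norm (J (m n) a - a)) \<longlonglongrightarrow> norm (L a - a)"
      by (intro tendsto_intros L)
    show "(\<lambda>n. C * (grid (m n) t - grid (m n) s) powr \<beta> * norm a) \<longlonglongrightarrow> C * (t - s) powr \<beta> * norm a"
      using \<beta> by (intro tendsto_mult_left tendsto_mult_right filterlim_compose[OF grid_length_tendsto m(2)]) auto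
    show "\<forall>\<^sub>F n in sequentially. norm (J (m n) a - a) \<le> C * (grid (m n) t - grid (m n) s) powr \<beta> * norm a"
      using J1[OF m(1)] by simp
  qed
  moreover have "norm (flow s t (x + u) - flow s t x - L u) \<le> C * norm u ^ 2" for u
  proof (rule tendsto_upperbound[OF _ _ sequentially_bot])
    show "(\<lambda>n. norm (approx (m n) s t (x + u) - approx (m n) s t x - J (m n) u)) \<longlonglongrightarrow> norm (flow s t (x + u) - flow s t x - L u)"
      by (intro tendsto_intros L filterlim_compose[OF flow_tendsto m(2)] st)
    show "\<forall>\<^sub>F n in sequentially. norm (approx (m n) s t (x + u) - approx (m n) s t x - J (m n) u) \<le> C * norm u ^ 2"
      using J2[OF m(1)] by simp
  qed
  ultimately show ?thesis
    by blast
qed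

end

end

section \<open>Differentiability of the flow and uniqueness\<close>

text \<open>On a partition into \<open>n\<close> equal parts the error terms sum to order
  \<open>n powr (1 - \<theta>)\<close>, which vanishes in the limit. A local bound with superlinear
  error thus becomes an exact global one.\<close>

lemma telescoping_bound:
  fixes p :: "real \<Rightarrow> 'a::real_normed_vector" and G :: "real \<Rightarrow> real"
  assumes ab: "a \<le> b" and q: "0 < q" and \<theta>: "1 < \<theta>"
    and le: "\<And>s t. a \<le> s \<Longrightarrow> s \<le> t \<Longrightarrow> t \<le> b \<Longrightarrow> t - s \<le> q \<Longrightarrow>
      norm (p t - p s) \<le> G t - G s + c * (t - s) powr \<theta>"
  shows "norm (p b - p a) \<le> G b - G a"
proof (rule tendsto_lowerbound[OF _ _ sequentially_bot])
  have lim: "(\<lambda>n. real n powr (1 - \<theta>)) \<longlonglongrightarrow> 0"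
    using \<theta> by (intro tendsto_neg_powr filterlim_real_sequentially) auto
  show "(\<lambda>n. G b - G a + c * ((b - a) powr \<theta> * real n powr (1 - \<theta>))) \<longlonglongrightarrow> G b - G a"
    using tendsto_add[OF tendsto_const tendsto_mult_right_zero[OF tendsto_mult_right_zero[OF lim]]] by simp
  obtain N :: nat where "max 1 ((b - a) / q) \<le> real N"
    using real_arch_simple by blast
  then have N: "(b - a) / q \<le> real N" "0 < N"
    by auto
  show "\<forall>\<^sub>F n in sequentially. norm (p b - p a) \<le> G b - G a + c * ((b - a) powr \<theta> * real n powr (1 - \<theta>))"
  proof (rule eventually_sequentiallyI[of N])
    fix n
    assume n: "N \<le> n"
    define w where "w = (b - a) / real n"
    define x where "x i = a + real i * w" for i
    have n0: "0 < real n"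
      using n N by simp
    have w: "0 \<le> w" "w \<le> q" "real n * w = b - a"
      using N n ab q n0 order_trans[OF N(1), of "real n"] by (auto simp: w_def field_simps)
    have "norm (p (x k) - p (x 0)) \<le> G (x k) - G (x 0) + real k * (c * w powr \<theta>)" if "k \<le> n" for k
      using that
    proof (induction k)
      case (Suc k)
      have "real (Suc k) * w \<le> real n * w"
        using Suc.prems w by (intro mult_right_mono) auto
      then have "norm (p (x (Suc k)) - p (x k)) \<le> G (x (Suc k)) - G (x k) + c * (x (Suc k) - x k) powr \<theta>"
        using w by (intro le) (auto simp: x_def algebra_simps)
      moreover have "x (Suc k) - x k = w"
        by (simp add: x_def algebra_simps)
      moreover have "norm (p (x (Suc k)) - p (x 0)) \<le> norm (p (x (Suc k)) - p (x k)) + norm (p (x k) - p (x 0))"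
        using norm_triangle_ineq[of "p (x (Suc k)) - p (x k)" "p (x k) - p (x 0)"] by simp
      ultimately show ?case
        using Suc by (simp add: algebra_simps)
    qed simp
    from this[of n] have "norm (p b - p a) \<le> G b - G a + real n * (c * w powr \<theta>)"
      using w by (simp add: x_def)
    also have "real n * (c * w powr \<theta>) = c * ((b - a) powr \<theta> * real n powr (1 - \<theta>))"
      using n0 ab by (simp add: w_def powr_divide powr_diff)
    finally show "norm (p b - p a) \<le> G b - G a + c * ((b - a) powr \<theta> * real n powr (1 - \<theta>))" .
  qed
qed

lemma has_derivative_if_quadratic_remainder:
  assumes "bounded_linear J" "\<And>u. norm (F (x + u) - F x - J u) \<le> L * norm u ^ 2"
  shows "(F has_derivative J) (at x)"
  unfolding has_derivative_at
proof (intro conjI assms)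
  show "(\<lambda>u. norm (F (x + u) - F x - J u) / norm u) \<midarrow>0\<rightarrow> 0"
  proof (rule Lim_null_comparison)
    show "\<forall>\<^sub>F u in at 0. norm (norm (F (x + u) - F x - J u) / norm u) \<le> L * norm u"
      using assms(2) by (intro always_eventually allI) (auto simp: divide_le_eq power2_eq_square mult.assoc)
    show "(\<lambda>u. L * norm u) \<midarrow>0\<rightarrow> 0"
      by (intro tendsto_mult_right_zero tendsto_norm_zero tendsto_ident_at)
  qed
qed

text \<open>Encodes a map of class C^{1,1} with uniformly invertible derivative: the lower bound on
  \<open>J x\<close> stands for a bounded inverse, and the uniform quadratic remainder for a
  Lipschitz derivative.\<close>

definition c11 :: "real \<Rightarrow> ('a::euclidean_space \<Rightarrow> 'a) \<Rightarrow> ('a \<Rightarrow> 'a \<Rightarrow>\<^sub>L 'a) \<Rightarrow> bool" where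
  "c11 L F J \<longleftrightarrow> (\<forall>x a. norm (J x a) \<le> L * norm a \<and> norm a \<le> L * norm (J x a)) \<and>
     (\<forall>x u. norm (F (x + u) - F x - J x u) \<le> L * norm u ^ 2)"

lemma c11D:
  assumes "c11 L F J"
  shows "norm (J x a) \<le> L * norm a" "norm a \<le> L * norm (J x a)"
    "norm (F (x + u) - F x - J x u) \<le> L * norm u ^ 2"
    "(F has_derivative J x) (at x)"
  using assms has_derivative_if_quadratic_remainder[OF blinfun.bounded_linear_right, of F x "J x" L]
  unfolding c11_def by auto

lemma c11_lipschitz:
  assumes "c11 L F J" "0 \<le> L"
  shows "norm (F x - F y) \<le> L * norm (x - y)"
  using c11D(4,1)[OF assms(1)] assms(2) by (rule lipschitz_of_bounded_derivative)

text \<open>The bounds on the derivatives multiply. The remainder collects \<open>L * M^2\<close>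
  from the outer map and \<open>L * M\<close> from transporting the inner remainder;
  \<open>M >= 1\<close> merges the two.\<close>

lemma c11_comp:
  assumes F: "c11 L F J" "1 \<le> L" and G: "c11 M G H" "1 \<le> M"
  shows "c11 (2 * L * M^2) (\<lambda>x. F (G x)) (\<lambda>x. J (G x) o\<^sub>L H x)"
proof -
  have LM: "L * M \<le> L * M^2" "0 \<le> L * M"
    using F(2) G(2) by (auto simp: power2_eq_square)
  have "norm ((J (G x) o\<^sub>L H x) a) \<le> L * M * norm a" for x a
    using order_trans[OF c11D(1)[OF F(1)] mult_left_mono[OF c11D(1)[OF G(1)]]] F(2) by (simp add: mult.assoc)
  moreover have "norm a \<le> L * M * norm ((J (G x) o\<^sub>L H x) a)" for x a
    using order_trans[OF c11D(2)[OF G(1)] mult_left_mono[OF c11D(2)[OF F(1)]]] G(2) by (simp add: ac_simps)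
  moreover have le: "L * M * y \<le> 2 * L * M^2 * y" if "0 \<le> y" for y
    using LM that by (intro mult_right_mono) auto
  moreover have "norm (F (G (x + u)) - F (G x) - (J (G x) o\<^sub>L H x) u) \<le> 2 * L * M^2 * norm u ^ 2" for x u
  proof -
    define w where "w = G (x + u) - G x"
    have w: "norm w \<le> M * norm u"
      using c11_lipschitz[OF G(1), of "x + u" x] G(2) by (simp add: w_def)
    have "F (G (x + u)) - F (G x) - (J (G x) o\<^sub>L H x) u
      = (F (G x + w) - F (G x) - J (G x) w) + J (G x) (w - H x u)"
      by (simp add: w_def blinfun.diff_right)
    also have "norm \<dots> \<le> L * (M * norm u)^2 + L * (M * norm u ^ 2)"
    proof (rule norm_triangle_mono)
      show "norm (F (G x + w) - F (G x) - J (G x) w) \<le> L * (M * norm u)^2"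
        using w F(2) by (intro order_trans[OF c11D(3)[OF F(1)]] mult_left_mono power_mono) auto
      show "norm (J (G x) (w - H x u)) \<le> L * (M * norm u ^ 2)"
        unfolding w_def using F(2)
        by (intro order_trans[OF c11D(1)[OF F(1)]] mult_left_mono c11D(3)[OF G(1)]) auto
    qed
    also have "\<dots> = (L * M^2 + L * M) * norm u ^ 2"
      by (simp add: algebra_simps power_mult_distrib)
    also have "\<dots> \<le> (2 * L * M^2) * norm u ^ 2"
      using LM by (intro mult_right_mono) auto
    finally show ?thesis .
  qed
  ultimately show ?thesis
    unfolding c11_def by (meson norm_ge_zero order_trans)
qed

text \<open>The converse of Taylor's theorem: compare the three expansions between
  \<open>x\<close>, \<open>y\<close> and \<open>x + h\<close> with \<open>norm h = norm (x - y)\<close>.\<close>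

lemma c11_derivative_lipschitz:
  assumes c: "c11 L F J" and L: "0 \<le> L"
  shows "norm (J x a - J y a) \<le> 6 * L * norm (x - y) * norm a"
proof (cases "a = 0 \<or> x = y")
  case False
  define r where "r = norm (x - y)"
  define u where "u = (r / norm a) *\<^sub>R a"
  have r: "0 < r" and u: "norm u = r"
    using False by (auto simp: r_def u_def)
  have "J x u - J y u = (F (y + (x - y + u)) - F y - J y (x - y + u))
    - (F (y + (x - y)) - F y - J y (x - y)) - (F (x + u) - F x - J x u)"
    by (simp add: blinfun.add_right)
  also have "norm \<dots> \<le> L * (r + r)^2 + L * r^2 + L * r^2"
  proof -
    have "norm (F (y + (x - y + u)) - F y - J y (x - y + u)) \<le> L * (r + r)^2"
      using L u by (intro order_trans[OF c11D(3)[OF c]] mult_left_mono power_mono)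
        (auto simp: r_def intro: order_trans[OF norm_triangle_ineq])
    moreover have "norm (F (y + (x - y)) - F y - J y (x - y)) \<le> L * r^2" "norm (F (x + u) - F x - J x u) \<le> L * r^2"
      using c11D(3)[OF c, of y "x - y"] c11D(3)[OF c, of x u] u by (auto simp: r_def)
    ultimately show ?thesis
      by (intro order_trans[OF norm_triangle_ineq4 add_mono] order_trans[OF norm_triangle_ineq4 add_mono])
  qed
  also have "\<dots> = 6 * L * r * r"
    by (simp add: power2_eq_square algebra_simps)
  finally have "(r / norm a) * norm (J x a - J y a) \<le> 6 * L * r * r"
    using r by (simp add: u_def blinfun.scaleR_right flip: scaleR_diff_right)
  then show ?thesis
    using r False by (simp add: field_simps r_def)
qed auto

context euler_flow
begin

text \<open>On short intervals the derivative differs from the identity by at most 1/2 in norm,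
  which gives upper and lower bounds at once.\<close>

lemma flow_c11_short:
  assumes st: "0 \<le> s" "s \<le> t" "t \<le> T" "t - s \<le> h / 2"
  shows "\<exists>J. c11 (2 * C) (flow s t) J \<and> (\<forall>x a. norm (J x a - a) \<le> C * (t - s) powr \<beta> * norm a)"
proof -
  obtain J where J: "\<And>x a. norm (blinfun_apply (J x) a - a) \<le> C * (t - s) powr \<beta> * norm a"
    "\<And>x u. norm (flow s t (x + u) - flow s t x - J x u) \<le> C * norm u ^ 2"
    using flow_derivative[OF st] by metis
  have "C * (t - s) powr \<beta> \<le> C * h powr \<beta>"
    using st h C \<beta> by (intro mult_left_mono powr_mono2) auto
  then have "C * (t - s) powr \<beta> * norm a \<le> 1/2 * norm a" for a :: 'a
    using Ch by (intro mult_right_mono) auto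
  then have half: "norm (J x a - a) \<le> 1/2 * norm a" for x a
    using J(1) order_trans by blast
  have "norm (J x a) \<le> 2 * norm a" "norm a \<le> 2 * norm (J x a)" for x a
    using half[of x a] norm_triangle_sub[of "J x a" a] norm_triangle_sub[of a "J x a"]
    by (auto simp: norm_minus_commute)
  moreover have "2 * y \<le> 2 * C * y" if "0 \<le> y" for y
    using C that by (simp add: mult_left_le_one_le mult_le_cancel_right1)
  moreover have "C * y \<le> 2 * C * y" if "0 \<le> y" for y
    using C that by simp
  ultimately have "c11 (2 * C) (flow s t) J"
    unfolding c11_def using J(2) by (meson norm_ge_zero order_trans zero_le_power2)
  then show ?thesis
    using J(1) by blast
qed

text \<open>Longer intervals are reached by splitting off a last piece of length at most
  \<open>h / 2\<close> and composing.\<close>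

lemma flow_c11_pow:
  "\<exists>L\<ge>1. \<forall>s t. 0 \<le> s \<and> s \<le> t \<and> t \<le> T \<and> t - s \<le> real p * (h / 2) \<longrightarrow> (\<exists>J. c11 L (flow s t) J)"
proof (induction p)
  case 0
  have "\<exists>J. c11 (2 * C) (flow s t) J" if "0 \<le> s" "s \<le> t" "t \<le> T" "t - s \<le> real 0 * (h / 2)" for s t
    using flow_c11_short[of s t] that h by auto
  then show ?case
    using C by (intro exI[of _ "2 * C"]) auto
next
  case (Suc p)
  then obtain L where L: "1 \<le> L"
    "\<And>s t. 0 \<le> s \<Longrightarrow> s \<le> t \<Longrightarrow> t \<le> T \<Longrightarrow> t - s \<le> real p * (h / 2) \<Longrightarrow> \<exists>J. c11 L (flow s t) J"
    by blast
  define N where "N = 2 * (2 * C) * L^2"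
  have N: "1 \<le> N"
  proof -
    have "1 * 1 \<le> (2 * (2 * C)) * L^2"
      using C L(1) by (intro mult_mono) (auto simp: one_le_power)
    then show ?thesis
      by (simp add: N_def)
  qed
  have "\<exists>J. c11 N (flow s t) J" if st: "0 \<le> s" "s \<le> t" "t \<le> T" "t - s \<le> real (Suc p) * (h / 2)" for s t
  proof -
    define u where "u = max s (t - h / 2)"
    have u: "s \<le> u" "u \<le> t" "t - u \<le> h / 2" "u - s \<le> real p * (h / 2)"
      using st h by (auto simp: u_def algebra_simps max_def)
    obtain J where J: "c11 (2 * C) (flow u t) J"
      using flow_c11_short[of u t] u st by auto
    obtain H where H: "c11 L (flow s u) H"
      using L(2)[of s u] u st by auto
    have "c11 N (\<lambda>x. flow u t (flow s u x)) (\<lambda>x. J (flow s u x) o\<^sub>L H x)"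
      unfolding N_def using C L(1) by (intro c11_comp J H) auto
    then show ?thesis
      using flow_comp[OF st(1) u(1,2) st(3)] by auto
  qed
  then show ?case
    using N by blast
qed

definition Dflow :: "real \<Rightarrow> real \<Rightarrow> 'a \<Rightarrow> 'a \<Rightarrow>\<^sub>L 'a" where
  "Dflow s t x = Blinfun (frechet_derivative (flow s t) (at x))"

lemma Dflow_eq:
  assumes "c11 L (flow s t) J"
  shows "Dflow s t = J"
proof
  fix x
  have "frechet_derivative (flow s t) (at x) = J x"
    using c11D(4)[OF assms] by (rule frechet_derivative_at[symmetric])
  then show "Dflow s t x = J x"
    by (simp add: Dflow_def blinfun_apply_inverse)
qed

lemma flow_c11: "\<exists>L\<ge>1. \<forall>s t. 0 \<le> s \<and> s \<le> t \<and> t \<le> T \<longrightarrow> c11 L (flow s t) (Dflow s t)"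
proof -
  define p where "p = nat \<lceil>T / (h / 2)\<rceil>"
  have "T / (h / 2) * (h / 2) \<le> real p * (h / 2)"
    unfolding p_def using h by (intro mult_right_mono) (auto simp: of_nat_ceiling)
  then have T_le: "T \<le> real p * (h / 2)"
    using h by simp
  obtain L where L: "1 \<le> L"
    "\<And>s t. 0 \<le> s \<Longrightarrow> s \<le> t \<Longrightarrow> t \<le> T \<Longrightarrow> t - s \<le> real p * (h / 2) \<Longrightarrow> \<exists>J. c11 L (flow s t) J"
    using flow_c11_pow[of p] by blast
  have "c11 L (flow s t) (Dflow s t)" if st: "0 \<le> s" "s \<le> t" "t \<le> T" for s t
    using L(2)[OF st] T_le st Dflow_eq by fastforce
  then show ?thesis
    using L(1) by blast
qed

lemma Dflow_near_identity:
  assumes st: "0 \<le> s" "s \<le> t" "t \<le> T" "t - s \<le> h / 2"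
  shows "norm (Dflow s t x a - a) \<le> C * (t - s) powr \<beta> * norm a"
  using flow_c11_short[OF st] Dflow_eq by metis

lemma Dflow_comp:
  assumes "0 \<le> s" "s \<le> u" "u \<le> t" "t \<le> T"
  shows "Dflow s t x = Dflow u t (flow s u x) o\<^sub>L Dflow s u x"
proof -
  obtain L where L: "1 \<le> L" "c11 L (flow u t) (Dflow u t)" "c11 L (flow s u) (Dflow s u)"
    using flow_c11 assms by (meson order_trans)
  have "c11 (2 * L * L^2) (\<lambda>x. flow u t (flow s u x)) (\<lambda>x. Dflow u t (flow s u x) o\<^sub>L Dflow s u x)"
    using L by (intro c11_comp) auto
  then show ?thesis
    using Dflow_eq flow_comp[OF assms] by (simp add: fun_eq_iff)
qed

section \<open>Davie solutions and their uniqueness\<close>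

definition davie :: "('a \<Rightarrow> 'a) \<Rightarrow> (real \<Rightarrow> 'a) \<Rightarrow> bool" where
  "davie b V \<longleftrightarrow> (\<exists>c \<delta>. 0 < \<delta> \<and> (\<forall>s t. 0 \<le> s \<and> s \<le> t \<and> t \<le> T \<and> t - s \<le> \<delta> \<longrightarrow>
     norm (V t - V s - Inc v D s t (V s) - (t - s) *\<^sub>R b (V s)) \<le> c * (t - s) powr (3 * \<beta>)))"

text \<open>The solution and the driftless flow share the one-step map, so it cancels: relative to
  the flow a solution moves only by the drift, up to order \<open>3 * \<beta>\<close>.\<close>

lemma davie_flow_step:
  assumes "davie b V"
  obtains c \<delta> where "0 \<le> c" "0 < \<delta>" "\<delta> \<le> h / 2"
    "\<And>s t. 0 \<le> s \<Longrightarrow> s \<le> t \<Longrightarrow> t \<le> T \<Longrightarrow> t - s \<le> \<delta> \<Longrightarrow>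
      norm (V t - flow s t (V s) - (t - s) *\<^sub>R b (V s)) \<le> c * (t - s) powr (3 * \<beta>)"
proof -
  obtain c \<delta> where \<delta>: "0 < \<delta>" and V: "\<And>s t. 0 \<le> s \<Longrightarrow> s \<le> t \<Longrightarrow> t \<le> T \<Longrightarrow> t - s \<le> \<delta> \<Longrightarrow>
     norm (V t - V s - Inc v D s t (V s) - (t - s) *\<^sub>R b (V s)) \<le> c * (t - s) powr (3 * \<beta>)"
    using assms unfolding davie_def by blast
  show ?thesis
  proof (rule that[of "\<bar>c\<bar> + C" "min \<delta> (h / 2)"])
    fix s t :: real
    assume st: "0 \<le> s" "s \<le> t" "t \<le> T" "t - s \<le> min \<delta> (h / 2)"
    have "norm ((V t - V s - Inc v D s t (V s) - (t - s) *\<^sub>R b (V s)) - (flow s t (V s) - V s - Inc v D s t (V s)))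
      \<le> c * (t - s) powr (3 * \<beta>) + C * (t - s) powr (3 * \<beta>)"
      using st by (intro order_trans[OF norm_triangle_ineq4 add_mono] V flow_expansion) auto
    also have "\<dots> \<le> (\<bar>c\<bar> + C) * (t - s) powr (3 * \<beta>)"
      by (simp add: algebra_simps mult_right_mono)
    finally show "norm (V t - flow s t (V s) - (t - s) *\<^sub>R b (V s)) \<le> (\<bar>c\<bar> + C) * (t - s) powr (3 * \<beta>)"
      by (simp add: algebra_simps)
  qed (use \<delta> h C in auto)
qed

text \<open>Two solutions \<open>V\<close>, \<open>V'\<close> are compared at time \<open>\<tau>\<close> by transporting them with the driftless flow:
  the difference \<open>p t\<close> of the images of \<open>V t\<close> and \<open>V' t\<close> under the flow from \<open>t\<close> to \<open>\<tau>\<close> only changes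
  through the drift, so that a Gronwall argument (here a maximum of the weighted difference)
  applies although the equation is driven by a rough signal.\<close>

theorem davie_unique:
  assumes V: "davie b V" "continuous_on {0..T} V" and V': "davie b V'" "continuous_on {0..T} V'"
    and b: "\<And>x y. norm (b x - b y) \<le> Lb * norm (x - y)" "0 \<le> Lb" and init: "V 0 = V' 0"
    and t: "t \<in> {0..T}"
  shows "V t = V' t"
proof -
  obtain L where L: "1 \<le> L" and c11: "\<And>s t. 0 \<le> s \<Longrightarrow> s \<le> t \<Longrightarrow> t \<le> T \<Longrightarrow> c11 L (flow s t) (Dflow s t)"
    using flow_c11 by blast
  obtain c1 \<delta>1 where c1: "0 \<le> c1" "0 < \<delta>1" "\<delta>1 \<le> h / 2"
    "\<And>s t. 0 \<le> s \<Longrightarrow> s \<le> t \<Longrightarrow> t \<le> T \<Longrightarrow> t - s \<le> \<delta>1 \<Longrightarrow>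
      norm (V t - flow s t (V s) - (t - s) *\<^sub>R b (V s)) \<le> c1 * (t - s) powr (3 * \<beta>)"
    using davie_flow_step[OF V(1)] by metis
  obtain c2 \<delta>2 where c2: "0 \<le> c2" "0 < \<delta>2" "\<delta>2 \<le> h / 2"
    "\<And>s t. 0 \<le> s \<Longrightarrow> s \<le> t \<Longrightarrow> t \<le> T \<Longrightarrow> t - s \<le> \<delta>2 \<Longrightarrow>
      norm (V' t - flow s t (V' s) - (t - s) *\<^sub>R b (V' s)) \<le> c2 * (t - s) powr (3 * \<beta>)"
    using davie_flow_step[OF V'(1)] by metis
  have cont_b: "continuous_on UNIV b"
    using b by (intro lipschitz_on_continuous_on[of Lb] lipschitz_onI) (auto simp: dist_norm)
  have bdd: "\<exists>M. \<forall>s\<in>{0..T}. norm (b (W s)) \<le> M" if "continuous_on {0..T} W" for W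
  proof -
    have "continuous_on {0..T} (\<lambda>s. b (W s))"
      using continuous_on_compose2[OF cont_b that] by auto
    then have "bounded ((\<lambda>s. b (W s)) ` {0..T})"
      by (intro compact_imp_bounded compact_continuous_image) auto
    then show ?thesis
      by (auto simp: bounded_iff)
  qed
  obtain M1 where M1: "\<And>s. s \<in> {0..T} \<Longrightarrow> norm (b (V s)) \<le> M1"
    using bdd[OF V(2)] by blast
  obtain M2 where M2: "\<And>s. s \<in> {0..T} \<Longrightarrow> norm (b (V' s)) \<le> M2"
    using bdd[OF V'(2)] by blast
  define \<delta> where "\<delta> = min \<delta>1 \<delta>2"
  define c where "c = max c1 c2"
  define M where "M = max 0 (max M1 M2)"
  define N where "N = M + c"
  \<comment> \<open>\<open>A\<close> collects what is proportional to \<open>E s * (t - s)\<close>: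
    the difference of the drifts and the variation of the flow derivative. \<open>A'\<close>
    collects the terms of order \<open>3 * \<beta>\<close>.\<close>
  define A where "A = L * Lb + 6 * L * L * N + 1"
  define A' where "A' = 2 * (L * N^2) + 2 * (L * c)"
  define E where "E s = norm (V s - V' s)" for s
  have \<delta>: "0 < \<delta>" "\<delta> \<le> h / 2" and c: "0 \<le> c" and M: "0 \<le> M"
    using c1 c2 by (auto simp: \<delta>_def c_def M_def)
  have N: "0 \<le> N"
    using c M by (simp add: N_def)
  have A: "1 \<le> A"
    using L b(2) N by (simp add: A_def)
  have E0: "0 \<le> E s" for s
    by (simp add: E_def)
  have step: "norm ((flow t \<tau> (V t) - flow t \<tau> (V' t)) - (flow s \<tau> (V s) - flow s \<tau> (V' s)))
      \<le> A * E s * (t - s) + A' * (t - s) powr (3 * \<beta>)"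
    if st: "0 \<le> s" "s \<le> t" "t \<le> \<tau>" "\<tau> \<le> T" "t - s \<le> \<delta>" for s t \<tau>
  proof -
    define d where "d = t - s"
    define d\<theta> where "d\<theta> = d powr (3 * \<beta>)"
    have d: "0 \<le> d" "d \<le> 1"
      using st \<delta> h by (auto simp: d_def)
    have d\<theta>: "0 \<le> d\<theta>" "d\<theta> \<le> d" "d^2 \<le> d\<theta>"
    proof -
      show "0 \<le> d\<theta>"
        by (simp add: d\<theta>_def)
      show "d\<theta> \<le> d"
        using d \<beta> powr_mono'[of 1 "3 * \<beta>" d] by (simp add: d\<theta>_def)
      have "d^2 = d powr 2"
        using d by (cases "d = 0") auto
      also have "\<dots> \<le> d\<theta>"
        unfolding d\<theta>_def using d \<beta> by (intro powr_mono') auto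
      finally show "d^2 \<le> d\<theta>" .
    qed
    have T: "t \<le> T" "s \<in> {0..T}" "0 \<le> t"
      using st by auto
    define x x' w w' where "x = flow s t (V s)" and "x' = flow s t (V' s)" and "w = V t - x" and "w' = V' t - x'"
    note F = c11[OF T(3) st(3,4)]
    have cd: "c1 * d\<theta> \<le> c * d\<theta>" "c2 * d\<theta> \<le> c * d\<theta>"
      using d\<theta>(1) by (auto simp: c_def intro: mult_right_mono)
    have w_b: "norm (w - d *\<^sub>R b (V s)) \<le> c * d\<theta>"
      using c1(4)[OF st(1,2) T(1)] cd st by (simp add: w_def x_def d_def[symmetric] d\<theta>_def[symmetric] \<delta>_def)
    have w'_b: "norm (w' - d *\<^sub>R b (V' s)) \<le> c * d\<theta>"
      using c2(4)[OF st(1,2) T(1)] cd st by (simp add: w'_def x'_def d_def[symmetric] d\<theta>_def[symmetric] \<delta>_def)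
    have lin: "norm z \<le> N * d" if "norm (z - d *\<^sub>R y) \<le> c * d\<theta>" "norm y \<le> M" for y z :: 'a
    proof -
      have "norm z \<le> d * norm y + c * d\<theta>"
        using norm_triangle_sub[of z "d *\<^sub>R y"] that d by simp
      also have "\<dots> \<le> d * M + c * d"
        using that d d\<theta> c by (intro add_mono mult_left_mono) auto
      finally show ?thesis
        by (simp add: N_def algebra_simps)
    qed
    have w: "norm w \<le> N * d" and w': "norm w' \<le> N * d"
      using M1[OF T(2)] M2[OF T(2)] by (intro lin[OF w_b] lin[OF w'_b]; simp add: M_def)+
    have quad: "norm (flow t \<tau> (y + z) - flow t \<tau> y - Dflow t \<tau> y z) \<le> L * N^2 * d\<theta>" if "norm z \<le> N * d" for y z
    proof -
      have "norm z ^ 2 \<le> N^2 * d^2"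
        using power_mono[OF that, of 2] by (simp add: power_mult_distrib)
      also have "\<dots> \<le> N^2 * d\<theta>"
        using d\<theta> by (intro mult_left_mono) auto
      finally have "L * norm z ^ 2 \<le> L * (N^2 * d\<theta>)"
        using L by (intro mult_left_mono) auto
      then show ?thesis
        using c11D(3)[OF F, of y z] by (simp add: mult.assoc)
    qed
    have ww': "norm (w - w') \<le> d * (Lb * E s) + 2 * (c * d\<theta>)"
    proof -
      have "w - w' = (w - d *\<^sub>R b (V s)) - (w' - d *\<^sub>R b (V' s)) + d *\<^sub>R (b (V s) - b (V' s))"
        by (simp add: scaleR_diff_right)
      also have "norm \<dots> \<le> (c * d\<theta> + c * d\<theta>) + d * (Lb * E s)"
        using d b(1)[of "V s" "V' s"]
        by (intro norm_triangle_mono order_trans[OF norm_triangle_ineq4 add_mono[OF w_b w'_b]])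
          (auto simp: E_def intro: mult_left_mono)
      finally show ?thesis
        by simp
    qed
    have xx': "norm (x - x') \<le> L * E s"
      unfolding x_def x'_def E_def using L st by (intro c11_lipschitz[OF c11]) auto
    have comp: "flow s \<tau> y = flow t \<tau> (flow s t y)" for y
      using flow_comp[OF st(1-4)] by simp
    \<comment> \<open>Expand around the driftless evolutions \<open>x\<close> and \<open>x'\<close>,
      with displacements \<open>w\<close> and \<open>w'\<close> of order \<open>t - s\<close>. The
      two Taylor remainders are quadratic in these; the other terms are proportional to
      \<open>E s * (t - s)\<close> up to order \<open>3 * \<beta>\<close>.\<close>
    have "(flow t \<tau> (V t) - flow t \<tau> (V' t)) - (flow s \<tau> (V s) - flow s \<tau> (V' s))
      = (flow t \<tau> (x + w) - flow t \<tau> x - Dflow t \<tau> x w) - (flow t \<tau> (x' + w') - flow t \<tau> x' - Dflow t \<tau> x' w')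
        + Dflow t \<tau> x (w - w') + (Dflow t \<tau> x w' - Dflow t \<tau> x' w')"
      unfolding comp by (simp add: w_def w'_def x_def x'_def blinfun.diff_right)
    also have "norm \<dots> \<le> (L * N^2 * d\<theta> + L * N^2 * d\<theta>) + L * (d * (Lb * E s) + 2 * (c * d\<theta>)) + 6 * L * (L * E s) * (N * d)"
    proof (intro norm_triangle_mono)
      show "norm ((flow t \<tau> (x + w) - flow t \<tau> x - Dflow t \<tau> x w) - (flow t \<tau> (x' + w') - flow t \<tau> x' - Dflow t \<tau> x' w'))
        \<le> L * N^2 * d\<theta> + L * N^2 * d\<theta>"
        by (rule order_trans[OF norm_triangle_ineq4 add_mono[OF quad[OF w] quad[OF w']]])
      show "norm (Dflow t \<tau> x (w - w')) \<le> L * (d * (Lb * E s) + 2 * (c * d\<theta>))"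
        using L by (intro order_trans[OF c11D(1)[OF F]] mult_left_mono ww') auto
      show "norm (Dflow t \<tau> x w' - Dflow t \<tau> x' w') \<le> 6 * L * (L * E s) * (N * d)"
        using L E0[of s] by (intro order_trans[OF c11_derivative_lipschitz[OF F]] mult_mono xx' w') auto
    qed
    also have "\<dots> = (A - 1) * E s * d + A' * d\<theta>"
      by (simp add: A_def A'_def algebra_simps)
    also have "\<dots> \<le> A * E s * d + A' * d\<theta>"
      using E0[of s] d by (intro add_right_mono mult_right_mono) auto
    finally show ?thesis
      by (simp add: d_def d\<theta>_def)
  qed
  \<comment> \<open>With twice the growth rate as weight, the maximum \<open>m\<close> of the
    weighted difference satisfies \<open>m <= m / 2\<close>.\<close>
  define \<mu> where "\<mu> = 2 * A"
  have \<mu>: "0 < \<mu>"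
    using A by (simp add: \<mu>_def)
  have cont: "continuous_on {0..T} (\<lambda>s. E s * exp (- \<mu> * s))"
    unfolding E_def by (intro continuous_intros V V')
  have "{0..T} \<noteq> {}"
    using T by simp
  then obtain \<tau> where \<tau>: "\<tau> \<in> {0..T}" and max: "\<And>s. s \<in> {0..T} \<Longrightarrow> E s * exp (- \<mu> * s) \<le> E \<tau> * exp (- \<mu> * \<tau>)"
    using continuous_attains_sup[OF compact_Icc _ cont] by blast
  define m where "m = E \<tau> * exp (- \<mu> * \<tau>)"
  have Em: "E s \<le> m * exp (\<mu> * s)" if "s \<in> {0..T}" for s
  proof -
    have "E s = E s * exp (- \<mu> * s) * exp (\<mu> * s)"
      by (simp add: exp_minus)
    also have "\<dots> \<le> m * exp (\<mu> * s)"
      unfolding m_def by (rule mult_right_mono[OF max[OF that]]) simp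
    finally show ?thesis .
  qed
  have m0: "0 \<le> m"
    using E0 by (simp add: m_def)
  have fin: "norm ((flow \<tau> \<tau> (V \<tau>) - flow \<tau> \<tau> (V' \<tau>)) - (flow 0 \<tau> (V 0) - flow 0 \<tau> (V' 0)))
    \<le> A * m / \<mu> * exp (\<mu> * \<tau>) - A * m / \<mu> * exp (\<mu> * 0)"
  proof (rule telescoping_bound[where p = "\<lambda>t. flow t \<tau> (V t) - flow t \<tau> (V' t)" and q = \<delta> and \<theta> = "3 * \<beta>"])
    fix s t
    assume st: "0 \<le> s" "s \<le> t" "t \<le> \<tau>" "t - s \<le> \<delta>"
    have "A * E s * (t - s) \<le> A * (m * exp (\<mu> * s)) * (t - s)"
      using st \<tau> A Em[of s] by (intro mult_right_mono mult_left_mono) auto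
    also have "\<dots> = A * m / \<mu> * (exp (\<mu> * s) * (\<mu> * (t - s)))"
      using \<mu> by simp
    also have "\<dots> \<le> A * m / \<mu> * (exp (\<mu> * t) - exp (\<mu> * s))"
    proof (rule mult_left_mono)
      have "exp (\<mu> * s) * (1 + \<mu> * (t - s)) \<le> exp (\<mu> * s) * exp (\<mu> * (t - s))"
        by (intro mult_left_mono exp_ge_add_one_self) auto
      also have "\<dots> = exp (\<mu> * t)"
        by (simp add: algebra_simps flip: exp_add)
      finally show "exp (\<mu> * s) * (\<mu> * (t - s)) \<le> exp (\<mu> * t) - exp (\<mu> * s)"
        by (simp add: algebra_simps)
      show "0 \<le> A * m / \<mu>"
        using A m0 \<mu> by simp
    qed
    finally show "norm ((flow t \<tau> (V t) - flow t \<tau> (V' t)) - (flow s \<tau> (V s) - flow s \<tau> (V' s)))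
      \<le> A * m / \<mu> * exp (\<mu> * t) - A * m / \<mu> * exp (\<mu> * s) + A' * (t - s) powr (3 * \<beta>)"
      using step[of s t \<tau>] st \<tau> by (simp add: right_diff_distrib)
  qed (use \<tau> \<delta> \<beta> in auto)
  have "E \<tau> \<le> A * m / \<mu> * exp (\<mu> * \<tau>)"
  proof -
    have "0 \<le> A * m / \<mu>"
      using A m0 \<mu> by simp
    moreover have "flow \<tau> \<tau> y = y" for y
      using \<tau> by (simp add: flow_self)
    ultimately show ?thesis
      using fin init by (simp add: E_def)
  qed
  also have "A * m / \<mu> = m / 2"
    using A by (simp add: \<mu>_def)
  finally have "E \<tau> \<le> m / 2 * exp (\<mu> * \<tau>)" .
  moreover have "E \<tau> = m * exp (\<mu> * \<tau>)"
    by (simp add: m_def exp_minus)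
  ultimately have "m * exp (\<mu> * \<tau>) \<le> m / 2 * exp (\<mu> * \<tau>)"
    by simp
  then have "m \<le> 0"
    unfolding mult_le_cancel_right by simp
  then have "E t \<le> 0"
    using Em[OF t] m0 by simp
  then show ?thesis
    by (simp add: E_def)
qed

end

section \<open>Equivalence with the formulation by rough integrals\<close>

lemma holder2D:
  assumes "holder2 T \<gamma> g"
  obtains c where "0 \<le> c" "\<And>s t. 0 \<le> s \<Longrightarrow> s < t \<Longrightarrow> t \<le> T \<Longrightarrow> norm (g s t) \<le> c * (t - s) powr \<gamma>"
proof -
  obtain c where c: "\<And>s t. 0 \<le> s \<Longrightarrow> s < t \<Longrightarrow> t \<le> T \<Longrightarrow> norm (g s t) / (t - s) powr \<gamma> \<le> c"
    using assms unfolding holder2_def by blast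
  show ?thesis
  proof (rule that[of "\<bar>c\<bar>"])
    fix s t :: real
    assume st: "0 \<le> s" "s < t" "t \<le> T"
    have "norm (g s t) \<le> c * (t - s) powr \<gamma>"
      using c[OF st] st by (simp add: pos_divide_le_eq)
    also have "\<dots> \<le> \<bar>c\<bar> * (t - s) powr \<gamma>"
      by (intro mult_right_mono) auto
    finally show "norm (g s t) \<le> \<bar>c\<bar> * (t - s) powr \<gamma>" .
  qed simp
qed

text \<open>Local estimates suffice: for times further apart than \<open>\<delta>\<close> the
  quotient is bounded by \<open>M / \<delta> powr \<gamma>\<close>.\<close>

lemma holder2_local:
  assumes \<delta>: "0 < \<delta>" and \<gamma>: "0 \<le> \<gamma>"
    and local: "\<And>s t. 0 \<le> s \<Longrightarrow> s < t \<Longrightarrow> t \<le> T \<Longrightarrow> t - s \<le> \<delta> \<Longrightarrow> norm (g s t) \<le> c * (t - s) powr \<gamma>"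
    and bound: "\<And>s t. 0 \<le> s \<Longrightarrow> s < t \<Longrightarrow> t \<le> T \<Longrightarrow> norm (g s t) \<le> M"
  shows "holder2 T \<gamma> g"
  unfolding holder2_def
proof (intro exI allI impI)
  fix s t :: real
  assume "0 \<le> s \<and> s < t \<and> t \<le> T"
  then have st: "0 \<le> s" "s < t" "t \<le> T"
    by auto
  show "norm (g s t) / (t - s) powr \<gamma> \<le> max c (M / \<delta> powr \<gamma>)"
  proof (cases "t - s \<le> \<delta>")
    case True
    then have "norm (g s t) / (t - s) powr \<gamma> \<le> c"
      using local[OF st] st by (simp add: pos_divide_le_eq)
    then show ?thesis
      by simp
  next
    case False
    have "0 \<le> M"
      using bound[OF st] norm_ge_zero order_trans by blast
    moreover have "\<delta> powr \<gamma> \<le> (t - s) powr \<gamma>"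
      using False \<delta> \<gamma> by (intro powr_mono2) auto
    ultimately have "norm (g s t) / (t - s) powr \<gamma> \<le> M / \<delta> powr \<gamma>"
      using bound[OF st] \<delta> by (intro frac_le) auto
    then show ?thesis
      by simp
  qed
qed

lemma locally_holder_continuous_on:
  assumes \<delta>: "0 < \<delta>" and \<gamma>: "0 < \<gamma>"
    and le: "\<And>s t. 0 \<le> s \<Longrightarrow> s \<le> t \<Longrightarrow> t \<le> T \<Longrightarrow> t - s \<le> \<delta> \<Longrightarrow> norm (f t - f s) \<le> c * (t - s) powr \<gamma>"
  shows "continuous_on {0..T} f"
proof -
  have le': "norm (f y - f x) \<le> c * \<bar>y - x\<bar> powr \<gamma>" if "x \<in> {0..T}" "y \<in> {0..T}" "\<bar>y - x\<bar> \<le> \<delta>" for x y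
    using le[of x y] le[of y x] that by (cases "x \<le> y") (auto simp: norm_minus_commute abs_minus_commute)
  show ?thesis
    unfolding continuous_on_def
  proof
    fix x
    assume x: "x \<in> {0..T}"
    have lim: "((\<lambda>y. \<bar>y - x\<bar>) \<longlongrightarrow> 0) (at x within {0..T})"
      using tendsto_rabs_zero[OF LIM_zero[OF tendsto_ident_at]] .
    then have "((\<lambda>y. \<bar>y - x\<bar> powr \<gamma>) \<longlongrightarrow> 0 powr \<gamma>) (at x within {0..T})"
      using \<gamma> by (intro tendsto_powr2) auto
    then have "((\<lambda>y. c * \<bar>y - x\<bar> powr \<gamma>) \<longlongrightarrow> 0) (at x within {0..T})"
      by (intro tendsto_mult_right_zero) simp
    moreover have "\<forall>\<^sub>F y in at x within {0..T}. norm (f y - f x) \<le> c * \<bar>y - x\<bar> powr \<gamma>"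
    proof -
      have "\<forall>\<^sub>F y in at x within {0..T}. \<bar>y - x\<bar> < \<delta>"
        using order_tendstoD(2)[OF lim \<delta>] .
      moreover have "\<forall>\<^sub>F y in at x within {0..T}. y \<in> {0..T}"
        by (simp add: eventually_at_filter)
      ultimately show ?thesis
        by eventually_elim (use le' x in auto)
    qed
    ultimately have "((\<lambda>y. f y - f x) \<longlongrightarrow> 0) (at x within {0..T})"
      by (rule Lim_null_comparison[rotated])
    then show "(f \<longlongrightarrow> f x) (at x within {0..T})"
      by (simp add: LIM_zero_iff)
  qed
qed

lemma holder_continuous_on:
  assumes "holder T \<gamma> f" "0 < \<gamma>"
  shows "continuous_on {0..T} f"
proof -
  obtain c where c: "0 \<le> c" "\<And>s t. 0 \<le> s \<Longrightarrow> s < t \<Longrightarrow> t \<le> T \<Longrightarrow> norm (increment f s t) \<le> c * (t - s) powr \<gamma>"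
    using holder2D[OF assms(1)[unfolded holder_def]] by blast
  show ?thesis
  proof (rule locally_holder_continuous_on[OF zero_less_one assms(2)])
    show "norm (f t - f s) \<le> c * (t - s) powr \<gamma>" if "0 \<le> s" "s \<le> t" "t \<le> T" for s t
      using c(2)[of s t] that by (cases "s = t") (auto simp: increment_def)
  qed
qed

section \<open>Tensor coordinates and sewing\<close>

lemma blinfun_axis_expansion:
  fixes F :: "(real^'d) \<Rightarrow>\<^sub>L 'b::real_normed_vector"
  shows "F x = (\<Sum>i\<in>UNIV. x $ i *\<^sub>R F (axis i 1))"
proof -
  have "F x = F (\<Sum>i\<in>UNIV. x $ i *\<^sub>R axis i 1)"
    using basis_expansion[of x] by (simp add: scalar_mult_eq_scaleR)
  then show ?thesis
    by (simp add: blinfun.sum_right blinfun.scaleR_right)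
qed

lemma norm_blinfun_axis_le:
  fixes F :: "(real^'d) \<Rightarrow>\<^sub>L 'b::real_normed_vector"
  assumes "\<And>i. norm (F (axis i 1)) \<le> m"
  shows "norm F \<le> real CARD('d) * m"
proof (rule norm_blinfun_bound)
  show m: "0 \<le> real CARD('d) * m"
    using order_trans[OF norm_ge_zero assms] by simp
  fix x :: "real^'d"
  have "norm (F x) \<le> real CARD('d) * (norm x * m)"
    unfolding blinfun_axis_expansion[of F x] using assms by (intro norm_sum_scaleR_le component_le_norm_cart)
  then show "norm (F x) \<le> real CARD('d) * m * norm x"
    by (simp add: ac_simps)
qed

lemma norm_tensor_apply_le:
  fixes F :: "(real^'d) \<Rightarrow>\<^sub>L ((real^'d) \<Rightarrow>\<^sub>L 'b::real_normed_vector)"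
  assumes "\<And>i j. \<bar>A $ i $ j\<bar> \<le> k"
  shows "norm (tensor_apply F A) \<le> real CARD('d)^2 * (k * norm F)"
  unfolding tensor_apply_def
proof (rule norm_double_sum_scaleR_le[OF assms])
  fix i j :: 'd
  have "norm (F (axis i 1) (axis j 1)) \<le> norm (F (axis i 1)) * norm (axis j (1::real))"
    by (rule norm_blinfun)
  also have "\<dots> \<le> norm F * norm (axis i (1::real))"
    using norm_blinfun[of F "axis i 1"] by simp
  finally show "norm (F (axis i 1) (axis j 1)) \<le> norm F"
    by simp
qed

lemma tensor_apply_simps:
  fixes F G :: "(real^'d) \<Rightarrow>\<^sub>L ((real^'d) \<Rightarrow>\<^sub>L 'b::real_normed_vector)"
  shows "tensor_apply F (A + A') = tensor_apply F A + tensor_apply F A'"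
    and "tensor_apply (F - G) A = tensor_apply F A - tensor_apply G A"
    and "tensor_apply F (outer x y) = F x y"
proof -
  show "tensor_apply F (A + A') = tensor_apply F A + tensor_apply F A'"
    by (simp add: tensor_apply_def scaleR_add_left sum.distrib)
  show "tensor_apply (F - G) A = tensor_apply F A - tensor_apply G A"
    by (simp add: tensor_apply_def blinfun.diff_left scaleR_diff_right sum_subtractf)
  have "F x y = (\<Sum>i\<in>UNIV. x $ i *\<^sub>R F (axis i 1)) y"
    by (rule arg_cong[OF blinfun_axis_expansion])
  also have "\<dots> = (\<Sum>i\<in>UNIV. x $ i *\<^sub>R (\<Sum>j\<in>UNIV. y $ j *\<^sub>R F (axis i 1) (axis j 1)))"
    by (simp add: blinfun.sum_left blinfun.scaleR_left blinfun_axis_expansion[of "F (axis _ 1)" y])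
  finally show "tensor_apply F (outer x y) = F x y"
    by (simp add: tensor_apply_def outer_def scaleR_sum_right)
qed

text \<open>The additive analogue of the Euler estimate: halve the block and use that the powers of
  the halves sum to at most \<kappa> times the power of the whole. The constant solves
  \<open>c * \<kappa> + N = c\<close>.\<close>

lemma uniform_sewing:
  fixes A :: "real \<Rightarrow> real \<Rightarrow> 'b::real_normed_vector"
  assumes \<theta>: "1 < \<theta>" and N: "0 \<le> N" and w: "0 \<le> w"
    and self: "\<And>s. a \<le> s \<Longrightarrow> s \<le> b \<Longrightarrow> A s s = 0"
    and defect: "\<And>s u t. a \<le> s \<Longrightarrow> s \<le> u \<Longrightarrow> u \<le> t \<Longrightarrow> t \<le> b \<Longrightarrow>
      norm (A s t - A s u - A u t) \<le> N * (t - s) powr \<theta>"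
  shows "a + real (j + m) * w \<le> b \<Longrightarrow>
    norm ((\<Sum>i<m. A (a + real (j + i) * w) (a + real (Suc (j + i)) * w)) - A (a + real j * w) (a + real (j + m) * w))
      \<le> N / (1 - (2/3) powr (\<theta> - 1)) * (real m * w) powr \<theta>"
proof (induction m arbitrary: j rule: less_induct)
  case (less m)
  define \<kappa> :: real where "\<kappa> = (2/3) powr (\<theta> - 1)"
  have \<kappa>: "\<kappa> < 1"
    using \<theta> powr_less_mono2[of "\<theta> - 1" "2/3" 1] by (simp add: \<kappa>_def)
  define c where "c = N / (1 - \<kappa>)"
  have c: "0 \<le> c" "c * \<kappa> + N = c"
    using N \<kappa> by (auto simp: c_def field_simps)
  define x where "x k = a + real k * w" for k
  define S where "S j m = (\<Sum>i<m. A (x (j + i)) (x (Suc (j + i))))" for j m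
  have x: "a \<le> x k" "k \<le> l \<Longrightarrow> x k \<le> x l" for k l
    using w by (auto simp: x_def mult_right_mono)
  have "norm (S j m - A (x j) (x (j + m))) \<le> c * (real m * w) powr \<theta>"
  proof -
    consider "m = 0" | "m = 1" | "2 \<le> m"
      by linarith
    then show ?thesis
    proof cases
      case 1
      then show ?thesis
        using self[of "x j"] x(1)[of j] less.prems by (simp add: S_def x_def)
    next
      case 2
      then show ?thesis
        using c by (simp add: S_def)
    next
      case 3
      define l where "l = m div 2"
      define k where "k = m - l"
      have lk: "l < m" "k < m" "m = k + l" "3 * l \<le> 2 * m" "3 * k \<le> 2 * m"
        using 3 unfolding l_def k_def by presburger+
      have b: "x (j + m) \<le> b" "x (j + k) \<le> b"
        using less.prems x(2)[of "j + k" "j + m"] lk by (auto simp: x_def)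
      have split: "S j m = S j k + S (j + k) l"
        unfolding S_def lk(3) by (induction l) (auto simp: algebra_simps)
      have "S j m - A (x j) (x (j + m)) = (S j k - A (x j) (x (j + k)))
        + (S (j + k) l - A (x (j + k)) (x (j + k + l)))
        - (A (x j) (x (j + m)) - A (x j) (x (j + k)) - A (x (j + k)) (x (j + m)))"
        using split lk(3) by (simp add: add.assoc)
      also have "norm \<dots> \<le> (c * (real k * w) powr \<theta> + c * (real l * w) powr \<theta>) + N * (x (j + m) - x j) powr \<theta>"
      proof (intro order_trans[OF norm_triangle_ineq4 add_mono] norm_triangle_mono)
        show "norm (S j k - A (x j) (x (j + k))) \<le> c * (real k * w) powr \<theta>"
          using less.IH[OF lk(2), of j] b by (simp add: S_def x_def c_def \<kappa>_def)
        show "norm (S (j + k) l - A (x (j + k)) (x (j + k + l))) \<le> c * (real l * w) powr \<theta>"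
          using less.IH[OF lk(1), of "j + k"] less.prems lk(3) by (simp add: S_def x_def c_def \<kappa>_def add.assoc)
        show "norm (A (x j) (x (j + m)) - A (x j) (x (j + k)) - A (x (j + k)) (x (j + m))) \<le> N * (x (j + m) - x j) powr \<theta>"
          using b lk x by (intro defect) auto
      qed
      also have "\<dots> \<le> c * (\<kappa> * (real m * w) powr \<theta>) + N * (real m * w) powr \<theta>"
      proof (rule add_mono)
        have "real k * 3 \<le> 2 * real m" "real l * 3 \<le> 2 * real m"
          using lk(4,5) by linarith+
        from this[THEN mult_right_mono, OF w]
        have "(real k * w) powr \<theta> + (real l * w) powr \<theta> \<le> \<kappa> * (real k * w + real l * w) powr \<theta>"
          unfolding \<kappa>_def using w \<theta> lk(3) by (intro powr_split_le) (auto simp: algebra_simps)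
        also have "real k * w + real l * w = real m * w"
          unfolding lk(3) by (simp add: algebra_simps)
        finally show "c * (real k * w) powr \<theta> + c * (real l * w) powr \<theta> \<le> c * (\<kappa> * (real m * w) powr \<theta>)"
          using mult_left_mono[OF _ c(1)] by (simp add: distrib_left[symmetric])
      qed (simp add: x_def algebra_simps)
      also have "\<dots> = (c * \<kappa> + N) * (real m * w) powr \<theta>"
        by (simp add: algebra_simps)
      finally show ?thesis
        unfolding c(2) .
    qed
  qed
  then show ?case
    by (simp add: S_def x_def c_def \<kappa>_def)
qed

lemma sum_lessThan_split: "(\<Sum>i<N + m. f i) = (\<Sum>i<N. f i) + (\<Sum>i<m. f (N + i))" for f :: "nat \<Rightarrow> 'b::comm_monoid_add"
  by (induction m) (auto simp: add.assoc)

text \<open>Subdivide the interval from 0 to \<open>t\<close> so that \<open>s\<close> is a point of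
  the subdivision. The Riemann sums for \<open>It\<close> and \<open>Is\<close> then differ by a sum
  over equal steps between \<open>s\<close> and \<open>t\<close>, which sewing compares with
  \<open>A s t\<close>.\<close>

lemma rough_integral_increment:
  fixes X :: "real \<Rightarrow> real^'d" and XX :: "real \<Rightarrow> real \<Rightarrow> real^'d^'d"
    and Y :: "real \<Rightarrow> (real^'d) \<Rightarrow>\<^sub>L 'b::real_normed_vector"
    and Y' :: "real \<Rightarrow> (real^'d) \<Rightarrow>\<^sub>L ((real^'d) \<Rightarrow>\<^sub>L 'b)"
  defines "A \<equiv> \<lambda>s t. Y s (increment X s t) + tensor_apply (Y' s) (XX s t)"
  assumes \<theta>: "1 < \<theta>" and N: "0 \<le> N" and st: "0 \<le> s" "s < t"
    and Is: "has_rough_integral X XX Y Y' 0 s Is" and It: "has_rough_integral X XX Y Y' 0 t It"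
    and self: "\<And>r. s \<le> r \<Longrightarrow> r \<le> t \<Longrightarrow> A r r = 0"
    and defect: "\<And>r u q. s \<le> r \<Longrightarrow> r \<le> u \<Longrightarrow> u \<le> q \<Longrightarrow> q \<le> t \<Longrightarrow>
      norm (A r q - A r u - A u q) \<le> N * (q - r) powr \<theta>"
  shows "norm (It - Is - A s t) \<le> N / (1 - (2/3) powr (\<theta> - 1)) * (t - s) powr \<theta>"
proof (rule field_le_epsilon)
  fix e :: real
  assume e: "0 < e"
  obtain \<delta>1 where \<delta>1: "0 < \<delta>1" "\<And>n \<tau>. subdivision 0 s n \<tau> \<Longrightarrow> (\<And>i. i < n \<Longrightarrow> \<tau> (Suc i) - \<tau> i < \<delta>1) \<Longrightarrow>
      norm ((\<Sum>i<n. A (\<tau> i) (\<tau> (Suc i))) - Is) < e / 2"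
    using Is e unfolding has_rough_integral_def A_def by (meson half_gt_zero)
  obtain \<delta>2 where \<delta>2: "0 < \<delta>2" "\<And>n \<tau>. subdivision 0 t n \<tau> \<Longrightarrow> (\<And>i. i < n \<Longrightarrow> \<tau> (Suc i) - \<tau> i < \<delta>2) \<Longrightarrow>
      norm ((\<Sum>i<n. A (\<tau> i) (\<tau> (Suc i))) - It) < e / 2"
    using It e unfolding has_rough_integral_def A_def by (meson half_gt_zero)
  define \<delta> where "\<delta> = min \<delta>1 \<delta>2"
  have \<delta>: "0 < \<delta>"
    using \<delta>1 \<delta>2 by (simp add: \<delta>_def)
  obtain M :: nat where "(s + t) / \<delta> < real M"
    using reals_Archimedean2 by blast
  then have M: "s + t < real M * \<delta>"
    using \<delta> by (simp add: pos_divide_less_eq)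
  have M0: "0 < M"
    using M st by (cases M) auto
  \<comment> \<open>Subdivision points increase strictly, so the degenerate interval that arises for
    \<open>s = 0\<close> has no steps.\<close>
  define n where "n = (if s = 0 then 0 else M)"
  define w where "w = (t - s) / real M"
  define \<tau> where "\<tau> k = (if k \<le> n then real k * (s / real M) else s + real (k - n) * w)" for k
  have w: "0 < w" "w < \<delta>" "real M * w = t - s"
    using M M0 st by (auto simp: w_def field_simps)
  have \<tau>n: "\<tau> n = s"
    using M0 by (auto simp: \<tau>_def n_def)
  have \<tau>r: "\<tau> (n + i) = s + real i * w" for i
    using \<tau>n by (cases "i = 0") (auto simp: \<tau>_def)
  have left: "\<tau> i < \<tau> (Suc i)" "\<tau> (Suc i) - \<tau> i < \<delta>" if "i < n" for i
  proof -
    have s: "0 < s" "n = M"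
      using that st by (auto simp: n_def split: if_splits)
    have "\<tau> (Suc i) - \<tau> i = s / real M"
      using that by (simp add: \<tau>_def algebra_simps add_divide_distrib)
    moreover have "0 < s / real M" "s / real M < \<delta>"
      using s M M0 st by (auto simp: field_simps)
    ultimately show "\<tau> i < \<tau> (Suc i)" "\<tau> (Suc i) - \<tau> i < \<delta>"
      by auto
  qed
  have right: "\<tau> i < \<tau> (Suc i)" "\<tau> (Suc i) - \<tau> i < \<delta>" if "n \<le> i" for i
    using \<tau>r[of "i - n"] \<tau>r[of "Suc i - n"] that w by (auto simp: Suc_diff_le algebra_simps)
  have inc: "\<tau> i < \<tau> (Suc i)" "\<tau> (Suc i) - \<tau> i < \<delta>" for i
    using left[of i] right[of i] by (cases "i < n"; simp)+
  have \<tau>0: "\<tau> 0 = 0"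
    by (simp add: \<tau>_def)
  have sub: "subdivision 0 s n \<tau>" "subdivision 0 t (n + M) \<tau>"
    unfolding subdivision_def using inc \<tau>n \<tau>0 \<tau>r[of M] w by auto
  define R where "R = (\<Sum>i<n. A (\<tau> i) (\<tau> (Suc i)))"
  define S where "S = (\<Sum>i<M. A (s + real i * w) (s + real (Suc i) * w))"
  have S: "(\<Sum>i<n + M. A (\<tau> i) (\<tau> (Suc i))) = R + S"
    unfolding sum_lessThan_split R_def S_def using \<tau>r by (simp flip: add_Suc_right)
  have 1: "norm (R - Is) < e / 2"
    unfolding R_def using inc by (intro \<delta>1 sub) (auto simp: \<delta>_def)
  have 2: "norm (R + S - It) < e / 2"
    unfolding S[symmetric] using inc by (intro \<delta>2 sub) (auto simp: \<delta>_def)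
  have 3: "norm (S - A s t) \<le> N / (1 - (2/3) powr (\<theta> - 1)) * (t - s) powr \<theta>"
    using uniform_sewing[OF \<theta> N, of w s t A 0 M] w self defect by (simp add: S_def)
  have "It - Is - A s t = (R - Is) - (R + S - It) + (S - A s t)"
    by simp
  also have "norm \<dots> \<le> (e / 2 + e / 2) + N / (1 - (2/3) powr (\<theta> - 1)) * (t - s) powr \<theta>"
    using 1 2 3 by (intro norm_triangle_mono order_trans[OF norm_triangle_ineq4 add_mono]) auto
  finally show "norm (It - Is - A s t) \<le> N / (1 - (2/3) powr (\<theta> - 1)) * (t - s) powr \<theta> + e"
    by simp
qed

section \<open>Davie's expansion versus rough integrals\<close>

locale rough_equation = euler_flow T \<beta> K X XX "\<lambda>i y. blinfun_apply (\<sigma> y) (axis i 1)" D D2 D3 B h C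
  for T \<beta> K :: real and X :: "real \<Rightarrow> real^'d::finite" and XX :: "real \<Rightarrow> real \<Rightarrow> real^'d^'d"
    and \<sigma> :: "real^'e::finite \<Rightarrow> (real^'d) \<Rightarrow>\<^sub>L (real^'e)" and D D2 D3 B h C +
  assumes \<sigma>_diff: "\<And>y. \<sigma> differentiable (at y)"
begin

abbreviation "vf \<equiv> \<lambda>i y. blinfun_apply (\<sigma> y) (axis i 1)"

lemma \<sigma>_deriv: "(\<sigma> has_derivative frechet_derivative \<sigma> (at y)) (at y)"
  using \<sigma>_diff frechet_derivative_works by blast

lemma D_eq: "D i y a = frechet_derivative \<sigma> (at y) a (axis i 1)"
proof -
  have "(vf i has_derivative (\<lambda>a. frechet_derivative \<sigma> (at y) a (axis i 1))) (at y)"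
    by (rule bounded_linear.has_derivative[OF blinfun.bounded_linear_left \<sigma>_deriv])
  from fun_cong[OF has_derivative_unique[OF D this]] show ?thesis .
qed

lemma grad_mult_apply: "grad_mult \<sigma> y a = frechet_derivative \<sigma> (at y) (\<sigma> y a)"
  unfolding grad_mult_def using has_derivative_bounded_linear[OF \<sigma>_deriv]
  by (simp add: bounded_linear_Blinfun_apply)

text \<open>Links the two formulations: the one-step map of the scheme is the summand of the rough
  integral of \<open>\<sigma>\<close> along the path.\<close>

lemma Inc_eq: "Inc vf D s t y = \<sigma> y (increment X s t) + tensor_apply (grad_mult \<sigma> y) (XX s t)"
  unfolding Inc_def rough_increment_def tensor_apply_def grad_mult_apply D_eq
  by (simp flip: blinfun_axis_expansion)

text \<open>A common majorant for all bounds on \<open>\<sigma>\<close> and its Gubinelli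
  derivative; each passage from columns to the operator norm costs a factor
  \<open>CARD('d)\<close>.\<close>

definition Ls :: real where
  "Ls = real CARD('d) * B + 2 * real CARD('d)^2 * B^2"

lemma Ls: "0 \<le> Ls" "real CARD('d) * B \<le> Ls" "real CARD('d) * (real CARD('d) * (2 * B^2)) \<le> Ls"
  using B by (auto simp: Ls_def power2_eq_square)

lemma norm_\<sigma>_le: "norm (\<sigma> y) \<le> Ls"
  by (rule order_trans[OF norm_blinfun_axis_le[OF bound0] Ls(2)])

lemma \<sigma>_lipschitz: "norm (\<sigma> x - \<sigma> y) \<le> Ls * norm (x - y)"
proof -
  have "norm (\<sigma> x - \<sigma> y) \<le> real CARD('d) * (B * norm (x - y))"
    using regular_on_lipschitz[OF convex_UNIV regular_on_UNIV]
    by (intro norm_blinfun_axis_le) (simp add: blinfun.diff_left)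
  also have "\<dots> \<le> Ls * norm (x - y)"
    using mult_right_mono[OF Ls(2), of "norm (x - y)"] by (simp add: mult.assoc)
  finally show ?thesis .
qed

lemma norm_\<sigma>_deriv_le: "norm (frechet_derivative \<sigma> (at y) a) \<le> Ls * norm a"
proof -
  have "norm (frechet_derivative \<sigma> (at y) a) \<le> real CARD('d) * (B * norm a)"
    using bound1 by (intro norm_blinfun_axis_le) (simp add: D_eq)
  also have "\<dots> \<le> Ls * norm a"
    using mult_right_mono[OF Ls(2), of "norm a"] by (simp add: mult.assoc)
  finally show ?thesis .
qed

lemma \<sigma>_taylor: "norm (\<sigma> z - \<sigma> y - frechet_derivative \<sigma> (at y) (z - y)) \<le> Ls * norm (z - y)^2"
proof -
  have "norm (\<sigma> z - \<sigma> y - frechet_derivative \<sigma> (at y) (z - y)) \<le> real CARD('d) * (B * norm (z - y)^2)"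
    using regular_on_taylor[OF convex_UNIV regular_on_UNIV]
    by (intro norm_blinfun_axis_le) (simp add: blinfun.diff_left D_eq)
  also have "\<dots> \<le> Ls * norm (z - y)^2"
    using mult_right_mono[OF Ls(2), of "norm (z - y)^2"] by (simp add: mult.assoc)
  finally show ?thesis .
qed

lemma norm_grad_mult_le: "norm (grad_mult \<sigma> y) \<le> Ls"
proof -
  have "norm (D j y (vf i y)) \<le> 2 * B^2" for i j
  proof -
    have "norm (D j y (vf i y)) \<le> B * B"
      by (rule order_trans[OF bound1 mult_left_mono[OF bound0 B]])
    also have "\<dots> \<le> 2 * B^2"
      by (simp add: power2_eq_square)
    finally show ?thesis .
  qed
  then have "norm (grad_mult \<sigma> y) \<le> real CARD('d) * (real CARD('d) * (2 * B^2))"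
    by (intro norm_blinfun_axis_le) (simp add: grad_mult_apply D_eq)
  then show ?thesis
    using Ls(3) by linarith
qed

lemma grad_mult_lipschitz: "norm (grad_mult \<sigma> x - grad_mult \<sigma> y) \<le> Ls * norm (x - y)"
proof -
  have "norm (grad_mult \<sigma> x - grad_mult \<sigma> y) \<le> real CARD('d) * (real CARD('d) * (2 * B^2 * norm (x - y)))"
    using regular_on_second_lipschitz[OF convex_UNIV regular_on_UNIV]
    by (intro norm_blinfun_axis_le) (simp add: grad_mult_apply D_eq blinfun.diff_left)
  also have "\<dots> \<le> Ls * norm (x - y)"
    using mult_right_mono[OF Ls(3), of "norm (x - y)"] by (simp add: mult.assoc)
  finally show ?thesis .
qed

lemma norm_increment_le:
  assumes "0 \<le> s" "s \<le> t" "t \<le> T"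
  shows "norm (increment X s t) \<le> real CARD('d) * K * (t - s) powr \<beta>"
proof -
  have "norm (increment X s t) \<le> (\<Sum>i\<in>UNIV. \<bar>increment X s t $ i\<bar>)"
    by (rule norm_le_l1_cart)
  also have "\<dots> \<le> real CARD('d) * (K * (t - s) powr \<beta>)"
    using X_bound[OF assms] by (intro sum_bounded_above)
  finally show ?thesis
    by (simp add: mult.assoc)
qed

lemma norm_tensor_increment_le:
  assumes "0 \<le> s" "s \<le> t" "t \<le> T"
  shows "norm (tensor_apply F (XX s t)) \<le> real CARD('d)^2 * K * norm F * (t - s) powr (2 * \<beta>)"
proof -
  have "((t - s) powr \<beta>)^2 = (t - s) powr (2 * \<beta>)"
    by (cases "t = s") (auto simp: powr_power mult.commute)
  then show ?thesis
    using norm_tensor_apply_le[OF XX_bound[OF assms], of F] by (simp add: ac_simps)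
qed

text \<open>Freezing the integrand at \<open>s\<close> costs order \<open>\<beta> + 1\<close>, which
  is at least \<open>3 * \<beta>\<close> because \<beta> is below 1/2.\<close>

lemma drift_integral:
  fixes b :: "real^'e \<Rightarrow> real^'e"
  assumes b: "\<And>x y. norm (b x - b y) \<le> Lb * norm (x - y)" "0 \<le> Lb" and V: "continuous_on {0..T} V"
    and st: "0 \<le> s" "s \<le> t" "t \<le> T" "t - s \<le> 1" and c: "0 \<le> c"
    and hol: "\<And>r. s \<le> r \<Longrightarrow> r \<le> t \<Longrightarrow> norm (V r - V s) \<le> c * (t - s) powr \<beta>"
  shows "(\<lambda>r. b (V r)) integrable_on {0..t}"
    and "norm (integral {0..t} (\<lambda>r. b (V r)) - integral {0..s} (\<lambda>r. b (V r)) - (t - s) *\<^sub>R b (V s))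
      \<le> Lb * c * (t - s) powr (3 * \<beta>)"
proof -
  have cont_b: "continuous_on UNIV b"
    using b by (intro lipschitz_on_continuous_on[of Lb] lipschitz_onI) (auto simp: dist_norm)
  have cont: "continuous_on {0..T} (\<lambda>s. b (V s))"
    using continuous_on_compose2[OF cont_b V] by auto
  show int: "(\<lambda>r. b (V r)) integrable_on {0..t}"
    using st by (intro integrable_continuous_real continuous_on_subset[OF cont]) auto
  have int': "(\<lambda>r. b (V r)) integrable_on {s..t}"
    using st by (intro integrable_continuous_real continuous_on_subset[OF cont]) auto
  have "((\<lambda>r. b (V r) - b (V s)) has_integral (integral {s..t} (\<lambda>r. b (V r)) - (t - s) *\<^sub>R b (V s))) {s..t}"
    using has_integral_diff[OF integrable_integral[OF int'] has_integral_const_real[of "b (V s)" s t]] st by simp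
  then have "norm (integral {s..t} (\<lambda>r. b (V r)) - (t - s) *\<^sub>R b (V s)) \<le> (Lb * (c * (t - s) powr \<beta>)) * measure lborel {s..t}"
  proof (rule has_integral_bound_real[rotated 2])
    show "norm (b (V r) - b (V s)) \<le> Lb * (c * (t - s) powr \<beta>)" if "r \<in> {s..t} - {}" for r
      using that b(2) by (intro order_trans[OF b(1)] mult_left_mono hol) auto
  qed (use b c in auto)
  also have "\<dots> = Lb * c * ((t - s) powr \<beta> * (t - s))"
    using st by simp
  also have "\<dots> \<le> Lb * c * (t - s) powr (3 * \<beta>)"
  proof (rule mult_left_mono)
    have "(t - s) powr \<beta> * (t - s) = (t - s) powr (\<beta> + 1)"
      using st by (cases "t = s") (auto simp: powr_add)
    also have "\<dots> \<le> (t - s) powr (3 * \<beta>)"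
      using st \<beta> by (intro powr_mono') auto
    finally show "(t - s) powr \<beta> * (t - s) \<le> (t - s) powr (3 * \<beta>)" .
  qed (use b c in auto)
  finally show "norm (integral {0..t} (\<lambda>r. b (V r)) - integral {0..s} (\<lambda>r. b (V r)) - (t - s) *\<^sub>R b (V s))
      \<le> Lb * c * (t - s) powr (3 * \<beta>)"
    using Henstock_Kurzweil_Integration.integral_combine[OF st(1,2) int, symmetric] by simp
qed

text \<open>The summand of the rough integral is additive up to order \<open>3 * \<beta>\<close>, so
  the increment of the integral is the one-step map up to that order. Freezing the drift then gives
  the expansion.\<close>

theorem solves_rde_davie:
  assumes b: "\<And>x y. norm (b x - b y) \<le> Lb * norm (x - y)" "0 \<le> Lb"
    and sol: "solves_rde T \<beta> X XX b \<sigma> y0 V V'"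
  shows "davie b V" "continuous_on {0..T} V" "V 0 = y0"
proof -
  have holV: "holder T \<beta> V" and contr: "controlled T \<beta> X (\<lambda>t. \<sigma> (V t)) (\<lambda>t. grad_mult \<sigma> (V t))"
    and int: "\<And>t. t \<in> {0..T} \<Longrightarrow> \<exists>B I. ((\<lambda>s. b (V s)) has_integral B) {0..t} \<and>
        has_rough_integral X XX (\<lambda>s. \<sigma> (V s)) (\<lambda>s. grad_mult \<sigma> (V s)) 0 t I \<and> V t = y0 + B + I"
    using sol unfolding solves_rde_def controlled_def by blast+
  show cont: "continuous_on {0..T} V"
    using holder_continuous_on[OF holV] \<beta> by simp
  have rough: "has_rough_integral X XX (\<lambda>s. \<sigma> (V s)) (\<lambda>s. grad_mult \<sigma> (V s)) 0 t
      (V t - y0 - integral {0..t} (\<lambda>s. b (V s)))" if "t \<in> {0..T}" for t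
    using int[OF that] by (auto dest: integral_unique)
  \<comment> \<open>The only subdivision of the interval from 0 to 0 has no steps, and its empty sum
    forces the rough integral there to be 0.\<close>
  show "V 0 = y0"
  proof -
    have "norm (V 0 - y0) \<le> 0 + e" if "0 < e" for e
      using rough[of 0] T that unfolding has_rough_integral_def
      by (force simp: subdivision_def norm_minus_commute dest!: spec[of _ e] intro: less_imp_le)
    then have "norm (V 0 - y0) \<le> 0"
      by (rule field_le_epsilon)
    then show ?thesis
      by simp
  qed
  obtain cV where cV: "0 \<le> cV" "\<And>s t. 0 \<le> s \<Longrightarrow> s < t \<Longrightarrow> t \<le> T \<Longrightarrow> norm (increment V s t) \<le> cV * (t - s) powr \<beta>"
    using holder2D[OF holV[unfolded holder_def]] by blast
  have hol2: "holder2 T \<beta> (increment (\<lambda>t. grad_mult \<sigma> (V t)))"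
      "holder2 T (2 * \<beta>) (\<lambda>s t. increment (\<lambda>t. \<sigma> (V t)) s t - grad_mult \<sigma> (V s) (increment X s t))"
    using contr unfolding controlled_def holder_def by blast+
  obtain cG where cG: "0 \<le> cG" "\<And>s t. 0 \<le> s \<Longrightarrow> s < t \<Longrightarrow> t \<le> T \<Longrightarrow>
      norm (increment (\<lambda>t. grad_mult \<sigma> (V t)) s t) \<le> cG * (t - s) powr \<beta>"
    using holder2D[OF hol2(1)] by blast
  obtain cR where cR: "0 \<le> cR" "\<And>s t. 0 \<le> s \<Longrightarrow> s < t \<Longrightarrow> t \<le> T \<Longrightarrow>
      norm (increment (\<lambda>t. \<sigma> (V t)) s t - grad_mult \<sigma> (V s) (increment X s t)) \<le> cR * (t - s) powr (2 * \<beta>)"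
    using holder2D[OF hol2(2)] by blast
  define A where "A s t = \<sigma> (V s) (increment X s t) + tensor_apply (grad_mult \<sigma> (V s)) (XX s t)" for s t
  have A_self: "A s s = 0" if "0 \<le> s" "s \<le> T" for s
    using Inc_self[OF that] by (simp add: A_def flip: Inc_eq)
  define N where "N = cR * (real CARD('d) * K) + real CARD('d)^2 * K * cG"
  have N: "0 \<le> N"
    using cR cG K by (simp add: N_def)
  have defect: "norm (A s t - A s u - A u t) \<le> N * (t - s) powr (3 * \<beta>)"
    if st: "0 \<le> s" "s \<le> u" "u \<le> t" "t \<le> T" for s u t
  proof (cases "s = u \<or> u = t")
    case True
    then show ?thesis
      using A_self[of s] A_self[of t] st N by auto
  next
    case False
    then have su: "s < u" "u \<le> T" "0 \<le> u"
      using st by auto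
    define R where "R = increment (\<lambda>t. \<sigma> (V t)) s u - grad_mult \<sigma> (V s) (increment X s u)"
    define G where "G = increment (\<lambda>t. grad_mult \<sigma> (V t)) s u"
    \<comment> \<open>By Chen's relation only two products remain: the controlled remainder, of
      order \<open>2 * \<beta>\<close>, with the first level, and the increment of the Gubinelli
      derivative, of order \<beta>, with the second level.\<close>
    have "A s t - A s u - A u t = - (R (increment X u t)) - tensor_apply G (XX u t)"
      unfolding A_def R_def G_def chen[OF st] increment_add[of s u t, symmetric]
      by (simp add: tensor_apply_simps blinfun.add_right blinfun.diff_left increment_def[of "\<lambda>t. \<sigma> (V t)"]
          increment_def[of "\<lambda>t. grad_mult \<sigma> (V t)"])
    also have "norm \<dots> \<le> (cR * (t - s) powr (2 * \<beta>)) * (real CARD('d) * K * (t - s) powr \<beta>)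
      + real CARD('d)^2 * K * (cG * (t - s) powr \<beta>) * (t - s) powr (2 * \<beta>)"
    proof (rule order_trans[OF norm_triangle_ineq4 add_mono])
      have mono: "(u - s) powr a \<le> (t - s) powr a" "(t - u) powr a \<le> (t - s) powr a" if "0 \<le> a" for a
        using st that by (auto intro: powr_mono2)
      have "norm (R (increment X u t)) \<le> norm R * norm (increment X u t)"
        by (rule norm_blinfun)
      also have "\<dots> \<le> (cR * (t - s) powr (2 * \<beta>)) * (real CARD('d) * K * (t - s) powr \<beta>)"
      proof (rule mult_mono)
        show "norm R \<le> cR * (t - s) powr (2 * \<beta>)"
          unfolding R_def using cR(1) \<beta> by (intro order_trans[OF cR(2)[OF st(1) su(1,2)]] mult_left_mono mono) auto
        show "norm (increment X u t) \<le> real CARD('d) * K * (t - s) powr \<beta>"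
          using K \<beta> by (intro order_trans[OF norm_increment_le[OF su(3) st(3,4)]] mult_left_mono mono) auto
      qed (use cR in auto)
      finally show "norm (- (R (increment X u t))) \<le> (cR * (t - s) powr (2 * \<beta>)) * (real CARD('d) * K * (t - s) powr \<beta>)"
        by simp
      have "norm (tensor_apply G (XX u t)) \<le> real CARD('d)^2 * K * norm G * (t - u) powr (2 * \<beta>)"
        using su st by (intro norm_tensor_increment_le) auto
      also have "\<dots> \<le> real CARD('d)^2 * K * (cG * (t - s) powr \<beta>) * (t - s) powr (2 * \<beta>)"
      proof (intro mult_mono mult_left_mono)
        show "norm G \<le> cG * (t - s) powr \<beta>"
          unfolding G_def using cG(1) \<beta> by (intro order_trans[OF cG(2)[OF st(1) su(1,2)]] mult_left_mono mono) auto
      qed (use K cG \<beta> in \<open>auto intro: mono\<close>)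
      finally show "norm (tensor_apply G (XX u t)) \<le> real CARD('d)^2 * K * (cG * (t - s) powr \<beta>) * (t - s) powr (2 * \<beta>)" .
    qed
    also have "\<dots> = N * ((t - s) powr (2 * \<beta>) * (t - s) powr \<beta>)"
      by (simp add: N_def algebra_simps)
    also have "(t - s) powr (2 * \<beta>) * (t - s) powr \<beta> = (t - s) powr (3 * \<beta>)"
      by (simp flip: powr_add)
    finally show ?thesis .
  qed
  define c where "c = N / (1 - (2/3) powr (3 * \<beta> - 1))"
  have c0: "0 \<le> c"
    using N \<beta> powr_less_mono2[of "3 * \<beta> - 1" "2/3" 1] by (simp add: c_def)
  have "norm (V t - V s - Inc vf D s t (V s) - (t - s) *\<^sub>R b (V s)) \<le> (c + Lb * cV) * (t - s) powr (3 * \<beta>)"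
    if st: "0 \<le> s" "s \<le> t" "t \<le> T" "t - s \<le> 1" for s t
  proof (cases "s = t")
    case True
    then show ?thesis
      using Inc_self[of t vf D "V t"] st c0 b cV by simp
  next
    case False
    then have lt: "s < t"
      using st by simp
    define It where "It t = V t - y0 - integral {0..t} (\<lambda>s. b (V s))" for t
    have 1: "norm (It t - It s - A s t) \<le> c * (t - s) powr (3 * \<beta>)"
      unfolding A_def c_def It_def using \<beta> N lt st A_self defect unfolding A_def
      by (intro rough_integral_increment rough) auto
    have 2: "norm (integral {0..t} (\<lambda>r. b (V r)) - integral {0..s} (\<lambda>r. b (V r)) - (t - s) *\<^sub>R b (V s))
      \<le> Lb * cV * (t - s) powr (3 * \<beta>)"
    proof (rule drift_integral(2)[OF b cont st cV(1)])
      fix r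
      assume r: "s \<le> r" "r \<le> t"
      have "norm (V r - V s) \<le> cV * (r - s) powr \<beta>"
        using cV(2)[of s r] r st by (cases "r = s") (auto simp: increment_def)
      also have "\<dots> \<le> cV * (t - s) powr \<beta>"
        using cV(1) r \<beta> by (intro mult_left_mono powr_mono2) auto
      finally show "norm (V r - V s) \<le> cV * (t - s) powr \<beta>" .
    qed
    have eq: "V t - V s - Inc vf D s t (V s) - (t - s) *\<^sub>R b (V s) = (It t - It s - A s t)
      + (integral {0..t} (\<lambda>r. b (V r)) - integral {0..s} (\<lambda>r. b (V r)) - (t - s) *\<^sub>R b (V s))"
      by (simp add: It_def A_def Inc_eq)
    show ?thesis
      unfolding eq distrib_right by (rule norm_triangle_mono[OF 1 2])
  qed
  then show "davie b V"
    unfolding davie_def by (intro exI[of _ "c + Lb * cV"] exI[of _ 1]) auto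
qed

lemma subdivision_mono:
  assumes "subdivision s t n \<tau>" "i \<le> j" "j \<le> n"
  shows "\<tau> i \<le> \<tau> j"
  using assms(2,3)
proof (induction j rule: dec_induct)
  case (step k)
  have "\<tau> i \<le> \<tau> k"
    using step by simp
  also have "\<tau> k < \<tau> (Suc k)"
    using assms(1) step.prems by (simp add: subdivision_def)
  finally show ?case
    by simp
qed simp

text \<open>Terms of order at least \<open>2 * \<beta>\<close> in the expansion go into the
  controlled remainder, and Taylor's formula transfers this to \<open>\<sigma>(V)\<close>. The path
  minus its drift integral telescopes over any subdivision, and each summand of the rough integral
  misses its increment by order \<open>3 * \<beta>\<close>.\<close>

theorem davie_solves_rde:
  assumes b: "\<And>x y. norm (b x - b y) \<le> Lb * norm (x - y)" "0 \<le> Lb"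
    and V: "davie b V" "continuous_on {0..T} V"
  shows "solves_rde T \<beta> X XX b \<sigma> (V 0) V (\<lambda>t. \<sigma> (V t))"
proof -
  obtain c0 \<delta>0 where \<delta>0: "0 < \<delta>0" and dav: "\<And>s t. 0 \<le> s \<Longrightarrow> s \<le> t \<Longrightarrow> t \<le> T \<Longrightarrow> t - s \<le> \<delta>0 \<Longrightarrow>
     norm (V t - V s - Inc vf D s t (V s) - (t - s) *\<^sub>R b (V s)) \<le> c0 * (t - s) powr (3 * \<beta>)"
    using V(1) unfolding davie_def by blast
  define \<delta> where "\<delta> = min \<delta>0 1"
  define c where "c = max c0 0"
  have \<delta>: "0 < \<delta>" "\<delta> \<le> \<delta>0" "\<delta> \<le> 1"
    using \<delta>0 by (auto simp: \<delta>_def)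
  have c: "0 \<le> c"
    by (simp add: c_def)
  have dav: "norm (V t - V s - Inc vf D s t (V s) - (t - s) *\<^sub>R b (V s)) \<le> c * (t - s) powr (3 * \<beta>)"
    if "0 \<le> s" "s \<le> t" "t \<le> T" "t - s \<le> \<delta>" for s t
    using dav[of s t] that \<delta> mult_right_mono[of c0 c "(t - s) powr (3 * \<beta>)"] by (simp add: c_def)
  have "bounded (V ` {0..T})"
    using V(2) by (intro compact_imp_bounded compact_continuous_image) auto
  then obtain R where R: "\<And>s. s \<in> {0..T} \<Longrightarrow> norm (V s) \<le> R"
    unfolding bounded_iff by blast
  have R0: "0 \<le> R"
    using order_trans[OF norm_ge_zero R[of 0]] T by simp
  define M where "M = norm (b 0) + Lb * R"
  have bM: "norm (b (V s)) \<le> M" if "s \<in> {0..T}" for s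
    using norm_triangle_sub[of "b (V s)" "b 0"] b(1)[of "V s" 0] mult_left_mono[OF R[OF that] b(2)]
    unfolding M_def diff_zero by linarith
  have M: "0 \<le> M"
    using order_trans[OF norm_ge_zero bM[of 0]] T by simp
  have powr_le: "(t - s) powr a \<le> (t - s) powr a'" if "s \<le> t" "t - s \<le> \<delta>" "a' \<le> a" for s t a a' :: real
    using that \<delta> by (intro powr_mono') auto
  have powr_le1: "t - s \<le> (t - s) powr a" if "s \<le> t" "t - s \<le> \<delta>" "a \<le> 1" for s t a :: real
    using powr_le[of s t a 1] that by simp
  define cR where "cR = real CARD('d)^2 * K * Ls + M + c"
  have cR: "0 \<le> cR"
    using K Ls M c by (simp add: cR_def)
  have rem: "norm (increment V s t - \<sigma> (V s) (increment X s t)) \<le> cR * (t - s) powr (2 * \<beta>)"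
    if st: "0 \<le> s" "s \<le> t" "t \<le> T" "t - s \<le> \<delta>" for s t
  proof -
    have "increment V s t - \<sigma> (V s) (increment X s t) = tensor_apply (grad_mult \<sigma> (V s)) (XX s t)
      + (t - s) *\<^sub>R b (V s) + (V t - V s - Inc vf D s t (V s) - (t - s) *\<^sub>R b (V s))"
      by (simp add: Inc_eq increment_def)
    also have "norm \<dots> \<le> real CARD('d)^2 * K * Ls * (t - s) powr (2 * \<beta>) + M * (t - s) powr (2 * \<beta>) + c * (t - s) powr (2 * \<beta>)"
    proof (intro norm_triangle_mono)
      show "norm (tensor_apply (grad_mult \<sigma> (V s)) (XX s t)) \<le> real CARD('d)^2 * K * Ls * (t - s) powr (2 * \<beta>)"
        using K by (intro order_trans[OF norm_tensor_increment_le[OF st(1-3)]] mult_right_mono mult_left_mono norm_grad_mult_le) auto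
      have "norm ((t - s) *\<^sub>R b (V s)) \<le> (t - s) powr (2 * \<beta>) * M"
        using st \<beta> powr_le1[of s t "2 * \<beta>"] bM[of s] by (auto intro: mult_mono)
      then show "norm ((t - s) *\<^sub>R b (V s)) \<le> M * (t - s) powr (2 * \<beta>)"
        by (simp add: mult.commute)
      show "norm (V t - V s - Inc vf D s t (V s) - (t - s) *\<^sub>R b (V s)) \<le> c * (t - s) powr (2 * \<beta>)"
        using st c \<beta> by (intro order_trans[OF dav] mult_left_mono powr_le) auto
    qed
    finally show ?thesis
      by (simp add: cR_def algebra_simps)
  qed
  define cV where "cV = Ls * (real CARD('d) * K) + cR"
  have cV: "0 \<le> cV"
    using K Ls cR by (simp add: cV_def)
  have inc_V: "norm (V t - V s) \<le> cV * (t - s) powr \<beta>" if st: "0 \<le> s" "s \<le> t" "t \<le> T" "t - s \<le> \<delta>" for s t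
  proof -
    have "V t - V s = \<sigma> (V s) (increment X s t) + (increment V s t - \<sigma> (V s) (increment X s t))"
      by (simp add: increment_def)
    also have "norm \<dots> \<le> Ls * (real CARD('d) * K * (t - s) powr \<beta>) + cR * (t - s) powr \<beta>"
    proof (rule norm_triangle_mono)
      show "norm (\<sigma> (V s) (increment X s t)) \<le> Ls * (real CARD('d) * K * (t - s) powr \<beta>)"
        using Ls norm_\<sigma>_le norm_increment_le[OF st(1-3)] by (intro order_trans[OF norm_blinfun] mult_mono) auto
      show "norm (increment V s t - \<sigma> (V s) (increment X s t)) \<le> cR * (t - s) powr \<beta>"
        using st cR \<beta> by (intro order_trans[OF rem] mult_left_mono powr_le) auto
    qed
    finally show ?thesis
      by (simp add: cV_def algebra_simps)
  qed
  have X_le: "norm (increment X s t) \<le> real CARD('d) * K * T powr \<beta>" if st: "0 \<le> s" "s < t" "t \<le> T" for s t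
    using st K \<beta> by (intro order_trans[OF norm_increment_le] mult_left_mono powr_mono2) auto
  have V_le: "norm (increment V s t) \<le> 2 * R" if st: "0 \<le> s" "s < t" "t \<le> T" for s t
    using norm_triangle_ineq4[of "V t" "V s"] R[of s] R[of t] st by (simp add: increment_def)
  have F_le: "norm (F (increment X s t)) \<le> Ls * (real CARD('d) * K * T powr \<beta>)"
    if st: "0 \<le> s" "s < t" "t \<le> T" and F: "norm F \<le> Ls" for s t and F :: "(real^'d) \<Rightarrow>\<^sub>L 'b::real_normed_vector"
    using Ls by (intro order_trans[OF norm_blinfun] mult_mono F X_le st) auto
  have \<beta>0: "0 \<le> \<beta>" "0 \<le> 2 * \<beta>"
    using \<beta> by auto
  have holV: "holder T \<beta> V"
    unfolding holder_def using \<delta>(1) \<beta>0(1)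
  proof (rule holder2_local)
    show "norm (increment V s t) \<le> cV * (t - s) powr \<beta>" if "0 \<le> s" "s < t" "t \<le> T" "t - s \<le> \<delta>" for s t
      using inc_V[of s t] that by (simp add: increment_def)
  qed (rule V_le)
  have hol\<sigma>: "holder T \<beta> (\<lambda>t. \<sigma> (V t))"
    unfolding holder_def using \<delta>(1) \<beta>0(1)
  proof (rule holder2_local)
    show "norm (increment (\<lambda>t. \<sigma> (V t)) s t) \<le> Ls * cV * (t - s) powr \<beta>" if "0 \<le> s" "s < t" "t \<le> T" "t - s \<le> \<delta>" for s t
      using order_trans[OF \<sigma>_lipschitz mult_left_mono[OF inc_V Ls(1)]] that by (simp add: increment_def mult.assoc)
    show "norm (increment (\<lambda>t. \<sigma> (V t)) s t) \<le> Ls + Ls" for s t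
      unfolding increment_def by (intro order_trans[OF norm_triangle_ineq4 add_mono] norm_\<sigma>_le)
  qed
  have holG: "holder T \<beta> (\<lambda>t. grad_mult \<sigma> (V t))"
    unfolding holder_def using \<delta>(1) \<beta>0(1)
  proof (rule holder2_local)
    show "norm (increment (\<lambda>t. grad_mult \<sigma> (V t)) s t) \<le> Ls * cV * (t - s) powr \<beta>" if "0 \<le> s" "s < t" "t \<le> T" "t - s \<le> \<delta>" for s t
      using order_trans[OF grad_mult_lipschitz mult_left_mono[OF inc_V Ls(1)]] that by (simp add: increment_def mult.assoc)
    show "norm (increment (\<lambda>t. grad_mult \<sigma> (V t)) s t) \<le> Ls + Ls" for s t
      unfolding increment_def by (intro order_trans[OF norm_triangle_ineq4 add_mono] norm_grad_mult_le)
  qed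
  have remV: "holder2 T (2 * \<beta>) (\<lambda>s t. increment V s t - \<sigma> (V s) (increment X s t))"
    using \<delta>(1) \<beta>0(2)
  proof (rule holder2_local)
    show "norm (increment V s t - \<sigma> (V s) (increment X s t)) \<le> cR * (t - s) powr (2 * \<beta>)"
      if "0 \<le> s" "s < t" "t \<le> T" "t - s \<le> \<delta>" for s t
      using rem[of s t] that by simp
    show "norm (increment V s t - \<sigma> (V s) (increment X s t)) \<le> 2 * R + Ls * (real CARD('d) * K * T powr \<beta>)"
      if "0 \<le> s" "s < t" "t \<le> T" for s t
      by (intro order_trans[OF norm_triangle_ineq4 add_mono] V_le F_le norm_\<sigma>_le that)
  qed
  have rem\<sigma>: "holder2 T (2 * \<beta>) (\<lambda>s t. increment (\<lambda>t. \<sigma> (V t)) s t - grad_mult \<sigma> (V s) (increment X s t))"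
    using \<delta>(1) \<beta>0(2)
  proof (rule holder2_local)
    fix s t :: real
    assume "0 \<le> s" "s < t" "t \<le> T" "t - s \<le> \<delta>"
    then have st: "0 \<le> s" "s \<le> t" "t \<le> T" "t - s \<le> \<delta>"
      by auto
    let ?d = "frechet_derivative \<sigma> (at (V s))"
    have "increment (\<lambda>t. \<sigma> (V t)) s t - grad_mult \<sigma> (V s) (increment X s t)
      = (\<sigma> (V t) - \<sigma> (V s) - ?d (V t - V s)) + ?d (increment V s t - \<sigma> (V s) (increment X s t))"
      by (simp add: linear_diff[OF has_derivative_linear[OF \<sigma>_deriv]] grad_mult_apply increment_def)
    also have "norm \<dots> \<le> Ls * (cV * (t - s) powr \<beta>)^2 + Ls * (cR * (t - s) powr (2 * \<beta>))"
      using Ls(1) by (intro norm_triangle_mono order_trans[OF \<sigma>_taylor] order_trans[OF norm_\<sigma>_deriv_le]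
          mult_left_mono power_mono inc_V[OF st] rem[OF st] norm_ge_zero)
    also have "(cV * (t - s) powr \<beta>)^2 = cV^2 * (t - s) powr (2 * \<beta>)"
      by (cases "t = s") (auto simp: power_mult_distrib powr_power mult.commute)
    finally show "norm (increment (\<lambda>t. \<sigma> (V t)) s t - grad_mult \<sigma> (V s) (increment X s t))
      \<le> (Ls * cV^2 + Ls * cR) * (t - s) powr (2 * \<beta>)"
      by (simp add: algebra_simps)
  next
    fix s t :: real
    assume st: "0 \<le> s" "s < t" "t \<le> T"
    show "norm (increment (\<lambda>t. \<sigma> (V t)) s t - grad_mult \<sigma> (V s) (increment X s t))
      \<le> (Ls + Ls) + Ls * (real CARD('d) * K * T powr \<beta>)"
      unfolding increment_def[of "\<lambda>t. \<sigma> (V t)"]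
      by (intro order_trans[OF norm_triangle_ineq4 add_mono] F_le norm_\<sigma>_le norm_grad_mult_le st)
  qed
  have cont_b: "continuous_on UNIV b"
    using b by (intro lipschitz_on_continuous_on[of Lb] lipschitz_onI) (auto simp: dist_norm)
  define J where "J t = integral {0..t} (\<lambda>r. b (V r))" for t
  have int: "((\<lambda>r. b (V r)) has_integral J t) {0..t}" if "t \<in> {0..T}" for t
    unfolding J_def using that continuous_on_compose2[OF cont_b V(2)]
    by (intro integrable_integral integrable_continuous_real) (auto intro: continuous_on_subset)
  define cI where "cI = c + Lb * cV"
  have cI: "0 \<le> cI"
    using b c cV by (simp add: cI_def)
  have piece: "norm (\<sigma> (V s) (increment X s t) + tensor_apply (grad_mult \<sigma> (V s)) (XX s t) - ((V t - J t) - (V s - J s)))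
    \<le> cI * (t - s) powr (3 * \<beta>)" if st: "0 \<le> s" "s \<le> t" "t \<le> T" "t - s \<le> \<delta>" for s t
  proof -
    have "norm (V r - V s) \<le> cV * (t - s) powr \<beta>" if r: "s \<le> r" "r \<le> t" for r
    proof (rule order_trans[OF inc_V])
      show "cV * (r - s) powr \<beta> \<le> cV * (t - s) powr \<beta>"
        using cV r \<beta> by (intro mult_left_mono powr_mono2) auto
    qed (use r st in auto)
    then have 1: "norm (J t - J s - (t - s) *\<^sub>R b (V s)) \<le> Lb * cV * (t - s) powr (3 * \<beta>)"
      unfolding J_def using st \<delta> by (intro drift_integral(2)[OF b V(2) _ _ _ _ cV]) auto
    have eq: "\<sigma> (V s) (increment X s t) + tensor_apply (grad_mult \<sigma> (V s)) (XX s t) - ((V t - J t) - (V s - J s))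
      = (J t - J s - (t - s) *\<^sub>R b (V s)) - (V t - V s - Inc vf D s t (V s) - (t - s) *\<^sub>R b (V s))"
      by (simp add: Inc_eq)
    show ?thesis
      unfolding eq using order_trans[OF norm_triangle_ineq4 add_mono[OF 1 dav[OF st]]]
      by (simp add: cI_def algebra_simps)
  qed
  have rough: "has_rough_integral X XX (\<lambda>s. \<sigma> (V s)) (\<lambda>s. grad_mult \<sigma> (V s)) 0 t (V t - V 0 - J t)"
    if t: "t \<in> {0..T}" for t
    unfolding has_rough_integral_def
  proof (intro allI impI)
    fix e :: real
    assume e: "0 < e"
    define a where "a = 3 * \<beta> - 1"
    have a: "0 < a"
      using \<beta> by (simp add: a_def)
    \<comment> \<open>Chosen so that the total error \<open>cI * T * \<eta> powr a\<close> is at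
      most \<open>e / 2\<close>; adding 1 keeps the denominator positive even if \<open>cI\<close>
      is 0.\<close>
    define q where "q = e / (2 * (cI * T + 1))"
    have q: "0 < q"
      unfolding q_def using e cI T by (intro divide_pos_pos mult_pos_pos add_nonneg_pos) auto
    define \<eta> where "\<eta> = min \<delta> (q powr (1 / a))"
    have \<eta>: "0 < \<eta>" "\<eta> \<le> \<delta>"
      using \<delta> q by (auto simp: \<eta>_def)
    have "\<eta> powr a \<le> (q powr (1 / a)) powr a"
      using a \<eta> by (intro powr_mono2) (auto simp: \<eta>_def)
    also have "\<dots> = q"
      using a q by (simp add: powr_powr)
    also have "q = e / (2 * (cI * T + 1))"
      by (simp add: q_def)
    finally have "cI * T * \<eta> powr a \<le> cI * T * (e / (2 * (cI * T + 1)))"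
      using cI T by (intro mult_left_mono) auto
    also have "\<dots> = (cI * T / (cI * T + 1)) * (e / 2)"
      by simp
    also have "\<dots> \<le> e / 2"
    proof (rule mult_left_le_one_le)
      have "0 \<le> cI * T"
        using cI T by simp
      then show "cI * T / (cI * T + 1) \<le> 1" "0 \<le> cI * T / (cI * T + 1)"
        by (auto simp: divide_le_eq_1)
    qed (use e in simp)
    also have "\<dots> < e"
      using e by simp
    finally have small: "cI * T * \<eta> powr a < e" .
    show "\<exists>\<delta>>0. \<forall>n \<tau>. subdivision 0 t n \<tau> \<and> (\<forall>i<n. \<tau> (Suc i) - \<tau> i < \<delta>) \<longrightarrow>
      norm ((\<Sum>i<n. \<sigma> (V (\<tau> i)) (increment X (\<tau> i) (\<tau> (Suc i))) +
        tensor_apply (grad_mult \<sigma> (V (\<tau> i))) (XX (\<tau> i) (\<tau> (Suc i)))) - (V t - V 0 - J t)) < e"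
    proof (intro exI[of _ \<eta>] conjI allI impI)
      fix n \<tau>
      assume "subdivision 0 t n \<tau> \<and> (\<forall>i<n. \<tau> (Suc i) - \<tau> i < \<eta>)"
      then have sub: "subdivision 0 t n \<tau>" and mesh: "\<And>i. i < n \<Longrightarrow> \<tau> (Suc i) - \<tau> i < \<eta>"
        by auto
      define f where "f i = \<sigma> (V (\<tau> i)) (increment X (\<tau> i) (\<tau> (Suc i))) +
        tensor_apply (grad_mult \<sigma> (V (\<tau> i))) (XX (\<tau> i) (\<tau> (Suc i)))" for i
      define g where "g i = V (\<tau> i) - J (\<tau> i)" for i
      have "J 0 = 0"
        by (simp add: J_def)
      then have tele: "(\<Sum>i<n. g (Suc i) - g i) = V t - V 0 - J t"
        unfolding sum_lessThan_telescope using sub by (simp add: g_def subdivision_def)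
      have "norm ((\<Sum>i<n. f i) - (V t - V 0 - J t)) \<le> (\<Sum>i<n. norm (f i - (g (Suc i) - g i)))"
        unfolding tele[symmetric] sum_subtractf[symmetric] by (rule norm_sum)
      also have "\<dots> \<le> (\<Sum>i<n. cI * \<eta> powr a * (\<tau> (Suc i) - \<tau> i))"
      proof (rule sum_mono)
        fix i
        assume "i \<in> {..<n}"
        then have i: "i < n" "Suc i \<le> n"
          by auto
        have \<tau>: "0 \<le> \<tau> i" "\<tau> i \<le> \<tau> (Suc i)" "\<tau> (Suc i) \<le> T"
          using subdivision_mono[OF sub, of 0 i] subdivision_mono[OF sub, of i "Suc i"]
            subdivision_mono[OF sub, of "Suc i" n] i sub t by (auto simp: subdivision_def)
        have "norm (f i - (g (Suc i) - g i)) \<le> cI * (\<tau> (Suc i) - \<tau> i) powr (3 * \<beta>)"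
          unfolding f_def g_def using mesh[OF i(1)] \<eta> \<tau> by (intro piece) auto
        also have "(\<tau> (Suc i) - \<tau> i) powr (3 * \<beta>) = (\<tau> (Suc i) - \<tau> i) powr a * (\<tau> (Suc i) - \<tau> i)"
          using \<tau>(2) by (cases "\<tau> (Suc i) = \<tau> i") (auto simp: a_def powr_diff)
        also have "cI * \<dots> \<le> cI * (\<eta> powr a * (\<tau> (Suc i) - \<tau> i))"
          using cI \<tau>(2) mesh[OF i(1)] a by (intro mult_left_mono mult_right_mono powr_mono2) auto
        finally show "norm (f i - (g (Suc i) - g i)) \<le> cI * \<eta> powr a * (\<tau> (Suc i) - \<tau> i)"
          by (simp add: mult.assoc)
      qed
      also have "\<dots> = cI * \<eta> powr a * t"
        using sub by (simp add: sum_lessThan_telescope subdivision_def flip: sum_distrib_left)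
      also have "\<dots> \<le> cI * \<eta> powr a * T"
        using t cI by (intro mult_left_mono) auto
      finally show "norm ((\<Sum>i<n. \<sigma> (V (\<tau> i)) (increment X (\<tau> i) (\<tau> (Suc i))) +
        tensor_apply (grad_mult \<sigma> (V (\<tau> i))) (XX (\<tau> i) (\<tau> (Suc i)))) - (V t - V 0 - J t)) < e"
        using small by (simp add: f_def ac_simps)
    qed (use \<eta> in auto)
  qed
  have "\<exists>B I. ((\<lambda>s. b (V s)) has_integral B) {0..t} \<and>
        has_rough_integral X XX (\<lambda>s. \<sigma> (V s)) (\<lambda>s. grad_mult \<sigma> (V s)) 0 t I \<and> V t = V 0 + B + I"
    if t: "t \<in> {0..T}" for t
    using int[OF t] rough[OF t] by (intro exI[of _ "J t"] exI[of _ "V t - V 0 - J t"]) auto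
  then show ?thesis
    unfolding solves_rde_def controlled_def using holV hol\<sigma> holG remV rem\<sigma> by blast
qed

end

section \<open>The flow transformation\<close>

text \<open>In a norm weighted by \<open>exp (- \<mu> * s)\<close>, integration gains the factor
  \<open>1 / \<mu>\<close>; the summand \<open>a\<close> accommodates affine growth. This replaces
  Gronwall's lemma for the ordinary differential equation.\<close>

lemma has_integral_exp_bound:
  fixes f :: "real \<Rightarrow> 'a::euclidean_space"
  assumes f: "(f has_integral I) {0..t}" and t: "0 \<le> t" and \<mu>: "0 < \<mu>" and c: "0 \<le> c"
    and le: "\<And>s. 0 \<le> s \<Longrightarrow> s \<le> t \<Longrightarrow> norm (f s) \<le> a + c * exp (\<mu> * s)"
  shows "norm I \<le> a * t + c / \<mu> * exp (\<mu> * t)"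
proof -
  have "((\<lambda>s. a + c * exp (\<mu> * s)) has_integral ((a * t + c / \<mu> * exp (\<mu> * t)) - (a * 0 + c / \<mu> * exp (\<mu> * 0)))) {0..t}"
  proof (rule fundamental_theorem_of_calculus[OF t])
    fix s
    show "((\<lambda>s. a * s + c / \<mu> * exp (\<mu> * s)) has_vector_derivative (a + c * exp (\<mu> * s))) (at s within {0..t})"
      using \<mu> unfolding has_real_derivative_iff_has_vector_derivative[symmetric]
      by (auto intro!: derivative_eq_intros)
  qed
  then have g: "((\<lambda>s. a + c * exp (\<mu> * s)) has_integral (a * t + c / \<mu> * exp (\<mu> * t) - c / \<mu>)) {0..t}"
    by simp
  have "norm (integral {0..t} f) \<le> integral {0..t} (\<lambda>s. a + c * exp (\<mu> * s))"
    using f g le by (intro integral_norm_bound_integral) auto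
  then have "norm I \<le> a * t + c / \<mu> * exp (\<mu> * t) - c / \<mu>"
    using integral_unique[OF f] integral_unique[OF g] by simp
  then show ?thesis
    using c \<mu> divide_nonneg_pos[of c \<mu>] by linarith
qed

lemma continuous_on_superposition:
  fixes f :: "real \<Rightarrow> 'a::real_normed_vector \<Rightarrow> 'b::real_normed_vector"
  assumes cont: "\<And>z. continuous_on S (\<lambda>t. f t z)"
    and lip: "\<And>t z z'. t \<in> S \<Longrightarrow> norm (f t z - f t z') \<le> \<Lambda> * norm (z - z')"
    and Z: "continuous_on S Z"
  shows "continuous_on S (\<lambda>t. f t (Z t))"
  unfolding continuous_on_def
proof
  fix x
  assume x: "x \<in> S"
  have "((\<lambda>t. f t (Z t) - f t (Z x)) \<longlongrightarrow> 0) (at x within S)"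
  proof (rule Lim_null_comparison)
    show "\<forall>\<^sub>F t in at x within S. norm (f t (Z t) - f t (Z x)) \<le> \<Lambda> * norm (Z t - Z x)"
      using lip by (auto simp: eventually_at_filter)
    show "((\<lambda>t. \<Lambda> * norm (Z t - Z x)) \<longlongrightarrow> 0) (at x within S)"
      using Z x by (intro tendsto_mult_right_zero tendsto_norm_zero LIM_zero) (simp add: continuous_on_def)
  qed
  moreover have "((\<lambda>t. f t (Z x)) \<longlongrightarrow> f x (Z x)) (at x within S)"
    using cont x by (simp add: continuous_on_def)
  ultimately have "((\<lambda>t. f t (Z t) - f t (Z x) + f t (Z x)) \<longlongrightarrow> 0 + f x (Z x)) (at x within S)"
    by (rule tendsto_add)
  then show "((\<lambda>t. f t (Z t)) \<longlongrightarrow> f x (Z x)) (at x within S)"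
    by simp
qed

text \<open>The weight \<open>exp (- \<mu> t)\<close> makes the Picard map a contraction on the whole interval.
  Functions on \<open>{0..T}\<close> are represented by bounded continuous functions on the line, evaluated at \<open>max 0 (min T t)\<close>.\<close>

lemma picard_lipschitz:
  fixes f :: "real \<Rightarrow> 'a::euclidean_space \<Rightarrow> 'a"
  assumes T: "0 < T" and \<Lambda>: "0 < \<Lambda>"
    and cont: "\<And>z. continuous_on {0..T} (\<lambda>t. f t z)"
    and lip: "\<And>t z z'. t \<in> {0..T} \<Longrightarrow> norm (f t z - f t z') \<le> \<Lambda> * norm (z - z')"
  obtains Z where "continuous_on {0..T} Z"
    "\<And>t. t \<in> {0..T} \<Longrightarrow> ((\<lambda>s. f s (Z s)) has_integral (Z t - y0)) {0..t}"
proof -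
  define \<mu> where "\<mu> = 2 * \<Lambda>"
  have \<mu>: "0 < \<mu>"
    using \<Lambda> by (simp add: \<mu>_def)
  \<comment> \<open>\<open>u\<close> removes the weight: the fixed point will be the weighted path,
    and the choice \<open>\<mu> = 2 * \<Lambda>\<close> makes the contraction factor 1/2.\<close>
  define u :: "(real \<Rightarrow>\<^sub>C 'a) \<Rightarrow> real \<Rightarrow> 'a" where "u g s = exp (\<mu> * s) *\<^sub>R apply_bcontfun g s" for g s
  define P where "P g t = exp (- \<mu> * t) *\<^sub>R (y0 + integral {0..t} (\<lambda>s. f s (u g s)))" for g t
  define cl where "cl t = max 0 (min T t)" for t
  have cl: "cl t \<in> {0..T}" "t \<in> {0..T} \<Longrightarrow> cl t = t" for t
    using T by (auto simp: cl_def)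
  have u_cont: "continuous_on {0..T} (u g)" for g
    unfolding u_def using continuous_on_apply_bcontfun by (intro continuous_intros) auto
  have fu_cont: "continuous_on {0..T} (\<lambda>s. f s (u g s))" for g
    by (rule continuous_on_superposition[OF cont lip u_cont])
  have fu_int: "(\<lambda>s. f s (u g s)) integrable_on {0..t}" if "t \<in> {0..T}" for g t
    using that by (intro integrable_continuous_real continuous_on_subset[OF fu_cont]) auto
  have P_cont: "continuous_on {0..T} (P g)" for g
    unfolding P_def using T by (intro continuous_intros indefinite_integral_continuous_1 fu_int) auto
  have bc: "(\<lambda>t. P g (cl t)) \<in> bcontfun" for g
  proof -
    have "continuous_on UNIV (\<lambda>t. P g (cl t))"
    proof (rule continuous_on_compose2[OF P_cont])
      show "continuous_on UNIV cl"
        unfolding cl_def by (intro continuous_intros)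
    qed (use cl(1) in blast)
    moreover have "bounded (P g ` {0..T})"
      using P_cont by (intro compact_imp_bounded compact_continuous_image) auto
    then have "bounded (range (\<lambda>t. P g (cl t)))"
      by (rule bounded_subset) (use cl(1) in blast)
    ultimately show ?thesis
      by (simp add: bcontfun_def)
  qed
  define F where "F g = Bcontfun (\<lambda>t. P g (cl t))" for g
  have F: "apply_bcontfun (F g) t = P g (cl t)" for g t
    unfolding F_def using Bcontfun_inverse[OF bc] by simp
  have "dist (F g) (F g') \<le> 1/2 * dist g g'" for g g'
  proof (rule dist_bound)
    fix x
    define t where "t = cl x"
    have t: "t \<in> {0..T}"
      unfolding t_def by (rule cl(1))
    define I where "I = integral {0..t} (\<lambda>s. f s (u g s)) - integral {0..t} (\<lambda>s. f s (u g' s))"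
    have "((\<lambda>s. f s (u g s) - f s (u g' s)) has_integral I) {0..t}"
      unfolding I_def by (intro has_integral_diff integrable_integral fu_int t)
    then have "norm I \<le> 0 * t + \<Lambda> * dist g g' / \<mu> * exp (\<mu> * t)"
    proof (rule has_integral_exp_bound)
      fix s
      assume s: "0 \<le> s" "s \<le> t"
      have "norm (f s (u g s) - f s (u g' s)) \<le> \<Lambda> * norm (u g s - u g' s)"
        using s t by (intro lip) auto
      also have "norm (u g s - u g' s) = exp (\<mu> * s) * dist (apply_bcontfun g s) (apply_bcontfun g' s)"
        by (simp add: u_def dist_norm flip: scaleR_diff_right)
      also have "\<Lambda> * \<dots> \<le> \<Lambda> * (exp (\<mu> * s) * dist g g')"
        using \<Lambda> by (intro mult_left_mono dist_bounded) auto
      finally show "norm (f s (u g s) - f s (u g' s)) \<le> 0 + \<Lambda> * dist g g' * exp (\<mu> * s)"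
        by (simp add: ac_simps)
    qed (use t \<mu> \<Lambda> in auto)
    then have I: "norm I \<le> 1/2 * dist g g' * exp (\<mu> * t)"
      using \<Lambda> by (simp add: \<mu>_def)
    have "dist (apply_bcontfun (F g) x) (apply_bcontfun (F g') x) = exp (- \<mu> * t) * norm I"
      unfolding F t_def[symmetric] P_def dist_norm I_def by (simp flip: scaleR_diff_right)
    also have "\<dots> \<le> exp (- \<mu> * t) * (1/2 * dist g g' * exp (\<mu> * t))"
      using I by (intro mult_left_mono) auto
    also have "\<dots> = 1/2 * dist g g'"
      by (simp add: exp_minus)
    finally show "dist (apply_bcontfun (F g) x) (apply_bcontfun (F g') x) \<le> 1/2 * dist g g'" .
  qed
  then obtain g where g: "F g = g"
    using banach_fix_type[of "1/2" F] by auto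
  show ?thesis
  proof (rule that[OF u_cont[of g]])
    fix t
    assume t: "t \<in> {0..T}"
    have "u g t = exp (\<mu> * t) *\<^sub>R P g t"
      unfolding u_def using F[of g t] g cl(2)[OF t] by simp
    also have "\<dots> = y0 + integral {0..t} (\<lambda>s. f s (u g s))"
      by (simp add: P_def exp_minus)
    finally show "((\<lambda>s. f s (u g s)) has_integral (u g t - y0)) {0..t}"
      using fu_int[OF t, of g] by (simp add: integrable_integral)
  qed
qed

text \<open>Outside a large ball the right-hand side is frozen by the projection onto the ball, which makes it
  globally Lipschitz; the growth bound shows that the solution does not leave the ball.\<close>

lemma picard_locally_lipschitz:
  fixes f :: "real \<Rightarrow> 'a::euclidean_space \<Rightarrow> 'a"
  assumes T: "0 < T" and K: "0 < K"
    and cont: "\<And>z. continuous_on {0..T} (\<lambda>t. f t z)"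
    and growth: "\<And>t z. t \<in> {0..T} \<Longrightarrow> norm (f t z) \<le> K * (1 + norm z)"
    and lip: "\<And>t z z'. t \<in> {0..T} \<Longrightarrow> norm (f t z - f t z') \<le> K * (1 + norm z') * norm (z - z')"
  obtains Z where "\<And>t. t \<in> {0..T} \<Longrightarrow> ((\<lambda>s. f s (Z s)) has_integral (Z t - y0)) {0..t}"
proof -
  define \<mu> where "\<mu> = 2 * K"
  define A where "A = norm y0 + K * T"
  \<comment> \<open>The weighted maximum of the solution turns out to be at most
    \<open>2 * A\<close>, a bound that comes from the linear growth alone and so does not depend on
    the radius of projection.\<close>
  define R where "R = 2 * A * exp (\<mu> * T)"
  have \<mu>: "0 < \<mu>" and A: "0 \<le> A" and R: "0 \<le> R"
    using K T by (auto simp: \<mu>_def A_def R_def)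
  define \<pi> :: "'a \<Rightarrow> 'a" where "\<pi> = closest_point (cball 0 R)"
  have \<pi>_lip: "norm (\<pi> z - \<pi> z') \<le> norm (z - z')" for z z'
    using closest_point_lipschitz[of "cball 0 R" z z'] R by (simp add: \<pi>_def dist_norm)
  have \<pi>_self: "\<pi> z = z" if "norm z \<le> R" for z
    using that by (simp add: \<pi>_def closest_point_self)
  have \<pi>_norm: "norm (\<pi> z) \<le> norm z" "norm (\<pi> z) \<le> R" for z
    using \<pi>_lip[of z 0] \<pi>_self[of 0] R closest_point_in_set[of "cball 0 R" z] by (auto simp: \<pi>_def)
  have lip': "norm (f t (\<pi> z) - f t (\<pi> z')) \<le> K * (1 + R) * norm (z - z')" if "t \<in> {0..T}" for t z z'
    using K R by (intro order_trans[OF lip[OF that]] mult_mono add_left_mono \<pi>_norm \<pi>_lip mult_nonneg_nonneg) auto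
  obtain Z where Z: "continuous_on {0..T} Z"
    and int: "\<And>t. t \<in> {0..T} \<Longrightarrow> ((\<lambda>s. f s (\<pi> (Z s))) has_integral (Z t - y0)) {0..t}"
  proof (rule picard_lipschitz[where f = "\<lambda>t z. f t (\<pi> z)" and \<Lambda> = "K * (1 + R)" and T = T and ?y0.0 = y0])
    show "0 < K * (1 + R)"
      using K R by (intro mult_pos_pos add_pos_nonneg) auto
  qed (use T cont lip' in auto)
  have contE: "continuous_on {0..T} (\<lambda>s. norm (Z s) * exp (- \<mu> * s))"
    by (intro continuous_intros Z)
  have "{0..T} \<noteq> {}"
    using T by simp
  then obtain \<tau> where \<tau>: "\<tau> \<in> {0..T}" and max: "\<And>s. s \<in> {0..T} \<Longrightarrow> norm (Z s) * exp (- \<mu> * s) \<le> norm (Z \<tau>) * exp (- \<mu> * \<tau>)"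
    using continuous_attains_sup[OF compact_Icc _ contE] by blast
  define m where "m = norm (Z \<tau>) * exp (- \<mu> * \<tau>)"
  have m: "0 \<le> m"
    by (simp add: m_def)
  have Zm: "norm (Z s) \<le> m * exp (\<mu> * s)" if "s \<in> {0..T}" for s
  proof -
    have "norm (Z s) = norm (Z s) * exp (- \<mu> * s) * exp (\<mu> * s)"
      by (simp add: exp_minus)
    also have "\<dots> \<le> m * exp (\<mu> * s)"
      unfolding m_def by (rule mult_right_mono[OF max[OF that]]) simp
    finally show ?thesis .
  qed
  have "norm (Z \<tau> - y0) \<le> K * \<tau> + K * m / \<mu> * exp (\<mu> * \<tau>)"
  proof (rule has_integral_exp_bound[OF int[OF \<tau>]])
    fix s
    assume s: "0 \<le> s" "s \<le> \<tau>"
    have "norm (f s (\<pi> (Z s))) \<le> K * (1 + norm (\<pi> (Z s)))"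
      using s \<tau> by (intro growth) auto
    also have "\<dots> \<le> K * (1 + m * exp (\<mu> * s))"
      using K s \<tau> by (intro mult_left_mono add_left_mono order_trans[OF \<pi>_norm(1) Zm]) auto
    finally show "norm (f s (\<pi> (Z s))) \<le> K + K * m * exp (\<mu> * s)"
      by (simp add: algebra_simps)
  qed (use \<tau> \<mu> K m in auto)
  also have "K * m / \<mu> = m / 2"
    using K by (simp add: \<mu>_def)
  finally have "norm (Z \<tau>) \<le> norm y0 + K * \<tau> + m / 2 * exp (\<mu> * \<tau>)"
    using norm_triangle_sub[of "Z \<tau>" y0] by linarith
  moreover have "K * \<tau> \<le> K * T"
    using K \<tau> by (intro mult_left_mono) auto
  moreover have "norm (Z \<tau>) = m * exp (\<mu> * \<tau>)"
    by (simp add: m_def exp_minus)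
  ultimately have "m * exp (\<mu> * \<tau>) \<le> 2 * A"
    by (simp add: A_def)
  moreover have "m * 1 \<le> m * exp (\<mu> * \<tau>)"
    using m \<mu> \<tau> by (intro mult_left_mono) auto
  ultimately have "m \<le> 2 * A"
    by linarith
  then have "norm (Z s) \<le> R" if "s \<in> {0..T}" for s
    unfolding R_def using Zm[OF that] m A \<mu> that
    by (intro order_trans[OF Zm[OF that]] mult_mono) auto
  then have "((\<lambda>s. f s (Z s)) has_integral (Z t - y0)) {0..t}" if "t \<in> {0..T}" for t
    using that by (intro has_integral_eq[OF _ int[OF that]]) (auto simp: \<pi>_self)
  then show ?thesis
    by (rule that)
qed

lemma matrix_inv_right_inverse:
  fixes A :: "real^'n^'n"
  assumes "inj ((*v) A)"
  shows "A *v (matrix_inv A *v x) = x"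
proof -
  have "invertible A"
    using assms by (simp add: invertible_left_inverse matrix_left_invertible_injective)
  then have "\<exists>A'. A ** A' = mat 1 \<and> A' ** A = mat 1"
    unfolding invertible_def .
  then have "A ** matrix_inv A = mat 1"
    unfolding matrix_inv_def using someI_ex[of "\<lambda>A'. A ** A' = mat 1 \<and> A' ** A = mat 1"] by blast
  then show ?thesis
    by (simp add: matrix_vector_mul_assoc)
qed

section \<open>The driftless flow and the regularity of the transformed drift\<close>

context rough_equation
begin

lemma flow_continuous_on: "continuous_on {0..T} (\<lambda>t. flow 0 t y)"
proof (rule locally_holder_continuous_on[where \<delta> = "h / 2"])
  show "norm (flow 0 t y - flow 0 s y) \<le> C * (t - s) powr \<beta>" if "0 \<le> s" "s \<le> t" "t \<le> T" "t - s \<le> h / 2" for s t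
    using flow_holder[OF that, of "flow 0 s y"] flow_comp[of 0 s t y] that by simp
qed (use h \<beta> in auto)

lemma flow_davie: "davie (\<lambda>_. 0) (\<lambda>t. flow 0 t y)"
  unfolding davie_def
proof (intro exI conjI allI impI)
  fix s t
  assume st: "0 \<le> s \<and> s \<le> t \<and> t \<le> T \<and> t - s \<le> h / 2"
  then show "norm (flow 0 t y - flow 0 s y - Inc vf D s t (flow 0 s y) - (t - s) *\<^sub>R 0) \<le> C * (t - s) powr (3 * \<beta>)"
    using flow_expansion[of s t "flow 0 s y"] flow_comp[of 0 s t y] by simp
qed (use h in simp)

text \<open>The driftless equation is the case \<open>b = 0\<close>, with Lipschitz constant 0, of
  the existence and uniqueness results for Davie solutions.\<close>

lemma rde_flow_eq:
  assumes t: "t \<in> {0..T}"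
  shows "rde_flow T \<beta> X XX \<sigma> y t = flow 0 t y"
  unfolding rde_flow_def
proof (rule the_equality)
  have zero: "norm ((0::real^'e) - 0) \<le> 0 * norm (x - y)" for x y :: "real^'e"
    by simp
  have self: "flow 0 0 y = y"
    using flow_self[of 0] T by simp
  show "\<exists>Y Y'. solves_rde T \<beta> X XX (\<lambda>_. 0) \<sigma> y Y Y' \<and> flow 0 t y = Y t"
    using davie_solves_rde[OF zero _ flow_davie flow_continuous_on, of y] self by auto
  fix u
  assume "\<exists>Y Y'. solves_rde T \<beta> X XX (\<lambda>_. 0) \<sigma> y Y Y' \<and> u = Y t"
  then obtain Y Y' where sol: "solves_rde T \<beta> X XX (\<lambda>_. 0) \<sigma> y Y Y'" and u: "u = Y t"
    by blast
  show "u = flow 0 t y"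
    unfolding u using solves_rde_davie[OF zero _ sol] self
    by (intro davie_unique[OF _ _ flow_davie flow_continuous_on zero _ _ t]) auto
qed

lemma flow_jacobian_eq:
  assumes t: "t \<in> {0..T}"
  shows "flow_jacobian T \<beta> X XX \<sigma> z t *v a = Dflow 0 t z a"
proof -
  obtain L where L: "c11 L (flow 0 t) (Dflow 0 t)"
    using flow_c11 t by auto
  have "frechet_derivative (flow 0 t) (at z) = Dflow 0 t z"
    by (rule frechet_derivative_at[OF c11D(4)[OF L], symmetric])
  moreover have "(\<lambda>y. rde_flow T \<beta> X XX \<sigma> y t) = flow 0 t"
    using rde_flow_eq[OF t] by auto
  ultimately show ?thesis
    by (simp add: flow_jacobian_def jacobian_def matrix_works bounded_linear.linear[OF blinfun.bounded_linear_right])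
qed

context
  fixes b :: "real^'e \<Rightarrow> real^'e" and Lb :: real
  assumes b: "\<And>x y. norm (b x - b y) \<le> Lb * norm (x - y)" "0 \<le> Lb"
begin

abbreviation "W \<equiv> flow_drift T \<beta> X XX b \<sigma>"

text \<open>Replaces the inverse Jacobian in the estimates: together with the lower bound in
  \<open>c11\<close>, this equation carries the information on \<open>W\<close>.\<close>

lemma Dflow_drift:
  assumes t: "t \<in> {0..T}"
  shows "Dflow 0 t z (W t z) = b (flow 0 t z)"
proof -
  obtain L where L: "c11 L (flow 0 t) (Dflow 0 t)"
    using flow_c11 t by auto
  have "inj ((*v) (flow_jacobian T \<beta> X XX \<sigma> z t))"
  proof (rule injI)
    fix x y
    assume "flow_jacobian T \<beta> X XX \<sigma> z t *v x = flow_jacobian T \<beta> X XX \<sigma> z t *v y"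
    then have "Dflow 0 t z (x - y) = 0"
      unfolding flow_jacobian_eq[OF t] by (simp add: blinfun.diff_right)
    then show "x = y"
      using c11D(2)[OF L, of "x - y" z] by simp
  qed
  then show ?thesis
    unfolding flow_jacobian_eq[OF t, symmetric] flow_drift_def rde_flow_eq[OF t]
    by (rule matrix_inv_right_inverse)
qed

text \<open>Applying \<open>Dflow 0 t z\<close> to the difference of drifts leaves a difference of
  values of \<open>b\<close> and a difference of flow derivatives; the lower bound on the derivative
  brings this back.\<close>

lemma drift_diff_le:
  assumes L: "c11 L (flow 0 t) (Dflow 0 t)" "0 \<le> L" and st: "s \<in> {0..T}" "t \<in> {0..T}"
  shows "norm (W t z - W s z') \<le> L * (norm (b (flow 0 t z) - b (flow 0 s z'))
    + norm (Dflow 0 t z (W s z') - Dflow 0 s z' (W s z')))"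
proof -
  have eq: "Dflow 0 t z (W t z - W s z') = (b (flow 0 t z) - b (flow 0 s z'))
      - (Dflow 0 t z (W s z') - Dflow 0 s z' (W s z'))"
    using Dflow_drift st by (simp add: blinfun.diff_right)
  show ?thesis
    using c11D(2)[OF L(1), of "W t z - W s z'" z] unfolding eq
    by (rule order_trans) (rule mult_left_mono[OF norm_triangle_ineq4 L(2)])
qed

text \<open>The Lipschitz constant grows with \<open>z'\<close> because \<open>b\<close> may be
  unbounded: the variation of the flow derivative acts on \<open>W t z'\<close>, which has linear
  growth. Regularity in time comes from the flow being near the identity.\<close>

lemma drift_regularity:
  obtains k where "0 < k"
    "\<And>t z. t \<in> {0..T} \<Longrightarrow> norm (W t z) \<le> k * (1 + norm z)"
    "\<And>t z z'. t \<in> {0..T} \<Longrightarrow> norm (W t z - W t z') \<le> k * (1 + norm z') * norm (z - z')"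
    "\<And>s t z. 0 \<le> s \<Longrightarrow> s \<le> t \<Longrightarrow> t \<le> T \<Longrightarrow> t - s \<le> h / 2 \<Longrightarrow>
      norm (W t z - W s z) \<le> k * (1 + norm z) * (t - s) powr \<beta>"
proof -
  obtain L where L: "1 \<le> L" and c11: "\<And>s t. 0 \<le> s \<Longrightarrow> s \<le> t \<Longrightarrow> t \<le> T \<Longrightarrow> c11 L (flow s t) (Dflow s t)"
    using flow_c11 by blast
  have "bounded ((\<lambda>t. flow 0 t 0) ` {0..T})"
    using flow_continuous_on by (intro compact_imp_bounded compact_continuous_image) auto
  then obtain R where R: "\<And>t. t \<in> {0..T} \<Longrightarrow> norm (flow 0 t 0) \<le> R"
    unfolding bounded_iff by blast
  have R0: "0 \<le> R"
    using order_trans[OF norm_ge_zero R[of 0]] T by simp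
  define k1 where "k1 = L * (norm (b 0) + Lb * R + Lb * L)"
  have k1: "0 \<le> k1"
    using L b(2) R0 by (simp add: k1_def)
  have W1: "norm (W t z) \<le> k1 * (1 + norm z)" if t: "t \<in> {0..T}" for t z
  proof -
    have c: "c11 L (flow 0 t) (Dflow 0 t)"
      using c11 t by auto
    have "norm (flow 0 t z) \<le> R + L * norm z"
      using c11_lipschitz[OF c, of z 0] R[OF t] norm_triangle_sub[of "flow 0 t z" "flow 0 t 0"] L by simp
    then have "Lb * norm (flow 0 t z) \<le> Lb * (R + L * norm z)"
      using b(2) by (rule mult_left_mono)
    then have "norm (b (flow 0 t z)) \<le> norm (b 0) + Lb * (R + L * norm z)"
      using b(1)[of "flow 0 t z" 0] norm_triangle_sub[of "b (flow 0 t z)" "b 0"] by simp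
    also have "\<dots> \<le> (norm (b 0) + Lb * R + Lb * L) * (1 + norm z)"
      using b(2) R0 L by (simp add: algebra_simps add_increasing2)
    finally have "L * norm (b (flow 0 t z)) \<le> L * ((norm (b 0) + Lb * R + Lb * L) * (1 + norm z))"
      using L by (intro mult_left_mono) auto
    then show ?thesis
      using c11D(2)[OF c, of "W t z" z] Dflow_drift[OF t, of z] by (simp add: k1_def mult.assoc)
  qed
  define k where "k = 1 + k1 + L * (Lb * L + 6 * L * k1) + L * (Lb * C + C * L * k1)"
  have terms: "0 \<le> L * (Lb * L + 6 * L * k1)" "0 \<le> L * (Lb * C + C * L * k1)"
    using L C b(2) k1 by auto
  have k: "0 < k" "k1 \<le> k" "L * (Lb * L + 6 * L * k1) \<le> k" "L * (Lb * C + C * L * k1) \<le> k"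
    using terms k1 by (auto simp: k_def)
  \<comment> \<open>Both remaining estimates have this shape: one term without growth and one
    carrying the linear growth of \<open>W\<close>.\<close>
  have absorb: "L * (x * y + a * (k1 * (1 + norm z)) * y) \<le> k * (1 + norm z) * y"
    if "0 \<le> x" "0 \<le> a" "0 \<le> y" "L * (x + a * k1) \<le> k" for x a y and z :: "real^'e"
  proof -
    have "x \<le> x * (1 + norm z)"
      using that(1) by (simp add: distrib_left)
    then have "x + a * (k1 * (1 + norm z)) \<le> (x + a * k1) * (1 + norm z)"
      by (simp add: algebra_simps)
    then have "L * (x + a * (k1 * (1 + norm z))) \<le> L * ((x + a * k1) * (1 + norm z))"
      using L by (intro mult_left_mono) auto
    also have "\<dots> = L * (x + a * k1) * (1 + norm z)"
      by simp
    also have "\<dots> \<le> k * (1 + norm z)"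
      using that(4) by (intro mult_right_mono) auto
    finally have "L * (x + a * (k1 * (1 + norm z))) * y \<le> k * (1 + norm z) * y"
      using that(3) by (rule mult_right_mono)
    then show ?thesis
      by (simp add: algebra_simps)
  qed
  show ?thesis
  proof (rule that[OF k(1)])
    show "norm (W t z) \<le> k * (1 + norm z)" if "t \<in> {0..T}" for t z
      using k by (intro order_trans[OF W1[OF that]] mult_right_mono) auto
    show "norm (W t z - W t z') \<le> k * (1 + norm z') * norm (z - z')" if t: "t \<in> {0..T}" for t z z'
    proof -
      have c: "c11 L (flow 0 t) (Dflow 0 t)" and L0: "0 \<le> L"
        using c11 t L by auto
      have "norm (W t z - W t z') \<le> L * (norm (b (flow 0 t z) - b (flow 0 t z'))
        + norm (Dflow 0 t z (W t z') - Dflow 0 t z' (W t z')))"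
        by (rule drift_diff_le[OF c L0 t t])
      also have "\<dots> \<le> L * (Lb * (L * norm (z - z')) + 6 * L * norm (z - z') * (k1 * (1 + norm z')))"
        using L b(2) by (intro mult_left_mono add_mono order_trans[OF b(1)] order_trans[OF c11_derivative_lipschitz[OF c]]
            c11_lipschitz[OF c] W1[OF t]) auto
      also have "\<dots> = L * ((Lb * L) * norm (z - z') + (6 * L) * (k1 * (1 + norm z')) * norm (z - z'))"
        by (simp add: ac_simps)
      also have "\<dots> \<le> k * (1 + norm z') * norm (z - z')"
        using b(2) L k by (intro absorb) auto
      finally show ?thesis .
    qed
    show "norm (W t z - W s z) \<le> k * (1 + norm z) * (t - s) powr \<beta>" if st: "0 \<le> s" "s \<le> t" "t \<le> T" "t - s \<le> h / 2" for s t z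
    proof -
      have c: "c11 L (flow 0 t) (Dflow 0 t)" "c11 L (flow 0 s) (Dflow 0 s)" and L0: "0 \<le> L" and s: "s \<in> {0..T}" and t: "t \<in> {0..T}"
        using c11 st L by auto
      have comp: "Dflow 0 t z = Dflow s t (flow 0 s z) o\<^sub>L Dflow 0 s z" "flow 0 t z = flow s t (flow 0 s z)"
        using Dflow_comp[of 0 s t z] flow_comp[of 0 s t z] st by auto
      have "norm (W t z - W s z) \<le> L * (norm (b (flow 0 t z) - b (flow 0 s z))
        + norm (Dflow 0 t z (W s z) - Dflow 0 s z (W s z)))"
        by (rule drift_diff_le[OF c(1) L0 s t])
      also have "\<dots> \<le> L * (Lb * (C * (t - s) powr \<beta>) + C * (t - s) powr \<beta> * (L * (k1 * (1 + norm z))))"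
      proof (intro mult_left_mono add_mono)
        show "norm (b (flow 0 t z) - b (flow 0 s z)) \<le> Lb * (C * (t - s) powr \<beta>)"
          unfolding comp using b(2) by (intro order_trans[OF b(1)] mult_left_mono flow_holder[OF st])
        show "norm (Dflow 0 t z (W s z) - Dflow 0 s z (W s z)) \<le> C * (t - s) powr \<beta> * (L * (k1 * (1 + norm z)))"
          unfolding comp blinfun_apply_blinfun_compose using L C
          by (intro order_trans[OF Dflow_near_identity[OF st]] mult_left_mono order_trans[OF c11D(1)[OF c(2)]] W1[OF s]) auto
      qed (use L in auto)
      also have "\<dots> = L * ((Lb * C) * (t - s) powr \<beta> + (C * L) * (k1 * (1 + norm z)) * (t - s) powr \<beta>)"
        by (simp add: ac_simps)
      also have "\<dots> \<le> k * (1 + norm z) * (t - s) powr \<beta>"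
        using b(2) C L k by (intro absorb) auto
      finally show ?thesis .
    qed
  qed
qed

lemma flow_ode_solvable: "\<exists>Z. solves_flow_ode T \<beta> X XX b \<sigma> y0 Z"
proof -
  obtain k where k: "0 < k" "\<And>t z. t \<in> {0..T} \<Longrightarrow> norm (W t z) \<le> k * (1 + norm z)"
    "\<And>t z z'. t \<in> {0..T} \<Longrightarrow> norm (W t z - W t z') \<le> k * (1 + norm z') * norm (z - z')"
    "\<And>s t z. 0 \<le> s \<Longrightarrow> s \<le> t \<Longrightarrow> t \<le> T \<Longrightarrow> t - s \<le> h / 2 \<Longrightarrow>
      norm (W t z - W s z) \<le> k * (1 + norm z) * (t - s) powr \<beta>"
  proof (rule drift_regularity, goal_cases)
    case (1 k)
    show ?case
      by (rule 1(1)[OF 1(2-5)])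
  qed
  have cont: "continuous_on {0..T} (\<lambda>t. W t z)" for z
    by (rule locally_holder_continuous_on[where \<delta> = "h / 2", OF _ _ k(4)]) (use h \<beta> in auto)
  show ?thesis
  proof (rule picard_locally_lipschitz[OF T k(1) cont k(2,3), of y0], goal_cases)
    case (3 Z)
    then show ?case
      unfolding solves_flow_ode_def by (intro exI[of _ Z] ballI)
  qed
qed

text \<open>The chain rule for \<open>flow 0 t (Z t)\<close>: expand first \<open>flow 0 s\<close> between \<open>Z s\<close> and \<open>Z t\<close>, which produces the drift
  because \<open>Dflow 0 s\<close> maps \<open>W s\<close> to \<open>b\<close>, and then \<open>flow s t\<close>, whose derivative is close to the identity.\<close>

lemma flow_ode_davie:
  assumes ode: "solves_flow_ode T \<beta> X XX b \<sigma> y0 Z"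
  defines "V \<equiv> \<lambda>t. flow 0 t (Z t)"
  shows "davie b V" "continuous_on {0..T} V" "V 0 = y0"
proof -
  obtain k where k: "0 < k" and W1: "\<And>t z. t \<in> {0..T} \<Longrightarrow> norm (W t z) \<le> k * (1 + norm z)"
    and W2: "\<And>t z z'. t \<in> {0..T} \<Longrightarrow> norm (W t z - W t z') \<le> k * (1 + norm z') * norm (z - z')"
    and W3: "\<And>s t z. 0 \<le> s \<Longrightarrow> s \<le> t \<Longrightarrow> t \<le> T \<Longrightarrow> t - s \<le> h / 2 \<Longrightarrow>
      norm (W t z - W s z) \<le> k * (1 + norm z) * (t - s) powr \<beta>"
  proof (rule drift_regularity, goal_cases)
    case (1 k)
    show ?case
      by (rule 1(1)[OF 1(2-5)])
  qed
  obtain L where L: "1 \<le> L" and c11: "\<And>s t. 0 \<le> s \<Longrightarrow> s \<le> t \<Longrightarrow> t \<le> T \<Longrightarrow> c11 L (flow s t) (Dflow s t)"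
    using flow_c11 by blast
  have int: "((\<lambda>s. W s (Z s)) has_integral (Z t - y0)) {0..t}" if "t \<in> {0..T}" for t
    using ode that unfolding solves_flow_ode_def by blast
  have Z_eq: "Z t = y0 + integral {0..t} (\<lambda>s. W s (Z s))" if "t \<in> {0..T}" for t
    using integral_unique[OF int[OF that]] by simp
  have W_int: "(\<lambda>s. W s (Z s)) integrable_on {0..T}"
    using int[of T] T by auto
  have "continuous_on {0..T} (\<lambda>t. y0 + integral {0..t} (\<lambda>s. W s (Z s)))"
    by (intro continuous_intros indefinite_integral_continuous_1 W_int)
  then have Z_cont: "continuous_on {0..T} Z"
    by (rule continuous_on_eq) (rule Z_eq[symmetric])
  have "Z 0 = y0"
    using Z_eq[of 0] T by simp
  then show "V 0 = y0"
    using flow_self[of 0] T by (simp add: V_def)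
  have "bounded (Z ` {0..T})"
    using Z_cont by (intro compact_imp_bounded compact_continuous_image) auto
  then obtain R where R: "\<And>t. t \<in> {0..T} \<Longrightarrow> norm (Z t) \<le> R"
    unfolding bounded_iff by blast
  define M where "M = k * (1 + R)"
  have R0: "0 \<le> R"
    using order_trans[OF norm_ge_zero R[of 0]] T by simp
  have M: "0 < M" "k * (1 + norm (Z t)) \<le> M" if "t \<in> {0..T}" for t
  proof -
    show "0 < M"
      unfolding M_def using k R0 by (intro mult_pos_pos add_pos_nonneg) auto
    show "k * (1 + norm (Z t)) \<le> M"
      unfolding M_def using k R[OF that] by (intro mult_left_mono) auto
  qed
  have M0: "0 < M"
    using M(1)[of 0] T by simp
  have int': "((\<lambda>r. W r (Z r)) has_integral (Z t - Z s)) {s..t}" if st: "0 \<le> s" "s \<le> t" "t \<le> T" for s t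
  proof -
    have t: "(\<lambda>r. W r (Z r)) integrable_on {0..t}"
      using int[of t] st by auto
    then have "(\<lambda>r. W r (Z r)) integrable_on {s..t}"
      by (rule integrable_subinterval_real) (use st in auto)
    moreover have "integral {s..t} (\<lambda>r. W r (Z r)) = Z t - Z s"
      using Henstock_Kurzweil_Integration.integral_combine[OF st(1,2) t] Z_eq[of s] Z_eq[of t] st
      by (simp add: algebra_simps)
    ultimately show ?thesis
      by (simp add: has_integral_integrable_integral)
  qed
  have Z_lip: "norm (Z t - Z s) \<le> M * (t - s)" if st: "0 \<le> s" "s \<le> t" "t \<le> T" for s t
  proof -
    have "norm (Z t - Z s) \<le> M * measure lborel {s..t}"
    proof (rule has_integral_bound_real[OF _ _ int'[OF st]])
      show "norm (W r (Z r)) \<le> M" if "r \<in> {s..t} - {}" for r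
        using that st by (intro order_trans[OF W1 M(2)]) auto
    qed (use M0 in auto)
    then show ?thesis
      using st by simp
  qed
  have one: "(t - s) powr a \<le> (t - s) powr a'" if "s \<le> t" "t - s \<le> h / 2" "a' \<le> a" for s t a a' :: real
    using that h by (intro powr_mono') auto
  define N where "N = M * (M + 1)"
  have N: "0 \<le> N"
    using M0 by (simp add: N_def)
  have Z_exp: "norm (Z t - Z s - (t - s) *\<^sub>R W s (Z s)) \<le> N * (t - s) powr (3 * \<beta>)"
    if st: "0 \<le> s" "s \<le> t" "t \<le> T" "t - s \<le> h / 2" for s t
  proof -
    have s: "s \<in> {0..T}"
      using st by auto
    have "((\<lambda>r. W r (Z r) - W s (Z s)) has_integral (Z t - Z s - (t - s) *\<^sub>R W s (Z s))) {s..t}"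
      using has_integral_diff[OF int'[OF st(1-3)] has_integral_const_real[of "W s (Z s)" s t]] st by simp
    then have "norm (Z t - Z s - (t - s) *\<^sub>R W s (Z s)) \<le> (N * (t - s) powr \<beta>) * measure lborel {s..t}"
    proof (rule has_integral_bound_real[rotated 2])
      fix r
      assume "r \<in> {s..t} - {}"
      then have r: "s \<le> r" "r \<le> t" "r \<in> {0..T}" "r - s \<le> h / 2" "r \<le> T"
        using st by auto
      have d: "r - s \<le> (t - s) powr \<beta>" "(r - s) powr \<beta> \<le> (t - s) powr \<beta>"
        using one[of s r \<beta> 1] r \<beta> powr_mono2[of \<beta> "r - s" "t - s"] by auto
      have "norm (W r (Z r) - W s (Z s)) \<le> norm (W r (Z r) - W r (Z s)) + norm (W r (Z s) - W s (Z s))"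
        using norm_triangle_ineq[of "W r (Z r) - W r (Z s)" "W r (Z s) - W s (Z s)"] by simp
      also have "\<dots> \<le> M * (M * (r - s)) + M * (r - s) powr \<beta>"
      proof (rule add_mono)
        have "norm (W r (Z r) - W r (Z s)) \<le> k * (1 + norm (Z s)) * norm (Z r - Z s)"
          by (rule W2[OF r(3)])
        also have "\<dots> \<le> M * (M * (r - s))"
          using M(2)[OF s] Z_lip[OF st(1) r(1,5)] M0 by (intro mult_mono) auto
        finally show "norm (W r (Z r) - W r (Z s)) \<le> M * (M * (r - s))" .
        have "norm (W r (Z s) - W s (Z s)) \<le> k * (1 + norm (Z s)) * (r - s) powr \<beta>"
          by (rule W3[OF st(1) r(1,5,4)])
        also have "\<dots> \<le> M * (r - s) powr \<beta>"
          using M(2)[OF s] by (intro mult_right_mono) auto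
        finally show "norm (W r (Z s) - W s (Z s)) \<le> M * (r - s) powr \<beta>" .
      qed
      also have "\<dots> \<le> M * (M * (t - s) powr \<beta>) + M * (t - s) powr \<beta>"
        using d M0 by (intro add_mono mult_left_mono) auto
      finally show "norm (W r (Z r) - W s (Z s)) \<le> N * (t - s) powr \<beta>"
        by (simp add: N_def algebra_simps)
    qed (use N in auto)
    also have "\<dots> = N * (t - s) powr (\<beta> + 1)"
      using st by (cases "s = t") (auto simp: powr_add)
    also have "\<dots> \<le> N * (t - s) powr (3 * \<beta>)"
      using st \<beta> N by (intro mult_left_mono one) auto
    finally show ?thesis .
  qed
  have V_eq: "V t = flow s t (flow 0 s (Z t))" if "0 \<le> s" "s \<le> t" "t \<le> T" for s t
    using flow_comp[of 0 s t "Z t"] that by (simp add: V_def)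
  have \<eta>_le: "norm (flow 0 s (Z t) - V s) \<le> L * M * (t - s)" if st: "0 \<le> s" "s \<le> t" "t \<le> T" for s t
  proof -
    have "norm (flow 0 s (Z t) - V s) \<le> L * norm (Z t - Z s)"
      unfolding V_def using L st by (intro c11_lipschitz[OF c11]) auto
    also have "\<dots> \<le> L * (M * (t - s))"
      using L by (intro mult_left_mono Z_lip st) auto
    finally show ?thesis
      by simp
  qed
  show "continuous_on {0..T} V"
  proof (rule locally_holder_continuous_on[where \<delta> = "h / 2"])
    fix s t
    assume st: "0 \<le> s" "s \<le> t" "t \<le> T" "t - s \<le> h / 2"
    have "V t - V s = (flow s t (flow 0 s (Z t)) - flow s t (V s)) + (flow s t (V s) - V s)"
      using V_eq[OF st(1-3)] by simp
    also have "norm \<dots> \<le> L * (L * M * (t - s)) + C * (t - s) powr \<beta>"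
    proof (rule norm_triangle_mono)
      show "norm (flow s t (flow 0 s (Z t)) - flow s t (V s)) \<le> L * (L * M * (t - s))"
        using L c11_lipschitz[OF c11[OF st(1-3)]] mult_left_mono[OF \<eta>_le[OF st(1-3)], of L] by (meson order_trans zero_le_one)
    qed (rule flow_holder[OF st])
    also have "\<dots> \<le> L * (L * M * (t - s) powr \<beta>) + C * (t - s) powr \<beta>"
      using one[of s t \<beta> 1] st \<beta> L M0 by (intro add_right_mono mult_left_mono) auto
    finally show "norm (V t - V s) \<le> (L * (L * M) + C) * (t - s) powr \<beta>"
      by (simp add: algebra_simps)
  qed (use h \<beta> in auto)
  define c where "c = L * (L * M)^2 + C * (L * M) + (L * M^2 + L * N) + C"
  have "norm (V t - V s - Inc vf D s t (V s) - (t - s) *\<^sub>R b (V s)) \<le> c * (t - s) powr (3 * \<beta>)"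
    if st: "0 \<le> s" "s \<le> t" "t \<le> T" "t - s \<le> h / 2" for s t
  proof -
    define \<tau> where "\<tau> = (t - s) powr (3 * \<beta>)"
    have s: "s \<in> {0..T}" "s \<le> T"
      using st by auto
    have sq: "(t - s)^2 \<le> \<tau>"
    proof -
      have "(t - s)^2 = (t - s) powr 2"
        using st by (cases "s = t") auto
      also have "\<dots> \<le> \<tau>"
        unfolding \<tau>_def using st \<beta> by (intro one) auto
      finally show ?thesis .
    qed
    have \<beta>1: "(t - s) powr \<beta> * (t - s) \<le> \<tau>"
    proof -
      have "(t - s) powr \<beta> * (t - s) = (t - s) powr (\<beta> + 1)"
        using st by (cases "s = t") (auto simp: powr_add)
      also have "\<dots> \<le> \<tau>"
        unfolding \<tau>_def using st \<beta> by (intro one) auto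
      finally show ?thesis .
    qed
    define x where "x = V s"
    define \<eta> where "\<eta> = flow 0 s (Z t) - x"
    define \<zeta> where "\<zeta> = Z t - Z s"
    have \<eta>: "norm \<eta> \<le> L * M * (t - s)"
      unfolding \<eta>_def x_def by (rule \<eta>_le[OF st(1-3)])
    have \<zeta>: "norm \<zeta> \<le> M * (t - s)"
      unfolding \<zeta>_def by (rule Z_lip[OF st(1-3)])
    have c0: "c11 L (flow 0 s) (Dflow 0 s)" and ct: "c11 L (flow s t) (Dflow s t)"
      using c11 st by auto
    have e1: "norm (flow 0 s (Z s + \<zeta>) - flow 0 s (Z s) - Dflow 0 s (Z s) \<zeta>) \<le> L * M^2 * \<tau>"
    proof -
      have "norm \<zeta> ^ 2 \<le> M^2 * (t - s)^2"
        using power_mono[OF \<zeta>, of 2] by (simp add: power_mult_distrib)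
      also have "\<dots> \<le> M^2 * \<tau>"
        using sq by (intro mult_left_mono) auto
      finally have "L * norm \<zeta> ^ 2 \<le> L * (M^2 * \<tau>)"
        using L by (intro mult_left_mono) auto
      then show ?thesis
        using c11D(3)[OF c0, of "Z s" \<zeta>] by (simp add: mult.assoc)
    qed
    have e2: "norm (Dflow 0 s (Z s) (\<zeta> - (t - s) *\<^sub>R W s (Z s))) \<le> L * N * \<tau>"
      unfolding mult.assoc \<zeta>_def \<tau>_def using L by (intro order_trans[OF c11D(1)[OF c0]] mult_left_mono Z_exp[OF st]) auto
    have e12: "norm (\<eta> - (t - s) *\<^sub>R b x) \<le> (L * M^2 + L * N) * \<tau>"
    proof -
      have eq: "\<eta> - (t - s) *\<^sub>R b x = (flow 0 s (Z s + \<zeta>) - flow 0 s (Z s) - Dflow 0 s (Z s) \<zeta>)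
        + Dflow 0 s (Z s) (\<zeta> - (t - s) *\<^sub>R W s (Z s))"
        using Dflow_drift[OF s(1), of "Z s"] by (simp add: \<eta>_def x_def V_def \<zeta>_def blinfun.diff_right blinfun.scaleR_right)
      show ?thesis
        unfolding eq distrib_right by (rule norm_triangle_mono[OF e1 e2])
    qed
    have e3: "norm (flow s t (x + \<eta>) - flow s t x - Dflow s t x \<eta>) \<le> L * (L * M)^2 * \<tau>"
    proof -
      have "norm \<eta> ^ 2 \<le> (L * M)^2 * (t - s)^2"
        using power_mono[OF \<eta>, of 2] by (simp add: power_mult_distrib)
      also have "\<dots> \<le> (L * M)^2 * \<tau>"
        using sq by (intro mult_left_mono) auto
      finally have "L * norm \<eta> ^ 2 \<le> L * ((L * M)^2 * \<tau>)"
        using L by (intro mult_left_mono) auto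
      then show ?thesis
        using c11D(3)[OF ct, of x \<eta>] by (simp add: mult.assoc)
    qed
    have e4: "norm (Dflow s t x \<eta> - \<eta>) \<le> C * (L * M) * \<tau>"
    proof -
      have "norm (Dflow s t x \<eta> - \<eta>) \<le> C * (t - s) powr \<beta> * (L * M * (t - s))"
        using C \<eta> by (intro order_trans[OF Dflow_near_identity[OF st]] mult_left_mono) auto
      also have "\<dots> = C * (L * M) * ((t - s) powr \<beta> * (t - s))"
        by simp
      also have "\<dots> \<le> C * (L * M) * \<tau>"
        using C L M0 \<beta>1 by (intro mult_left_mono) auto
      finally show ?thesis .
    qed
    have e5: "norm (flow s t x - x - Inc vf D s t x) \<le> C * \<tau>"
      unfolding \<tau>_def by (rule flow_expansion[OF st])
    have eq: "V t - x - Inc vf D s t x - (t - s) *\<^sub>R b x = (flow s t (x + \<eta>) - flow s t x - Dflow s t x \<eta>)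
      + (Dflow s t x \<eta> - \<eta>) + (\<eta> - (t - s) *\<^sub>R b x) + (flow s t x - x - Inc vf D s t x)"
      using V_eq[OF st(1-3)] by (simp add: \<eta>_def)
    have "norm (V t - x - Inc vf D s t x - (t - s) *\<^sub>R b x)
      \<le> L * (L * M)^2 * \<tau> + C * (L * M) * \<tau> + (L * M^2 + L * N) * \<tau> + C * \<tau>"
      unfolding eq by (intro norm_triangle_mono e3 e4 e12 e5)
    also have "\<dots> = c * \<tau>"
      by (simp add: c_def distrib_right)
    finally show ?thesis
      by (simp add: x_def \<tau>_def)
  qed
  then show "davie b V"
    unfolding davie_def using h by (intro exI[of _ c] exI[of _ "h / 2"]) auto
qed

text \<open>Every solution of the transformed equation yields, through the flow, a Davie solution
  starting at \<open>y0\<close>, so \<open>davie_unique\<close> settles both uniqueness and the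
  representation by an arbitrary \<open>Z\<close>.\<close>

theorem rde_well_posed:
  "\<exists>Y Y'. solves_rde T \<beta> X XX b \<sigma> y0 Y Y' \<and>
    (\<forall>V V'. solves_rde T \<beta> X XX b \<sigma> y0 V V' \<longrightarrow> (\<forall>t\<in>{0..T}. V t = Y t \<and> V' t = Y' t)) \<and>
    (\<exists>Z. solves_flow_ode T \<beta> X XX b \<sigma> y0 Z) \<and>
    (\<forall>Z. solves_flow_ode T \<beta> X XX b \<sigma> y0 Z \<longrightarrow>
       (\<forall>t\<in>{0..T}. Y t = rde_flow T \<beta> X XX \<sigma> (Z t) t))"
proof -
  obtain Z where Z: "solves_flow_ode T \<beta> X XX b \<sigma> y0 Z"
    using flow_ode_solvable by blast
  define Y where "Y t = flow 0 t (Z t)" for t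
  note Y = flow_ode_davie[OF Z, folded Y_def]
  have sol: "solves_rde T \<beta> X XX b \<sigma> y0 Y (\<lambda>t. \<sigma> (Y t))"
    using davie_solves_rde[OF b Y(1,2)] Y(3) by simp
  have unique: "V t = Y t" if "davie b V" "continuous_on {0..T} V" "V 0 = y0" "t \<in> {0..T}" for V t
    by (rule davie_unique[OF that(1,2) Y(1,2) b _ that(4)]) (simp add: that(3) Y(3))
  show ?thesis
  proof (rule exI[of _ Y], rule exI[of _ "\<lambda>t. \<sigma> (Y t)"], intro conjI allI impI ballI sol)
    fix V V' t
    assume V: "solves_rde T \<beta> X XX b \<sigma> y0 V V'" and t: "t \<in> {0..T}"
    show "V t = Y t"
      by (rule unique[OF solves_rde_davie[OF b V] t])
    then show "V' t = \<sigma> (Y t)"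
      using V t unfolding solves_rde_def by auto
  next
    show "\<exists>Z. solves_flow_ode T \<beta> X XX b \<sigma> y0 Z"
      using Z by blast
  next
    fix Z' t
    assume Z': "solves_flow_ode T \<beta> X XX b \<sigma> y0 Z'" and t: "t \<in> {0..T}"
    show "Y t = rde_flow T \<beta> X XX \<sigma> (Z' t) t"
      unfolding rde_flow_eq[OF t] using unique[OF flow_ode_davie[OF Z'] t] by simp
  qed
qed

end

end

section \<open>From the hypotheses to the constants of the locales\<close>

lemma norm_matrix_vector_le:
  fixes A :: "real^'n^'m"
  shows "norm (A *v x) \<le> real CARD('m) * norm A * norm x"
proof -
  have "norm (A *v x) \<le> (\<Sum>i\<in>UNIV. \<bar>(A *v x) $ i\<bar>)"
    by (rule norm_le_l1_cart)
  also have "\<dots> \<le> real CARD('m) * (norm A * norm x)"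
  proof (rule sum_bounded_above)
    fix i
    have "\<bar>(A *v x) $ i\<bar> \<le> norm (A $ i) * norm x"
      by (simp add: matrix_vector_mul_component Cauchy_Schwarz_ineq2)
    also have "\<dots> \<le> norm A * norm x"
      by (intro mult_right_mono Finite_Cartesian_Product.norm_nth_le) auto
    finally show "\<bar>(A *v x) $ i\<bar> \<le> norm A * norm x" .
  qed
  finally show ?thesis
    by (simp add: mult.assoc)
qed

lemma lipschitz_of_bounded_jacobian:
  fixes b :: "real^'n \<Rightarrow> real^'m"
  assumes diff: "\<forall>x. b differentiable (at x)" and bd: "bounded (range (\<lambda>x. jacobian b (at x)))"
  obtains L where "0 \<le> L" "\<And>x y. norm (b x - b y) \<le> L * norm (x - y)"
proof -
  obtain M where M: "\<And>x. norm (jacobian b (at x)) \<le> M"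
    using bd unfolding bounded_iff by blast
  have M0: "0 \<le> M"
    using order_trans[OF norm_ge_zero M] .
  have deriv: "(b has_derivative (\<lambda>h. jacobian b (at x) *v h)) (at x)" for x
    using diff jacobian_works by blast
  have "norm (jacobian b (at x) *v h) \<le> (real CARD('m) * M) * norm h" for x h
    using M by (intro order_trans[OF norm_matrix_vector_le] mult_right_mono mult_left_mono) auto
  then show ?thesis
    using that[of "real CARD('m) * M"] lipschitz_of_bounded_derivative[OF deriv] M0 by simp
qed

lemma geometric_rough_path_bounds:
  fixes X :: "real \<Rightarrow> real^'d" and XX :: "real \<Rightarrow> real \<Rightarrow> real^'d^'d"
  assumes T: "0 < T" and \<beta>: "1/3 < \<beta>" "\<beta> < 1/2" and rp: "geometric_rough_path T \<beta> X XX"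
  shows "\<exists>K. rough_path T \<beta> K X XX"
proof -
  have hX: "holder2 T \<beta> (increment X)" and hXX: "holder2 T (2 * \<beta>) XX"
    and chen: "\<And>s u t. 0 \<le> s \<Longrightarrow> s \<le> u \<Longrightarrow> u \<le> t \<Longrightarrow> t \<le> T \<Longrightarrow>
        XX s t = XX s u + XX u t + outer (increment X s u) (increment X u t)"
    using rp unfolding geometric_rough_path_def holder_def by blast+
  obtain c1 where c1: "0 \<le> c1" "\<And>s t. 0 \<le> s \<Longrightarrow> s < t \<Longrightarrow> t \<le> T \<Longrightarrow> norm (increment X s t) \<le> c1 * (t - s) powr \<beta>"
    using holder2D[OF hX] by blast
  obtain c2 where c2: "0 \<le> c2" "\<And>s t. 0 \<le> s \<Longrightarrow> s < t \<Longrightarrow> t \<le> T \<Longrightarrow> norm (XX s t) \<le> c2 * (t - s) powr (2 * \<beta>)"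
    using holder2D[OF hXX] by blast
  have diag: "XX t t = 0" if "0 \<le> t" "t \<le> T" for t
    using chen[of t t t] that by (simp add: outer_def increment_def vec_eq_iff)
  define K where "K = max c1 c2"
  have "rough_path T \<beta> K X XX"
  proof
    show "0 \<le> K"
      using c1 by (simp add: K_def)
    fix s t :: real and i j :: 'd
    assume st: "0 \<le> s" "s \<le> t" "t \<le> T"
    show "\<bar>increment X s t $ i\<bar> \<le> K * (t - s) powr \<beta>"
    proof (cases "s = t")
      case False
      have "\<bar>increment X s t $ i\<bar> \<le> c1 * (t - s) powr \<beta>"
        using component_le_norm_cart[of "increment X s t" i] c1(2)[of s t] st False by simp
      also have "\<dots> \<le> K * (t - s) powr \<beta>"
        by (intro mult_right_mono) (auto simp: K_def)
      finally show ?thesis .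
    qed (simp add: increment_def)
    show "\<bar>XX s t $ i $ j\<bar> \<le> K * ((t - s) powr \<beta>)^2"
    proof (cases "s = t")
      case False
      have "\<bar>XX s t $ i $ j\<bar> \<le> norm (XX s t)"
        by (rule order_trans[OF component_le_norm_cart Finite_Cartesian_Product.norm_nth_le])
      also have "\<dots> \<le> c2 * (t - s) powr (2 * \<beta>)"
        using c2(2)[of s t] st False by simp
      also have "\<dots> \<le> K * (t - s) powr (2 * \<beta>)"
        by (intro mult_right_mono) (auto simp: K_def)
      also have "(t - s) powr (2 * \<beta>) = ((t - s) powr \<beta>)^2"
        using st False by (simp add: powr_power mult.commute)
      finally show ?thesis .
    qed (use diag st in simp)
  qed (rule T \<beta> chen; assumption)+
  then show ?thesis
    by blast
qed

text \<open>Paths are represented by functions on the whole real line, which is why uniqueness is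
  asserted on \<open>{0..T}\<close>.\<close>

theorem proposition3p1:
  fixes T \<beta> :: real
    and X :: "real \<Rightarrow> real^'d" and XX :: "real \<Rightarrow> real \<Rightarrow> real^'d^'d"
    and b :: "real^'e \<Rightarrow> real^'e" and \<sigma> :: "real^'e \<Rightarrow> (real^'d) \<Rightarrow>\<^sub>L (real^'e)"
    and y0 :: "real^'e"
  assumes "T > 0"
    and "Cb 4 \<sigma>"
    and "\<forall>x. b differentiable (at x)"
    and "Cb 0 (\<lambda>x. jacobian b (at x))"
    and "1/3 < \<beta>" and "\<beta> < 1/2"
    and "geometric_rough_path T \<beta> X XX"
  shows "\<exists>Y Y'. solves_rde T \<beta> X XX b \<sigma> y0 Y Y' \<and>
    (\<forall>V V'. solves_rde T \<beta> X XX b \<sigma> y0 V V' \<longrightarrow> (\<forall>t\<in>{0..T}. V t = Y t \<and> V' t = Y' t)) \<and>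
    (\<exists>Z. solves_flow_ode T \<beta> X XX b \<sigma> y0 Z) \<and>
    (\<forall>Z. solves_flow_ode T \<beta> X XX b \<sigma> y0 Z \<longrightarrow>
       (\<forall>t\<in>{0..T}. Y t = rde_flow T \<beta> X XX \<sigma> (Z t) t))"
proof -
  obtain Lb where Lb: "0 \<le> Lb" "\<And>x y. norm (b x - b y) \<le> Lb * norm (x - y)"
    using lipschitz_of_bounded_jacobian[OF assms(3)] assms(4) by auto
  obtain K where rp: "rough_path T \<beta> K X XX"
    using geometric_rough_path_bounds[OF assms(1,5-7)] by blast
  have "Cb 4 (\<lambda>y. blinfun_apply (\<sigma> y) (axis i 1))" for i
    by (rule Cb_bounded_linear[OF blinfun.bounded_linear_left assms(2)])
  then obtain D D2 D3 B where sf: "smooth_fields (\<lambda>i y. blinfun_apply (\<sigma> y) (axis i 1)) D D2 D3 B"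
    using Cb_smooth_fields[of "\<lambda>i y. blinfun_apply (\<sigma> y) (axis i 1)"] by blast
  interpret rf: rough_flow T \<beta> K X XX "\<lambda>i y. blinfun_apply (\<sigma> y) (axis i 1)" D D2 D3 B
    using rp sf by (rule rough_flow.intro)
  have diff: "\<sigma> differentiable (at y)" for y
    using assms(2) by (simp add: eval_nat_numeral)
  obtain h C where "rough_equation T \<beta> K X XX \<sigma> D D2 D3 B h C"
  proof (rule rf.discrete_flow, goal_cases)
    case (1 h C)
    have "euler_flow T \<beta> K X XX (\<lambda>i y. blinfun_apply (\<sigma> y) (axis i 1)) D D2 D3 B h C"
      by (intro euler_flow.intro euler_flow_axioms.intro rf.rough_flow_axioms 1(2-))
    then show ?case
      using diff by (intro 1(1)) (simp add: rough_equation_def rough_equation_axioms_def)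
  qed
  then interpret rough_equation T \<beta> K X XX \<sigma> D D2 D3 B h C .
  show ?thesis
    by (rule rde_well_posed[OF Lb(2,1)])
qed

end
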